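(* Let $A$ be an $\Omega$-algebra over a field $F$ and let $V\subseteq\mathrm{End}_F(A)$ be a unital pointwise finite dimensional subalgebra closed in the finite topology. Let $\rho_{A,V}^\vee\colon\mathcal{B}^\square(A,V)^\circ\otimes A\to A$ be the action $b^*\otimes a\mapsto b^*(a_{(1)})a_{(0)}$, where $\rho_{A,V}(a)=a_{(0)}\otimes a_{(1)}$. If $\theta\colon\mathcal{B}^\square(A,V)^\circ\to{}_\square\mathcal{B}(A,V)$ is the unique bialgebra homomorphism such that $\psi_{A,V}(\theta\otimes\mathrm{id}_A)=\rho_{A,V}^\vee$, then $\theta$ is a bialgebra isomorphism. In particular, for any finite dimensional (unital associative) algebra $A$ and any finite dimensional coalgebra $C$ there are bialgebra isomorphisms $${}_\square\mathcal{B}(A)\cong\mathcal{B}^\square(A)^\circ,\qquad {}_{\blacksquare}\mathcal{B}(C)\cong\mathcal{B}^{\blacksquare}(C)^\circ .$$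
   Context: $F$ is a fixed field; everything is over $F$; coalgebras are coassociative and counital. $B^\circ$ is the finite dual (a bialgebra if $B$ is a bialgebra). $\Omega$ is a fixed set with two maps $s,t\colon\Omega\to\mathbb{Z}_+$. An $\Omega$-algebra is a vector space $A$ with a linear map $\omega_A\colon A^{\otimes s(\omega)}\to A^{\otimes t(\omega)}$ for every $\omega\in\Omega$, where $A^{\otimes 0}:=F$. Measurings and actions. For a coalgebra $P$ and linear $\psi\colon P\otimes A\to A$ put $\psi_0=\varepsilon_P$, $\psi_n(p\otimes a_1\otimes\dots\otimes a_n)=\psi(p_{(1)}\otimes a_1)\otimes\dots\otimes\psi(p_{(n)}\otimes a_n)$ for $n>0$; $\psi$ is a measuring if $\psi_{t(\omega)}(p\otimes\omega_A(x))=\omega_A(\psi_{s(\omega)}(p\otimes x))$ for all $\omega,p,x$. $\mathrm{cosupp}\,\psi=\{\psi(p\otimes(-))\mid p\in P\}$. An action of a bialgebra $B$ on $A$ is a unital left module structure $B\otimes A\to A$ that is a measuring. Comeasurings and coactions. For a unital associative algebra $Q$ and linear $\rho\colon A\to A\otimes Q$, $\rho(a)=a_{(0)}\otimes a_{(1)}$, put $\rho_0(\alpha)=\alpha1_Q$, $\rho_n(a_1\otimes\dots\otimes a_n)=(a_1)_{(0)}\otimes\dots\otimes(a_n)_{(0)}\otimes(a_1)_{(1)}\cdots(a_n)_{(1)}$ for $n>0$; $\rho$ is a comeasuring if $\rho_{t(\omega)}(\omega_A(x))=(\omega_A\otimes\mathrm{id}_Q)\rho_{s(\omega)}(x)$ for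 all $\omega,x$. $\mathrm{cosupp}\,\rho$ is the set of all maps $a\mapsto q^*(a_{(1)})a_{(0)}$, $q^*\in Q^*$. A coaction of a bialgebra $B$ on $A$ is a counital right comodule structure $A\to A\otimes B$ that is a comeasuring. $({}_\square\mathcal{B}(A,V),\psi_{A,V})$, the $V$-universal acting bialgebra, is the terminal object in the category of measurings $\psi\colon P\otimes A\to A$ with $\mathrm{cosupp}\,\psi\subseteq V$ ($P$ a coalgebra; morphisms are coalgebra maps $\varphi$ with $\psi_2(\varphi\otimes\mathrm{id}_A)=\psi_1$), with the unique bialgebra structure (extending its coalgebra structure) making $\psi_{A,V}$ an action; it is also universal (terminal) among actions of bialgebras with cosupport in $V$. $(\mathcal{B}^\square(A,V),\rho_{A,V})$, the $V$-universal coacting bialgebra, is the initial object in the category of comeasurings $\rho\colon A\to A\otimes Q$ with $\mathrm{cosupp}\,\rho\subseteq V$ ($Q$ a unital associative algebra; morphisms are unital algebra maps $\varphi$ with $(\mathrm{id}_A\otimes\varphi)\rho_1=\rho_2$), with the unique bialgebra structure (extending its algebra structure) making $\rho_{A,V}$ a coaction; it is also universal (initial) among coactions of bialgebras with cosupport in $V$. Both exist under the hypotheses of the claim. For a unital associative algebra $A$, viewed as an $\Omega$-algebra with $\Omega=\{\mu,u\}$ (multiplication $A\otimes A\to A$ and unit $F\to A$), ${}_\square\mathcal{B}(A):={}_\square\mathcal{B}(A,\mathrm{End}_F(A))$ and $\mathcal{B}^\square(A):=\mathcal{B}^\square(A,\mathrm{End}_F(A))$. For a coalgebra $C$, viewed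 as an $\Omega$-algebra with $\Omega=\{\Delta,\varepsilon\}$, ${}_{\blacksquare}\mathcal{B}(C):={}_\square\mathcal{B}(C,\mathrm{End}_F(C))$ and $\mathcal{B}^{\blacksquare}(C):=\mathcal{B}^\square(C,\mathrm{End}_F(C))$. The finite topology on $\mathrm{End}_F(A)$ has as base the sets $\{f\mid f(a_i)=b_i,\ 1\le i\le n\}$. $V$ is pointwise finite dimensional if $Va=\{v(a)\mid v\in V\}$ is finite dimensional for every $a\in A$. *)

theory Defs
  imports Main "HOL-Library.Function_Algebras" "HOL-Analysis.Abstract_Topology"
begin

section \<open>Vector spaces and linear maps\<close>

text \<open>
  The ground field is a type of class field. A vector space is a subspace \<open>carr\<close> of an
  ambient vector space structure on an Isabelle type, so that the linear algebra of
  \<^theory>\<open>HOL.Vector_Spaces\<close> applies and carriers of different sizes can share one type.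
\<close>

record ('f, 'v) vspace =
  scale :: "'f \<Rightarrow> 'v \<Rightarrow> 'v"
  carr :: "'v set"

definition is_vspace :: "('f::field, 'v::ab_group_add, 'm) vspace_scheme \<Rightarrow> bool" where
  "is_vspace V \<longleftrightarrow> vector_space (scale V) \<and> module.subspace (scale V) (carr V)"

definition fld :: "('f::field, 'f) vspace" where
  "fld = \<lparr>scale = (*), carr = UNIV\<rparr>"

definition fin_dim :: "('f::field \<Rightarrow> 'v::ab_group_add \<Rightarrow> 'v) \<Rightarrow> 'v set \<Rightarrow> bool" where
  "fin_dim sc S \<longleftrightarrow> (\<exists>E. finite E \<and> S \<subseteq> module.span sc E)"

definition lin_map :: "('f::field, 'v::ab_group_add, 'm) vspace_scheme \<Rightarrow>
    ('f, 'w::ab_group_add, 'n) vspace_scheme \<Rightarrow> ('v \<Rightarrow> 'w) \<Rightarrow> bool" where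
  "lin_map V W h \<longleftrightarrow>
     (\<forall>x\<in>carr V. h x \<in> carr W) \<and>
     (\<forall>x\<in>carr V. \<forall>y\<in>carr V. h (x + y) = h x + h y) \<and>
     (\<forall>c. \<forall>x\<in>carr V. h (scale V c x) = scale W c (h x))"

text \<open>
  Elements of \<open>Hom V W\<close> are normalised to be \<open>0\<close> outside \<open>carr V\<close>, so that equality of
  functions is equality of linear maps and \<open>Hom V W\<close> is closed under pointwise operations.
\<close>

definition Hom :: "('f::field, 'v::ab_group_add, 'm) vspace_scheme \<Rightarrow>
    ('f, 'w::ab_group_add, 'n) vspace_scheme \<Rightarrow> ('v \<Rightarrow> 'w) set" where
  "Hom V W = {h. lin_map V W h \<and> (\<forall>x. x \<notin> carr V \<longrightarrow> h x = 0)}"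

definition zrestr :: "('f, 'v, 'm) vspace_scheme \<Rightarrow> ('v \<Rightarrow> 'w::zero) \<Rightarrow> 'v \<Rightarrow> 'w" where
  "zrestr V h = (\<lambda>x. if x \<in> carr V then h x else 0)"

definition bilinear :: "('f::field, 'v::ab_group_add, 'm) vspace_scheme \<Rightarrow>
    ('f, 'w::ab_group_add, 'n) vspace_scheme \<Rightarrow> ('f, 'u::ab_group_add, 'k) vspace_scheme \<Rightarrow>
    ('v \<Rightarrow> 'w \<Rightarrow> 'u) \<Rightarrow> bool" where
  "bilinear V W U \<beta> \<longleftrightarrow>
     (\<forall>v\<in>carr V. lin_map W U (\<beta> v)) \<and> (\<forall>w\<in>carr W. lin_map V U (\<lambda>v. \<beta> v w))"

definition tuples :: "('f, 'v, 'm) vspace_scheme \<Rightarrow> nat \<Rightarrow> 'v list set" where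
  "tuples V n = {xs. length xs = n \<and> set xs \<subseteq> carr V}"

definition multilinear :: "('f::field, 'v::ab_group_add, 'm) vspace_scheme \<Rightarrow> nat \<Rightarrow>
    ('f, 'u::ab_group_add, 'k) vspace_scheme \<Rightarrow> ('v list \<Rightarrow> 'u) \<Rightarrow> bool" where
  "multilinear V n U \<beta> \<longleftrightarrow>
     (\<forall>xs\<in>tuples V n. \<beta> xs \<in> carr U) \<and>
     (\<forall>xs\<in>tuples V n. \<forall>i<n. lin_map V U (\<lambda>x. \<beta> (xs[i := x])))"


section \<open>Tensor products\<close>

text \<open>
  The pure tensor \<open>v \<otimes> w\<close> is realised as evaluation at \<open>(v, w)\<close> on the space of bilinear forms
  on \<open>V \<times> W\<close>, and \<open>V \<otimes> W\<close> is the span of the pure tensors. Over a field this is a tensor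
  product of \<open>V\<close> and \<open>W\<close>: the universal property is \<open>tensor_universal\<close> below. Tensor powers
  are built likewise from multilinear forms; for \<open>n = 0\<close> this gives the one-dimensional
  space spanned by \<open>ptens V 0 []\<close>, playing the role of the ground field.
\<close>

definition fscale :: "'f::field \<Rightarrow> ('i \<Rightarrow> 'f) \<Rightarrow> 'i \<Rightarrow> 'f" where
  "fscale c f = (\<lambda>x. c * f x)"

type_synonym ('f, 'v, 'w) tens = "('v \<times> 'w \<Rightarrow> 'f) \<Rightarrow> 'f"
type_synonym ('f, 'v) tpow = "('v list \<Rightarrow> 'f) \<Rightarrow> 'f"

definition tens :: "('f::field, 'v::ab_group_add, 'm) vspace_scheme \<Rightarrow>
    ('f, 'w::ab_group_add, 'n) vspace_scheme \<Rightarrow> 'v \<Rightarrow> 'w \<Rightarrow> ('f, 'v, 'w) tens" where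
  "tens V W v w = (\<lambda>\<beta>. if bilinear V W fld (curry \<beta>) then \<beta> (v, w) else 0)"

definition tensor :: "('f::field, 'v::ab_group_add, 'm) vspace_scheme \<Rightarrow>
    ('f, 'w::ab_group_add, 'n) vspace_scheme \<Rightarrow> ('f, ('f, 'v, 'w) tens) vspace" where
  "tensor V W = \<lparr>scale = fscale,
     carr = module.span fscale {tens V W v w | v w. v \<in> carr V \<and> w \<in> carr W}\<rparr>"

definition ptens :: "('f::field, 'v::ab_group_add, 'm) vspace_scheme \<Rightarrow> nat \<Rightarrow>
    'v list \<Rightarrow> ('f, 'v) tpow" where
  "ptens V n xs = (\<lambda>\<beta>. if multilinear V n fld \<beta> then \<beta> xs else 0)"

definition tpower :: "('f::field, 'v::ab_group_add, 'm) vspace_scheme \<Rightarrow> nat \<Rightarrow>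
    ('f, ('f, 'v) tpow) vspace" where
  "tpower V n = \<lparr>scale = fscale, carr = module.span fscale (ptens V n ` tuples V n)\<rparr>"

text \<open>The linear map induced by a bilinear (multilinear) map.\<close>

definition tlift :: "('f::field, 'v::ab_group_add, 'm) vspace_scheme \<Rightarrow>
    ('f, 'w::ab_group_add, 'n) vspace_scheme \<Rightarrow> ('f, 'u::ab_group_add, 'k) vspace_scheme \<Rightarrow>
    ('v \<Rightarrow> 'w \<Rightarrow> 'u) \<Rightarrow> ('f, 'v, 'w) tens \<Rightarrow> 'u" where
  "tlift V W U \<beta> = (THE h. h \<in> Hom (tensor V W) U \<and>
     (\<forall>v\<in>carr V. \<forall>w\<in>carr W. h (tens V W v w) = \<beta> v w))"

definition plift :: "('f::field, 'v::ab_group_add, 'm) vspace_scheme \<Rightarrow> nat \<Rightarrow>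
    ('f, 'u::ab_group_add, 'k) vspace_scheme \<Rightarrow> ('v list \<Rightarrow> 'u) \<Rightarrow> ('f, 'v) tpow \<Rightarrow> 'u" where
  "plift V n U \<beta> = (THE h. h \<in> Hom (tpower V n) U \<and> (\<forall>xs\<in>tuples V n. h (ptens V n xs) = \<beta> xs))"

lemma vector_space_fscale: "vector_space (fscale :: 'f::field \<Rightarrow> ('i \<Rightarrow> 'f) \<Rightarrow> 'i \<Rightarrow> 'f)"
  by unfold_locales (auto simp: fscale_def fun_eq_iff algebra_simps)

lemma eval_span_universal:
  fixes U :: "('f::field, 'u::ab_group_add, 'k) vspace_scheme"
    and X :: "'x set" and M :: "('x \<Rightarrow> 'f) set" and G :: "'x \<Rightarrow> 'u"
  defines "E \<equiv> (\<lambda>x \<beta>. if \<beta> \<in> M then \<beta> x else 0)"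
  assumes U: "is_vspace U" and GU: "\<And>x. x \<in> X \<Longrightarrow> G x \<in> carr U"
    and M: "\<And>g. Vector_Spaces.linear (scale U) (*) g \<Longrightarrow> g \<circ> G \<in> M"
  shows "\<exists>!h. h \<in> Hom \<lparr>scale = fscale, carr = module.span fscale (E ` X)\<rparr> U \<and>
           (\<forall>x\<in>X. h (E x) = G x)"
proof -
  interpret T: vector_space "fscale :: 'f \<Rightarrow> (('x \<Rightarrow> 'f) \<Rightarrow> 'f) \<Rightarrow> _"
    by (rule vector_space_fscale)
  interpret U: vector_space "scale U" using U by (simp add: is_vspace_def)
  interpret F: vector_space "(*) :: 'f \<Rightarrow> 'f \<Rightarrow> 'f"
    by unfold_locales (auto simp: algebra_simps)
  interpret UF: vector_space_pair "scale U" "(*) :: 'f \<Rightarrow> 'f \<Rightarrow> 'f" ..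
  have sub: "U.subspace (carr U)" using U by (simp add: is_vspace_def)
  let ?L = "\<lambda>g. Vector_Spaces.linear (scale U) (*) g"
  let ?S = "T.span (E ` X)"
  let ?T = "\<lparr>scale = fscale, carr = ?S\<rparr>"
  have sep: "u = v" if "\<And>g. ?L g \<Longrightarrow> g u = g v" for u v
  proof (rule ccontr)
    assume "u \<noteq> v"
    then have "U.independent {u - v}" by (simp add: U.independent_insert U.independent_empty)
    from UF.linear_independent_extend[OF this, of "\<lambda>_. 1"]
    obtain g where g: "?L g" "g (u - v) = 1" by auto
    then interpret g: Vector_Spaces.linear "scale U" "(*)" g by simp
    from g(2) that[OF g(1)] show False by (simp add: g.diff)
  qed
  define R where "R = (\<lambda>t u. u \<in> carr U \<and> (\<forall>g. ?L g \<longrightarrow> g u = t (g \<circ> G)))"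
  have Ladd: "g (u + v) = g u + g v" and Lsc: "g (scale U c u) = c * g u" and L0: "g 0 = 0"
    if "?L g" for g c u v
  proof -
    interpret g: Vector_Spaces.linear "scale U" "(*)" g by (rule that)
    show "g (u + v) = g u + g v" "g (scale U c u) = c * g u" "g 0 = 0"
      by (simp_all add: g.add g.scale g.zero)
  qed
  have Radd: "R (s + t) (u + v)" if "R s u" "R t v" for s t u v
    using that by (simp add: R_def U.subspace_add[OF sub] Ladd)
  have Rsc: "R (fscale c s) (scale U c u)" if "R s u" for c s u
    using that by (simp add: R_def U.subspace_scale[OF sub] fscale_def Lsc)
  have R0: "R 0 0"
    by (simp add: R_def U.subspace_0[OF sub] L0)
  have RE: "R (E x) (G x)" if "x \<in> X" for x
    using that by (auto simp: R_def GU E_def M)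
  have Rex: "\<exists>u. R t u" if "t \<in> ?S" for t
    using that
  proof (induction rule: T.span_induct_alt)
    case base then show ?case using R0 by blast
  next
    case (step c x y) then show ?case using Radd Rsc RE by blast
  qed
  have Run: "u = v" if "R t u" "R t v" for t u v
    using that by (intro sep) (auto simp: R_def)
  define h where "h = (\<lambda>t. if t \<in> ?S then (THE u. R t u) else 0)"
  have hR: "R t (h t)" if "t \<in> ?S" for t
    unfolding h_def using that Rex[OF that] Run by (auto intro: theI2)
  have hHom: "h \<in> Hom ?T U"
    unfolding Hom_def lin_map_def
  proof (safe; simp)
    show "h t \<in> carr U" if "t \<in> ?S" for t using hR[OF that] by (simp add: R_def)
    show "h (s + t) = h s + h t" if "s \<in> ?S" "t \<in> ?S" for s t
      using Run[OF hR[OF T.span_add[OF that]] Radd[OF hR hR]] that by simp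
    show "h (fscale c s) = scale U c (h s)" if "s \<in> ?S" for c s
      using Run[OF hR[OF T.span_scale[OF that]] Rsc[OF hR]] that by simp
    show "h t = 0" if "t \<notin> ?S" for t using that by (simp add: h_def)
  qed
  have hE: "h (E x) = G x" if "x \<in> X" for x
    using Run[OF hR RE[OF that]] that by (simp add: T.span_base)
  show ?thesis
  proof (rule ex1I[of _ h])
    show "h \<in> Hom ?T U \<and> (\<forall>x\<in>X. h (E x) = G x)" using hHom hE by blast
    fix k assume k: "k \<in> Hom ?T U \<and> (\<forall>x\<in>X. k (E x) = G x)"
    have add: "\<And>s t. s \<in> ?S \<Longrightarrow> t \<in> ?S \<Longrightarrow> k (s + t) = k s + k t"
      and sc: "\<And>c s. s \<in> ?S \<Longrightarrow> k (fscale c s) = scale U c (k s)"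
      and out: "\<And>s. s \<notin> ?S \<Longrightarrow> k s = 0"
      using k by (auto simp: Hom_def lin_map_def)
    have add': "\<And>s t. s \<in> ?S \<Longrightarrow> t \<in> ?S \<Longrightarrow> h (s + t) = h s + h t"
      and sc': "\<And>c s. s \<in> ?S \<Longrightarrow> h (fscale c s) = scale U c (h s)"
      using hHom by (auto simp: Hom_def lin_map_def)
    have "t \<in> ?S \<and> k t = h t" if "t \<in> ?S" for t
      using that
    proof (induction rule: T.span_induct_alt)
      case base
      show ?case using sc[of 0 0] sc'[of 0 0] T.span_zero[of "E ` X"] T.scale_zero_left
        by (simp add: zero_fun_def)
    next
      case (step c x y)
      then obtain z where z: "z \<in> X" "x = E z" by auto
      have x: "x \<in> ?S" using step by (simp add: T.span_base)
      then have cx: "fscale c x \<in> ?S" by (simp add: T.span_scale)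
      have "k (fscale c x) = h (fscale c x)"
        using sc[OF x] sc'[OF x] k z hE by simp
      then show ?case
        using add[OF cx] add'[OF cx] step T.span_add[OF cx, of y] by (simp add: plus_fun_def)
    qed
    then show "k = h" using out by (auto simp: h_def fun_eq_iff)
  qed
qed

theorem tensor_universal:
  fixes U :: "('f::field, 'u::ab_group_add, 'k) vspace_scheme"
  assumes "is_vspace U" "bilinear V W U \<beta>"
  shows "\<exists>!h. h \<in> Hom (tensor V W) U \<and> (\<forall>v\<in>carr V. \<forall>w\<in>carr W. h (tens V W v w) = \<beta> v w)"
proof -
  let ?M = "{\<gamma>. bilinear V W fld (curry \<gamma>)}"
  have *: "g \<circ> case_prod \<beta> \<in> ?M" if "Vector_Spaces.linear (scale U) (*) g" for g
    using that assms(2)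
    by (auto simp: bilinear_def lin_map_def fld_def Vector_Spaces.linear_def
        module_hom.add module_hom.scale)
  have eq: "{tens V W v w | v w. v \<in> carr V \<and> w \<in> carr W} =
      (\<lambda>x \<gamma>. if \<gamma> \<in> ?M then \<gamma> x else 0) ` (carr V \<times> carr W)"
    by (force simp: tens_def)
  have "\<exists>!h. h \<in> Hom (tensor V W) U \<and>
      (\<forall>x\<in>carr V \<times> carr W. h (\<lambda>\<gamma>. if \<gamma> \<in> ?M then \<gamma> x else 0) = case_prod \<beta> x)"
    unfolding tensor_def eq
    using assms by (intro eval_span_universal *) (auto simp: bilinear_def lin_map_def)
  then show ?thesis by (simp add: tens_def)
qed

theorem tpower_universal:
  fixes U :: "('f::field, 'u::ab_group_add, 'k) vspace_scheme"
  assumes "is_vspace U" "multilinear V n U \<beta>"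
  shows "\<exists>!h. h \<in> Hom (tpower V n) U \<and> (\<forall>xs\<in>tuples V n. h (ptens V n xs) = \<beta> xs)"
proof -
  let ?M = "{\<gamma>. multilinear V n fld \<gamma>}"
  have *: "g \<circ> \<beta> \<in> ?M" if "Vector_Spaces.linear (scale U) (*) g" for g
    using that assms(2)
    by (auto simp: multilinear_def lin_map_def fld_def Vector_Spaces.linear_def
        module_hom.add module_hom.scale)
  have eq: "ptens V n = (\<lambda>x \<gamma>. if \<gamma> \<in> ?M then \<gamma> x else 0)"
    by (auto simp: ptens_def fun_eq_iff)
  show ?thesis
    unfolding tpower_def eq
    using assms by (intro eval_span_universal *) (auto simp: multilinear_def)
qed


section \<open>Algebras, coalgebras, bialgebras\<close>

record ('f, 'v) alg = "('f, 'v) vspace" +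
  mul :: "'v \<Rightarrow> 'v \<Rightarrow> 'v"
  one :: "'v"

record ('f, 'v) coalg = "('f, 'v) vspace" +
  comul :: "'v \<Rightarrow> ('f, 'v, 'v) tens"
  counit :: "'v \<Rightarrow> 'f"

record ('f, 'v) bialg = "('f, 'v) alg" +
  bcomul :: "'v \<Rightarrow> ('f, 'v, 'v) tens"
  bcounit :: "'v \<Rightarrow> 'f"

definition coalg_of :: "('f, 'v) bialg \<Rightarrow> ('f, 'v) coalg" where
  "coalg_of B = \<lparr>scale = scale B, carr = carr B, comul = bcomul B, counit = bcounit B\<rparr>"

definition algebra :: "('f::field, 'v::ab_group_add, 'm) alg_scheme \<Rightarrow> bool" where
  "algebra Q \<longleftrightarrow> is_vspace Q \<and> bilinear Q Q Q (mul Q) \<and> one Q \<in> carr Q \<and>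
     (\<forall>x\<in>carr Q. \<forall>y\<in>carr Q. \<forall>z\<in>carr Q. mul Q (mul Q x y) z = mul Q x (mul Q y z)) \<and>
     (\<forall>x\<in>carr Q. mul Q (one Q) x = x \<and> mul Q x (one Q) = x)"

text \<open>Coassociativity is stated in the tensor cube, which avoids an associator.\<close>

definition coalgebra :: "('f::field, 'v::ab_group_add, 'm) coalg_scheme \<Rightarrow> bool" where
  "coalgebra P \<longleftrightarrow> is_vspace P \<and> lin_map P (tensor P P) (comul P) \<and> lin_map P fld (counit P) \<and>
     (\<forall>p\<in>carr P.
        tlift P P (tpower P 3)
          (\<lambda>x y. tlift P P (tpower P 3) (\<lambda>x1 x2. ptens P 3 [x1, x2, y]) (comul P x)) (comul P p) =
        tlift P P (tpower P 3)
          (\<lambda>x y. tlift P P (tpower P 3) (\<lambda>y1 y2. ptens P 3 [x, y1, y2]) (comul P y)) (comul P p) \<and>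
        tlift P P P (\<lambda>x y. scale P (counit P x) y) (comul P p) = p \<and>
        tlift P P P (\<lambda>x y. scale P (counit P y) x) (comul P p) = p)"

definition tensor_mul :: "('f::field, 'v::ab_group_add, 'm) alg_scheme \<Rightarrow>
    ('f, 'v, 'v) tens \<Rightarrow> ('f, 'v, 'v) tens \<Rightarrow> ('f, 'v, 'v) tens" where
  "tensor_mul B s t =
     tlift B B (tensor B B)
       (\<lambda>x1 x2. tlift B B (tensor B B) (\<lambda>y1 y2. tens B B (mul B x1 y1) (mul B x2 y2)) t) s"

definition bialgebra :: "('f::field, 'v::ab_group_add) bialg \<Rightarrow> bool" where
  "bialgebra B \<longleftrightarrow> algebra B \<and> coalgebra (coalg_of B) \<and>
     (\<forall>x\<in>carr B. \<forall>y\<in>carr B.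
        bcomul B (mul B x y) = tensor_mul B (bcomul B x) (bcomul B y) \<and>
        bcounit B (mul B x y) = bcounit B x * bcounit B y) \<and>
     bcomul B (one B) = tens B B (one B) (one B) \<and> bcounit B (one B) = 1"

definition alg_hom :: "('f::field, 'v::ab_group_add, 'm) alg_scheme \<Rightarrow>
    ('f, 'w::ab_group_add, 'n) alg_scheme \<Rightarrow> ('v \<Rightarrow> 'w) \<Rightarrow> bool" where
  "alg_hom Q R \<phi> \<longleftrightarrow> \<phi> \<in> Hom Q R \<and>
     (\<forall>x\<in>carr Q. \<forall>y\<in>carr Q. \<phi> (mul Q x y) = mul R (\<phi> x) (\<phi> y)) \<and> \<phi> (one Q) = one R"

definition coalg_hom :: "('f::field, 'v::ab_group_add, 'm) coalg_scheme \<Rightarrow>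
    ('f, 'w::ab_group_add, 'n) coalg_scheme \<Rightarrow> ('v \<Rightarrow> 'w) \<Rightarrow> bool" where
  "coalg_hom P R \<phi> \<longleftrightarrow> \<phi> \<in> Hom P R \<and>
     (\<forall>p\<in>carr P. comul R (\<phi> p) = tlift P P (tensor R R) (\<lambda>x y. tens R R (\<phi> x) (\<phi> y)) (comul P p) \<and>
        counit R (\<phi> p) = counit P p)"

definition bialg_hom :: "('f::field, 'v::ab_group_add) bialg \<Rightarrow>
    ('f, 'w::ab_group_add) bialg \<Rightarrow> ('v \<Rightarrow> 'w) \<Rightarrow> bool" where
  "bialg_hom B C \<phi> \<longleftrightarrow> alg_hom B C \<phi> \<and> coalg_hom (coalg_of B) (coalg_of C) \<phi>"

definition bialg_iso :: "('f::field, 'v::ab_group_add) bialg \<Rightarrow>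
    ('f, 'w::ab_group_add) bialg \<Rightarrow> ('v \<Rightarrow> 'w) \<Rightarrow> bool" where
  "bialg_iso B C \<phi> \<longleftrightarrow> bialg_hom B C \<phi> \<and> bij_betw \<phi> (carr B) (carr C)"


section \<open>The finite dual\<close>

definition ideal :: "('f::field, 'v::ab_group_add, 'm) alg_scheme \<Rightarrow> 'v set \<Rightarrow> bool" where
  "ideal Q I \<longleftrightarrow> I \<subseteq> carr Q \<and> module.subspace (scale Q) I \<and>
     (\<forall>x\<in>carr Q. \<forall>y\<in>I. mul Q x y \<in> I \<and> mul Q y x \<in> I)"

definition cofinite :: "('f::field, 'v::ab_group_add, 'm) alg_scheme \<Rightarrow> 'v set \<Rightarrow> bool" where
  "cofinite Q I \<longleftrightarrow> (\<exists>E. finite E \<and> E \<subseteq> carr Q \<and>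
     (\<forall>x\<in>carr Q. \<exists>y\<in>module.span (scale Q) E. \<exists>z\<in>I. x = y + z))"

definition fdual_space :: "('f::field, 'v::ab_group_add, 'm) alg_scheme \<Rightarrow> ('f, 'v \<Rightarrow> 'f) vspace" where
  "fdual_space Q = \<lparr>scale = fscale,
     carr = {f \<in> Hom Q fld. \<exists>I. ideal Q I \<and> cofinite Q I \<and> (\<forall>x\<in>I. f x = 0)}\<rparr>"

text \<open>
  The comultiplication of \<open>f\<close> is the tensor \<open>f\<^sub>1 \<otimes> f\<^sub>2\<close> with \<open>f (x y) = f\<^sub>1 x * f\<^sub>2 y\<close>;
  the product is the convolution product.
\<close>

definition fdual :: "('f::field, 'v::ab_group_add) bialg \<Rightarrow> ('f, 'v \<Rightarrow> 'f) bialg" where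
  "fdual B = \<lparr>scale = scale (fdual_space B), carr = carr (fdual_space B),
     mul = (\<lambda>f g. zrestr B (\<lambda>x. tlift B B fld (\<lambda>x1 x2. f x1 * g x2) (bcomul B x))),
     one = zrestr B (bcounit B),
     bcomul = (\<lambda>f. THE t. t \<in> carr (tensor (fdual_space B) (fdual_space B)) \<and>
        (\<forall>x\<in>carr B. \<forall>y\<in>carr B.
           tlift (fdual_space B) (fdual_space B) fld (\<lambda>f1 f2. f1 x * f2 y) t = f (mul B x y))),
     bcounit = (\<lambda>f. f (one B))\<rparr>"


section \<open>Omega-algebras, measurings and comeasurings\<close>

record 'o sig =
  opset :: "'o set"
  src :: "'o \<Rightarrow> nat"
  tgt :: "'o \<Rightarrow> nat"

record ('f, 'v, 'o) oalg = "('f, 'v) vspace" +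
  oper :: "'o \<Rightarrow> ('f, 'v) tpow \<Rightarrow> ('f, 'v) tpow"

definition omega_algebra :: "'o sig \<Rightarrow> ('f::field, 'v::ab_group_add, 'o) oalg \<Rightarrow> bool" where
  "omega_algebra S A \<longleftrightarrow> is_vspace A \<and>
     (\<forall>\<omega>\<in>opset S. lin_map (tpower A (src S \<omega>)) (tpower A (tgt S \<omega>)) (oper A \<omega>))"

definition tcons :: "('f::field, 'v::ab_group_add, 'm) vspace_scheme \<Rightarrow> nat \<Rightarrow>
    'v \<Rightarrow> ('f, 'v) tpow \<Rightarrow> ('f, 'v) tpow" where
  "tcons V n v = plift V n (tpower V (Suc n)) (\<lambda>xs. ptens V (Suc n) (v # xs))"

text \<open>
  \<open>sweedler P n p\<close> is \<open>p\<^sub>1 \<otimes> \<dots> \<otimes> p\<^sub>n\<close>, and the counit of \<open>p\<close> for \<open>n = 0\<close>. Starting the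
  recursion at \<open>0\<close> gives \<open>p\<close> itself for \<open>n = 1\<close> by the counit law.
\<close>

primrec sweedler :: "('f::field, 'p::ab_group_add, 'm) coalg_scheme \<Rightarrow> nat \<Rightarrow> 'p \<Rightarrow> ('f, 'p) tpow"
  where
  "sweedler P 0 p = fscale (counit P p) (ptens P 0 [])"
| "sweedler P (Suc n) p =
     tlift P P (tpower P (Suc n)) (\<lambda>p1 p2. tcons P n p1 (sweedler P n p2)) (comul P p)"

text \<open>
  Linear maps \<open>P \<otimes> A \<rightarrow> A\<close> are given as bilinear maps \<open>\<psi>\<close>. The map \<open>meas_pow P A \<psi> n p\<close>
  sends \<open>a\<^sub>1 \<otimes> \<dots> \<otimes> a\<^sub>n\<close> to \<open>\<psi> p\<^sub>1 a\<^sub>1 \<otimes> \<dots> \<otimes> \<psi> p\<^sub>n a\<^sub>n\<close>; for \<open>n = 0\<close> it is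
  multiplication by the counit of \<open>p\<close>.
\<close>

definition meas_pow :: "('f::field, 'p::ab_group_add, 'm) coalg_scheme \<Rightarrow>
    ('f, 'a::ab_group_add, 'n) vspace_scheme \<Rightarrow> ('p \<Rightarrow> 'a \<Rightarrow> 'a) \<Rightarrow> nat \<Rightarrow> 'p \<Rightarrow>
    ('f, 'a) tpow \<Rightarrow> ('f, 'a) tpow" where
  "meas_pow P A \<psi> n p =
     plift A n (tpower A n)
       (\<lambda>as. plift P n (tpower A n) (\<lambda>ps. ptens A n (map2 \<psi> ps as)) (sweedler P n p))"

definition measuring :: "'o sig \<Rightarrow> ('f::field, 'a::ab_group_add, 'o) oalg \<Rightarrow>
    ('f, 'p::ab_group_add, 'm) coalg_scheme \<Rightarrow> ('p \<Rightarrow> 'a \<Rightarrow> 'a) \<Rightarrow> bool" where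
  "measuring S A P \<psi> \<longleftrightarrow> bilinear P A A \<psi> \<and>
     (\<forall>\<omega>\<in>opset S. \<forall>p\<in>carr P. \<forall>x\<in>carr (tpower A (src S \<omega>)).
        meas_pow P A \<psi> (tgt S \<omega>) p (oper A \<omega> x) = oper A \<omega> (meas_pow P A \<psi> (src S \<omega>) p x))"

definition meas_cosupp :: "('f, 'a::zero, 'n) vspace_scheme \<Rightarrow> ('f, 'p, 'm) vspace_scheme \<Rightarrow>
    ('p \<Rightarrow> 'a \<Rightarrow> 'a) \<Rightarrow> ('a \<Rightarrow> 'a) set" where
  "meas_cosupp A P \<psi> = {zrestr A (\<psi> p) | p. p \<in> carr P}"

definition action :: "'o sig \<Rightarrow> ('f::field, 'a::ab_group_add, 'o) oalg \<Rightarrow>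
    ('f, 'b::ab_group_add) bialg \<Rightarrow> ('b \<Rightarrow> 'a \<Rightarrow> 'a) \<Rightarrow> bool" where
  "action S A B \<psi> \<longleftrightarrow> measuring S A (coalg_of B) \<psi> \<and>
     (\<forall>a\<in>carr A. \<psi> (one B) a = a \<and>
        (\<forall>b\<in>carr B. \<forall>c\<in>carr B. \<psi> (mul B b c) a = \<psi> b (\<psi> c a)))"

primrec rho_list :: "('f::field, 'a::ab_group_add, 'n) vspace_scheme \<Rightarrow>
    ('f, 'q::ab_group_add, 'm) alg_scheme \<Rightarrow> ('a \<Rightarrow> ('f, 'a, 'q) tens) \<Rightarrow> 'a list \<Rightarrow>
    ('f, ('f, 'a) tpow, 'q) tens" where
  "rho_list A Q \<rho> [] = tens (tpower A 0) Q (ptens A 0 []) (one Q)"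
| "rho_list A Q \<rho> (a # as) = (let n = length as; T = tensor (tpower A (Suc n)) Q in
     tlift A Q T
       (\<lambda>a0 a1. tlift (tpower A n) Q T
          (\<lambda>x q. tens (tpower A (Suc n)) Q (tcons A n a0 x) (mul Q a1 q)) (rho_list A Q \<rho> as))
       (\<rho> a))"

definition comeas_pow :: "('f::field, 'a::ab_group_add, 'n) vspace_scheme \<Rightarrow>
    ('f, 'q::ab_group_add, 'm) alg_scheme \<Rightarrow> ('a \<Rightarrow> ('f, 'a, 'q) tens) \<Rightarrow> nat \<Rightarrow>
    ('f, 'a) tpow \<Rightarrow> ('f, ('f, 'a) tpow, 'q) tens" where
  "comeas_pow A Q \<rho> n = plift A n (tensor (tpower A n) Q) (rho_list A Q \<rho>)"

definition comeasuring :: "'o sig \<Rightarrow> ('f::field, 'a::ab_group_add, 'o) oalg \<Rightarrow>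
    ('f, 'q::ab_group_add, 'm) alg_scheme \<Rightarrow> ('a \<Rightarrow> ('f, 'a, 'q) tens) \<Rightarrow> bool" where
  "comeasuring S A Q \<rho> \<longleftrightarrow> lin_map A (tensor A Q) \<rho> \<and>
     (\<forall>\<omega>\<in>opset S. \<forall>x\<in>carr (tpower A (src S \<omega>)).
        comeas_pow A Q \<rho> (tgt S \<omega>) (oper A \<omega> x) =
        tlift (tpower A (src S \<omega>)) Q (tensor (tpower A (tgt S \<omega>)) Q)
          (\<lambda>y q. tens (tpower A (tgt S \<omega>)) Q (oper A \<omega> y) q)
          (comeas_pow A Q \<rho> (src S \<omega>) x))"

definition coact_dual :: "('f::field, 'a::ab_group_add, 'n) vspace_scheme \<Rightarrow>
    ('f, 'q::ab_group_add, 'm) vspace_scheme \<Rightarrow> ('a \<Rightarrow> ('f, 'a, 'q) tens) \<Rightarrow>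
    ('q \<Rightarrow> 'f) \<Rightarrow> 'a \<Rightarrow> 'a" where
  "coact_dual A Q \<rho> f a = tlift A Q A (\<lambda>a0 a1. scale A (f a1) a0) (\<rho> a)"

definition comeas_cosupp :: "('f::field, 'a::ab_group_add, 'n) vspace_scheme \<Rightarrow>
    ('f, 'q::ab_group_add, 'm) vspace_scheme \<Rightarrow> ('a \<Rightarrow> ('f, 'a, 'q) tens) \<Rightarrow> ('a \<Rightarrow> 'a) set" where
  "comeas_cosupp A Q \<rho> = {zrestr A (coact_dual A Q \<rho> f) | f. f \<in> Hom Q fld}"

definition coaction :: "'o sig \<Rightarrow> ('f::field, 'a::ab_group_add, 'o) oalg \<Rightarrow>
    ('f, 'b::ab_group_add) bialg \<Rightarrow> ('a \<Rightarrow> ('f, 'a, 'b) tens) \<Rightarrow> bool" where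
  "coaction S A B \<rho> \<longleftrightarrow> comeasuring S A B \<rho> \<and>
     (\<forall>a\<in>carr A.
        tlift A B A (\<lambda>a0 a1. scale A (bcounit B a1) a0) (\<rho> a) = a \<and>
        tlift A B (tensor A (tensor B B))
          (\<lambda>a0 a1. tlift A B (tensor A (tensor B B))
             (\<lambda>a00 a01. tens A (tensor B B) a00 (tens B B a01 a1)) (\<rho> a0)) (\<rho> a) =
        tlift A B (tensor A (tensor B B))
          (\<lambda>a0 a1. tens A (tensor B B) a0 (bcomul B a1)) (\<rho> a))"


section \<open>Universal acting and coacting bialgebras\<close>

text \<open>
  HOL cannot quantify over all types inside a formula, so the coalgebras (algebras) against which
  universality is tested are all those whose underlying type is \<open>'w\<close>, with arbitrary scalar
  multiplication and carrier. The universal object itself may live on a different type.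
  For \<open>'w = 'u \<Rightarrow> 'f\<close> the subspaces include, up to isomorphism, every vector space over \<open>'f\<close>
  with a basis of cardinality at most that of \<open>'u\<close>.
\<close>

definition universal_acting :: "'w::ab_group_add itself \<Rightarrow> 'o sig \<Rightarrow>
    ('f::field, 'a::ab_group_add, 'o) oalg \<Rightarrow> ('a \<Rightarrow> 'a) set \<Rightarrow>
    ('f, 'b::ab_group_add) bialg \<Rightarrow> ('b \<Rightarrow> 'a \<Rightarrow> 'a) \<Rightarrow> bool" where
  "universal_acting _ S A V B \<psi> \<longleftrightarrow>
     bialgebra B \<and> action S A B \<psi> \<and> meas_cosupp A B \<psi> \<subseteq> V \<and>
     (\<forall>(P :: ('f, 'w) coalg) \<psi>'.
        coalgebra P \<and> measuring S A P \<psi>' \<and> meas_cosupp A P \<psi>' \<subseteq> V \<longrightarrow>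
        (\<exists>!\<phi>. coalg_hom P (coalg_of B) \<phi> \<and> (\<forall>p\<in>carr P. \<forall>a\<in>carr A. \<psi> (\<phi> p) a = \<psi>' p a)))"

definition universal_coacting :: "'w::ab_group_add itself \<Rightarrow> 'o sig \<Rightarrow>
    ('f::field, 'a::ab_group_add, 'o) oalg \<Rightarrow> ('a \<Rightarrow> 'a) set \<Rightarrow>
    ('f, 'b::ab_group_add) bialg \<Rightarrow> ('a \<Rightarrow> ('f, 'a, 'b) tens) \<Rightarrow> bool" where
  "universal_coacting _ S A V B \<rho> \<longleftrightarrow>
     bialgebra B \<and> coaction S A B \<rho> \<and> comeas_cosupp A B \<rho> \<subseteq> V \<and>
     (\<forall>(Q :: ('f, 'w) alg) \<rho>'.
        algebra Q \<and> comeasuring S A Q \<rho>' \<and> comeas_cosupp A Q \<rho>' \<subseteq> V \<longrightarrow>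
        (\<exists>!\<phi>. alg_hom B Q \<phi> \<and>
           (\<forall>a\<in>carr A. tlift A B (tensor A Q) (\<lambda>a0 a1. tens A Q a0 (\<phi> a1)) (\<rho> a) = \<rho>' a)))"


section \<open>Subalgebras of the endomorphism algebra\<close>

definition unital_subalgebra :: "('f::field, 'a::ab_group_add, 'n) vspace_scheme \<Rightarrow>
    ('a \<Rightarrow> 'a) set \<Rightarrow> bool" where
  "unital_subalgebra A V \<longleftrightarrow> V \<subseteq> Hom A A \<and> zrestr A id \<in> V \<and>
     (\<forall>f\<in>V. \<forall>g\<in>V. f + g \<in> V \<and> f \<circ> g \<in> V) \<and> (\<forall>c. \<forall>f\<in>V. (\<lambda>x. scale A c (f x)) \<in> V)"

definition finite_topology :: "('f::field, 'a::ab_group_add, 'n) vspace_scheme \<Rightarrow>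
    ('a \<Rightarrow> 'a) topology" where
  "finite_topology A = topology_generated_by
     {{f \<in> Hom A A. \<forall>(a, b)\<in>R. f a = b} | R. finite R \<and> R \<subseteq> carr A \<times> carr A}"

definition pointwise_fin_dim :: "('f::field, 'a::ab_group_add, 'n) vspace_scheme \<Rightarrow>
    ('a \<Rightarrow> 'a) set \<Rightarrow> bool" where
  "pointwise_fin_dim A V \<longleftrightarrow> (\<forall>a\<in>carr A. fin_dim (scale A) {v a | v. v \<in> V})"


section \<open>Algebras and coalgebras as Omega-algebras\<close>

datatype alg_op = Mult | Unit

definition alg_sig :: "alg_op sig" where
  "alg_sig = \<lparr>opset = {Mult, Unit},
     src = (\<lambda>\<omega>. case \<omega> of Mult \<Rightarrow> 2 | Unit \<Rightarrow> 0), tgt = (\<lambda>_. 1)\<rparr>"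

definition alg_oalg :: "('f::field, 'a::ab_group_add) alg \<Rightarrow> ('f, 'a, alg_op) oalg" where
  "alg_oalg A = \<lparr>scale = scale A, carr = carr A,
     oper = (\<lambda>\<omega>. case \<omega> of
         Mult \<Rightarrow> plift A 2 (tpower A 1) (\<lambda>xs. ptens A 1 [mul A (xs ! 0) (xs ! 1)])
       | Unit \<Rightarrow> plift A 0 (tpower A 1) (\<lambda>_. ptens A 1 [one A]))\<rparr>"

datatype coalg_op = Comult | Counit

definition coalg_sig :: "coalg_op sig" where
  "coalg_sig = \<lparr>opset = {Comult, Counit}, src = (\<lambda>_. 1),
     tgt = (\<lambda>\<omega>. case \<omega> of Comult \<Rightarrow> 2 | Counit \<Rightarrow> 0)\<rparr>"

definition coalg_oalg :: "('f::field, 'a::ab_group_add) coalg \<Rightarrow> ('f, 'a, coalg_op) oalg" where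
  "coalg_oalg C = \<lparr>scale = scale C, carr = carr C,
     oper = (\<lambda>\<omega>. case \<omega> of
         Comult \<Rightarrow> plift C 1 (tpower C 2)
           (\<lambda>xs. tlift C C (tpower C 2) (\<lambda>x y. ptens C 2 [x, y]) (comul C (xs ! 0)))
       | Counit \<Rightarrow> plift C 1 (tpower C 0)
           (\<lambda>xs. fscale (counit C (xs ! 0)) (ptens C 0 [])))\<rparr>"

end

theory Submission
  imports Defs
begin

text \<open>
  Write \<open>L\<close> for the universal acting and \<open>R\<close> for the universal coacting bialgebra. Since \<open>V\<close> is pointwise
  finite dimensional, an action of \<open>L\<close> can be rewritten as a map \<open>A \<rightarrow> A \<otimes> L*\<close>, which is a comeasuring over
  the convolution algebra \<open>L*\<close>; because \<open>V\<close> is closed its cosupport stays inside \<open>V\<close>. Universality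
  of \<open>R\<close> gives an algebra map \<open>\<phi>: R \<rightarrow> L*\<close>, and its transpose \<open>\<beta>: L \<rightarrow> R\<degree>\<close>, \<open>\<beta>(p)(b) = \<phi>(b)(p)\<close>,
  is a coalgebra map compatible with the actions. Terminality of \<open>L\<close> yields \<open>\<theta>\<beta> = id\<close>.

  The dual of \<open>R\<degree>\<close> may be too large for the type of the test objects, so \<open>\<beta>\<theta> = id\<close> is not obtained by
  dualising once more. Instead, \<open>R\<close> is generated as an algebra by the coefficients of its coaction.
  The elements of \<open>R\<close> at which all \<open>f\<close> and \<open>\<beta>(\<theta>(f))\<close> agree form a subalgebra containing the coefficients,
  and likewise for \<open>\<beta>(p q)\<close> and \<open>\<beta>(p) \<beta>(q)\<close>, so that \<open>\<beta>\<close>, and hence \<open>\<theta>\<close>, is a bialgebra isomorphism.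
\<close>

section \<open>Linear maps and tensors\<close>

text \<open>Passing between actions and coactions rests on one device: contracting the second tensor
  factor by a form. Contracted along the functional belonging to an element \<open>p\<close>, the
  comeasuring law becomes the measuring law at \<open>p\<close>; where such functionals separate
  points, the passage can be reversed. The locale \<open>pairing\<close> states this once. The
  reverse direction is taken for the full dual of \<open>L\<close> paired with \<open>L\<close>, the
  direct one for \<open>R\<close> paired with its finite dual.

  Closedness of \<open>V\<close> enters because a form on the full dual of \<open>L\<close> need not
  be evaluation at an element of \<open>L\<close>; it is so only on each finite set of functionals,
  and this is exactly approximation in the finite topology.

  The test objects that occur are \<open>L\<close>, its full dual, \<open>R\<close>, a subalgebra of
  \<open>R\<close>, and the finite dual of \<open>R\<close>. Each consists of functions on, or has
  coordinates indexed by, a type that injects into \<open>'u\<close>, so its structure can be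
  carried over to \<open>'u \<Rightarrow> 'f\<close>.\<close>

lemma is_vspaceD:
  assumes "is_vspace V"
  shows carr_add: "x \<in> carr V \<Longrightarrow> y \<in> carr V \<Longrightarrow> x + y \<in> carr V"
    and carr_scale: "x \<in> carr V \<Longrightarrow> scale V c x \<in> carr V"
    and carr_zero: "0 \<in> carr V"
    and scale_add_right: "scale V c (u + v) = scale V c u + scale V c v"
    and scale_add_left: "scale V (c + d) u = scale V c u + scale V d u"
    and scale_scale: "scale V c (scale V d u) = scale V (c * d) u"
    and scale_one: "scale V 1 u = u"
    and scale_zero_left: "scale V 0 u = 0"
    and scale_zero_right: "scale V c 0 = 0"
proof -
  interpret vector_space "scale V" using assms by (simp add: is_vspace_def)
  have s: "subspace (carr V)" using assms by (simp add: is_vspace_def)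
  show "x \<in> carr V \<Longrightarrow> y \<in> carr V \<Longrightarrow> x + y \<in> carr V"
    "x \<in> carr V \<Longrightarrow> scale V c x \<in> carr V" "0 \<in> carr V"
    using s by (auto simp: subspace_def)
  show "scale V c (u + v) = scale V c u + scale V c v"
    "scale V (c + d) u = scale V c u + scale V d u"
    "scale V c (scale V d u) = scale V (c * d) u"
    "scale V 1 u = u" "scale V 0 u = 0" "scale V c 0 = 0"
    by (auto simp: scale_right_distrib scale_left_distrib)
qed

lemmas vs_carr = carr_add carr_scale carr_zero
lemmas vs_scale = scale_add_right scale_add_left scale_scale scale_one scale_zero_left scale_zero_right

lemma carr_sum_list:
  "is_vspace V \<Longrightarrow> (\<And>x. x \<in> set xs \<Longrightarrow> f x \<in> carr V) \<Longrightarrow> (\<Sum>x\<leftarrow>xs. f x) \<in> carr V"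
  by (induction xs) (auto simp: vs_carr)

lemma scale_sum_list: "is_vspace V \<Longrightarrow> scale V c (\<Sum>x\<leftarrow>xs. f x) = (\<Sum>x\<leftarrow>xs. scale V c (f x))"
  by (induction xs) (auto simp: vs_scale)

lemma sum_list_scale: "is_vspace V \<Longrightarrow> scale V (\<Sum>x\<leftarrow>xs. f x) v = (\<Sum>x\<leftarrow>xs. scale V (f x) v)"
  by (induction xs) (auto simp: vs_scale)

lemma sum_list_fun: "(\<Sum>x\<leftarrow>xs. f x) y = (\<Sum>x\<leftarrow>xs. f x y)"
  for f :: "'a \<Rightarrow> 'b \<Rightarrow> 'c::comm_monoid_add"
  by (induction xs) (auto simp: zero_fun_def plus_fun_def)

lemma sum_list_swap:
  "(\<Sum>x\<leftarrow>xs. \<Sum>y\<leftarrow>ys. f x y) = (\<Sum>y\<leftarrow>ys. \<Sum>x\<leftarrow>xs. f x y)"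
  for f :: "'a \<Rightarrow> 'b \<Rightarrow> 'c::comm_monoid_add"
proof (induction xs)
  case Nil then show ?case by (induction ys) auto
next
  case (Cons a xs)
  then show ?case by (simp add: sum_list_addf)
qed

lemma sum_list_cong: "(\<And>x. x \<in> set xs \<Longrightarrow> f x = g x) \<Longrightarrow> (\<Sum>x\<leftarrow>xs. f x) = (\<Sum>x\<leftarrow>xs. g x)"
  by (metis map_eq_conv)

lemma sum_list_concat: "(\<Sum>x\<leftarrow>concat xss. f x) = (\<Sum>xs\<leftarrow>xss. \<Sum>x\<leftarrow>xs. f x)"
  for f :: "'a \<Rightarrow> 'b::comm_monoid_add"
  by (induction xss) auto

lemma sum_list_mult_right: "(\<Sum>x\<leftarrow>xs. f x) * c = (\<Sum>x\<leftarrow>xs. f x * c)" for c :: "'a::semiring_0"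
  by (induction xs) (auto simp: algebra_simps)

lemma sum_list_mult_left: "c * (\<Sum>x\<leftarrow>xs. f x) = (\<Sum>x\<leftarrow>xs. c * f x)" for c :: "'a::semiring_0"
  by (induction xs) (auto simp: algebra_simps)

lemma sum_list_swap3:
  "(\<Sum>x\<leftarrow>xs. \<Sum>y\<leftarrow>ys. \<Sum>i\<leftarrow>is. f x y i) = (\<Sum>i\<leftarrow>is. \<Sum>x\<leftarrow>xs. \<Sum>y\<leftarrow>ys. f x y i)"
  for f :: "'a \<Rightarrow> 'b \<Rightarrow> 'd \<Rightarrow> 'c::comm_monoid_add"
proof -
  have "(\<Sum>x\<leftarrow>xs. \<Sum>y\<leftarrow>ys. \<Sum>i\<leftarrow>is. f x y i) = (\<Sum>x\<leftarrow>xs. \<Sum>i\<leftarrow>is. \<Sum>y\<leftarrow>ys. f x y i)"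
    by (intro sum_list_cong sum_list_swap)
  also have "\<dots> = (\<Sum>i\<leftarrow>is. \<Sum>x\<leftarrow>xs. \<Sum>y\<leftarrow>ys. f x y i)" by (rule sum_list_swap)
  finally show ?thesis .
qed

lemma sum_list_swap4:
  "(\<Sum>x\<leftarrow>xs. \<Sum>y\<leftarrow>ys. \<Sum>i\<leftarrow>is. \<Sum>j\<leftarrow>js. f x y i j) =
   (\<Sum>i\<leftarrow>is. \<Sum>j\<leftarrow>js. \<Sum>x\<leftarrow>xs. \<Sum>y\<leftarrow>ys. f x y i j)"
  for f :: "'a \<Rightarrow> 'b \<Rightarrow> 'd \<Rightarrow> 'e \<Rightarrow> 'c::comm_monoid_add"
proof -
  have "(\<Sum>x\<leftarrow>xs. \<Sum>y\<leftarrow>ys. \<Sum>i\<leftarrow>is. \<Sum>j\<leftarrow>js. f x y i j) =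
      (\<Sum>i\<leftarrow>is. \<Sum>x\<leftarrow>xs. \<Sum>y\<leftarrow>ys. \<Sum>j\<leftarrow>js. f x y i j)" by (rule sum_list_swap3)
  also have "\<dots> = (\<Sum>i\<leftarrow>is. \<Sum>j\<leftarrow>js. \<Sum>x\<leftarrow>xs. \<Sum>y\<leftarrow>ys. f x y i j)"
    by (intro sum_list_cong sum_list_swap3)
  finally show ?thesis .
qed

lemma sum_list_product: "(\<Sum>x\<leftarrow>xs. f x) * (\<Sum>y\<leftarrow>ys. g y) = (\<Sum>x\<leftarrow>xs. \<Sum>y\<leftarrow>ys. f x * g y)"
  for f :: "'a \<Rightarrow> 'c::semiring_0"
  by (induction xs) (simp_all add: distrib_right sum_list_mult_left sum_list_addf)

section \<open>Maps that are linear on carriers\<close>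

lemma lin_mapI:
  assumes "\<And>x. x \<in> carr V \<Longrightarrow> h x \<in> carr W"
    and "\<And>x y. x \<in> carr V \<Longrightarrow> y \<in> carr V \<Longrightarrow> h (x + y) = h x + h y"
    and "\<And>c x. x \<in> carr V \<Longrightarrow> h (scale V c x) = scale W c (h x)"
  shows "lin_map V W h"
  using assms by (auto simp: lin_map_def)

lemma lin_map_carr: "lin_map V W h \<Longrightarrow> x \<in> carr V \<Longrightarrow> h x \<in> carr W"
  and lin_map_add: "lin_map V W h \<Longrightarrow> x \<in> carr V \<Longrightarrow> y \<in> carr V \<Longrightarrow> h (x + y) = h x + h y"
  and lin_map_scale: "lin_map V W h \<Longrightarrow> x \<in> carr V \<Longrightarrow> h (scale V c x) = scale W c (h x)"
  by (auto simp: lin_map_def)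

lemma lin_map_zero: "lin_map V W h \<Longrightarrow> is_vspace V \<Longrightarrow> h 0 = 0"
  using lin_map_add[of V W h 0 0] by (simp add: carr_zero)

lemma lin_map_sum_list:
  "lin_map V W h \<Longrightarrow> is_vspace V \<Longrightarrow> (\<And>x. x \<in> set xs \<Longrightarrow> f x \<in> carr V) \<Longrightarrow>
   h (\<Sum>x\<leftarrow>xs. f x) = (\<Sum>x\<leftarrow>xs. h (f x))"
  by (induction xs) (auto simp: lin_map_zero lin_map_add carr_sum_list)

lemma lin_map_sum_list2:
  assumes "lin_map V W h" "is_vspace V"
    and "\<And>z w. z \<in> set xs \<Longrightarrow> w \<in> set (ys z) \<Longrightarrow> f z w \<in> carr V"
  shows "h (\<Sum>z\<leftarrow>xs. \<Sum>w\<leftarrow>ys z. f z w) = (\<Sum>z\<leftarrow>xs. \<Sum>w\<leftarrow>ys z. h (f z w))"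
proof -
  have "h (\<Sum>z\<leftarrow>xs. \<Sum>w\<leftarrow>ys z. f z w) = (\<Sum>z\<leftarrow>xs. h (\<Sum>w\<leftarrow>ys z. f z w))"
    by (rule lin_map_sum_list[OF assms(1,2)]) (rule carr_sum_list[OF assms(2) assms(3)])
  also have "\<dots> = (\<Sum>z\<leftarrow>xs. \<Sum>w\<leftarrow>ys z. h (f z w))"
    by (rule sum_list_cong, rule lin_map_sum_list[OF assms(1,2)]) (rule assms(3))
  finally show ?thesis .
qed

lemma vs_minus: "is_vspace V \<Longrightarrow> scale V (-1) y = - y"
  using scale_add_left[of V "-1" 1 y] by (simp add: scale_zero_left scale_one eq_neg_iff_add_eq_0)

lemma lin_map_diff:
  assumes "lin_map V W h" "is_vspace V" "is_vspace W" "x \<in> carr V" "y \<in> carr V"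
  shows "h (x - y) = h x - h y"
proof -
  have "h (x + scale V (-1) y) = h x + scale W (-1) (h y)"
    using assms by (simp add: lin_map_add lin_map_scale vs_carr)
  then show ?thesis by (simp add: vs_minus[OF assms(2)] vs_minus[OF assms(3)])
qed

lemma carr_diff:
  assumes "is_vspace V" "x \<in> carr V" "y \<in> carr V"
  shows "x - y \<in> carr V"
proof -
  have "x + scale V (-1) y \<in> carr V"
    using assms by (intro carr_add carr_scale)
  then show ?thesis by (simp add: vs_minus[OF assms(1)])
qed

lemma lin_map_cong: "is_vspace V \<Longrightarrow> (\<And>x. x \<in> carr V \<Longrightarrow> h x = k x) \<Longrightarrow> lin_map V W h = lin_map V W k"
  by (simp add: lin_map_def vs_carr)

lemma lin_map_comp: "lin_map U V g \<Longrightarrow> lin_map V W h \<Longrightarrow> lin_map U W (\<lambda>x. h (g x))"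
  by (auto simp: lin_map_def)

lemma lin_map_ident: "lin_map V V (\<lambda>x. x)"
  by (auto simp: lin_map_def)

lemma lin_map_sum:
  assumes "is_vspace W" "\<And>i. i \<in> set xs \<Longrightarrow> lin_map V W (h i)"
  shows "lin_map V W (\<lambda>x. \<Sum>i\<leftarrow>xs. h i x)"
proof (rule lin_mapI)
  show "(\<Sum>i\<leftarrow>xs. h i x) \<in> carr W" if "x \<in> carr V" for x
    using assms that by (intro carr_sum_list) (auto intro: lin_map_carr)
  show "(\<Sum>i\<leftarrow>xs. h i (x + y)) = (\<Sum>i\<leftarrow>xs. h i x) + (\<Sum>i\<leftarrow>xs. h i y)"
    if "x \<in> carr V" "y \<in> carr V" for x y
    unfolding sum_list_addf[symmetric] using assms that
    by (intro sum_list_cong lin_map_add[OF assms(2)])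
  show "(\<Sum>i\<leftarrow>xs. h i (scale V c x)) = scale W c (\<Sum>i\<leftarrow>xs. h i x)" if "x \<in> carr V" for c x
    unfolding scale_sum_list[OF assms(1)] using that
    by (intro sum_list_cong lin_map_scale[OF assms(2)])
qed

lemma lin_map_plus:
  "is_vspace W \<Longrightarrow> lin_map V W g \<Longrightarrow> lin_map V W h \<Longrightarrow> lin_map V W (\<lambda>x. g x + h x)"
  by (auto simp: lin_map_def vs_carr vs_scale)

lemma lin_map_scaled:
  assumes "is_vspace W" "lin_map V W h"
  shows "lin_map V W (\<lambda>x. scale W c (h x))"
  using assms by (auto simp: lin_map_def vs_scale vs_carr mult.commute)

lemma lin_map_scale_vec:
  assumes "is_vspace W" "lin_map V fld h" "w \<in> carr W"
  shows "lin_map V W (\<lambda>x. scale W (h x) w)"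
  using assms by (auto simp: lin_map_def vs_scale vs_carr fld_def)

lemma fld_simps [simp]: "scale fld = (*)" "carr fld = UNIV"
  by (auto simp: fld_def)

lemma is_vspace_fld [simp]: "is_vspace fld"
proof -
  interpret vector_space "(*) :: 'a::field \<Rightarrow> 'a \<Rightarrow> 'a"
    by unfold_locales (auto simp: algebra_simps)
  have "vector_space ((*) :: 'a::field \<Rightarrow> 'a \<Rightarrow> 'a)" ..
  then show ?thesis by (simp add: is_vspace_def)
qed

lemma lin_map_zrestr: "is_vspace V \<Longrightarrow> lin_map V W (zrestr V h) \<longleftrightarrow> lin_map V W h"
  by (auto simp: lin_map_def zrestr_def vs_carr)

lemma zrestr_Hom: "is_vspace V \<Longrightarrow> lin_map V W h \<Longrightarrow> zrestr V h \<in> Hom V W"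
  by (simp add: Hom_def lin_map_zrestr) (simp add: zrestr_def)

lemma zrestr_in [simp]: "x \<in> carr V \<Longrightarrow> zrestr V h x = h x"
  by (simp add: zrestr_def)

lemma zrestr_eqI: "(\<And>x. x \<in> carr V \<Longrightarrow> g x = h x) \<Longrightarrow> zrestr V g = zrestr V h"
  by (auto simp: zrestr_def)

lemma Hom_lin: "h \<in> Hom V W \<Longrightarrow> lin_map V W h"
  by (simp add: Hom_def)

lemma Hom_eqI: "g \<in> Hom V W \<Longrightarrow> h \<in> Hom V W \<Longrightarrow> (\<And>x. x \<in> carr V \<Longrightarrow> g x = h x) \<Longrightarrow> g = h"
  unfolding Hom_def fun_eq_iff by (metis (mono_tags, lifting) mem_Collect_eq)

lemma bilinearI:
  "(\<And>v. v \<in> carr V \<Longrightarrow> lin_map W U (\<beta> v)) \<Longrightarrow>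
   (\<And>w. w \<in> carr W \<Longrightarrow> lin_map V U (\<lambda>v. \<beta> v w)) \<Longrightarrow> bilinear V W U \<beta>"
  by (simp add: bilinear_def)

lemma bilinear_right: "bilinear V W U \<beta> \<Longrightarrow> v \<in> carr V \<Longrightarrow> lin_map W U (\<beta> v)"
  and bilinear_left: "bilinear V W U \<beta> \<Longrightarrow> w \<in> carr W \<Longrightarrow> lin_map V U (\<lambda>v. \<beta> v w)"
  by (auto simp: bilinear_def)

lemma bilinear_comp: "bilinear V W U \<beta> \<Longrightarrow> lin_map U T h \<Longrightarrow> bilinear V W T (\<lambda>v w. h (\<beta> v w))"
  by (auto simp: bilinear_def lin_map_def)

lemma bilinear_congr:
  "is_vspace V \<Longrightarrow> is_vspace W \<Longrightarrow> (\<And>v w. v \<in> carr V \<Longrightarrow> w \<in> carr W \<Longrightarrow> \<beta> v w = \<gamma> v w) \<Longrightarrow>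
   bilinear V W U \<beta> = bilinear V W U \<gamma>"
  by (simp add: bilinear_def lin_map_def vs_carr)

lemma bilinear_maps:
  "bilinear V W U \<beta> \<Longrightarrow> lin_map V' V g \<Longrightarrow> lin_map W' W h \<Longrightarrow>
   bilinear V' W' U (\<lambda>v w. \<beta> (g v) (h w))"
  by (auto simp: bilinear_def lin_map_def)

lemma bilinear_sum:
  "is_vspace U \<Longrightarrow> (\<And>i. i \<in> set xs \<Longrightarrow> bilinear V W U (\<beta> i)) \<Longrightarrow>
   bilinear V W U (\<lambda>v w. \<Sum>i\<leftarrow>xs. \<beta> i v w)"
  by (auto simp: bilinear_def intro: lin_map_sum)

lemma bilinear_scale_right: "is_vspace V \<Longrightarrow> lin_map W fld f \<Longrightarrow>
    bilinear V W V (\<lambda>v w. scale V (f w) v)"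
  by (auto simp: bilinear_def lin_map_def vs_scale vs_carr mult.commute)

lemma bilinear_scale_left: "is_vspace W \<Longrightarrow> lin_map V fld f \<Longrightarrow>
    bilinear V W W (\<lambda>v w. scale W (f v) w)"
  by (auto simp: bilinear_def lin_map_def vs_scale vs_carr mult.commute)

lemma bilinear_mult: "lin_map V fld f \<Longrightarrow> lin_map W fld g \<Longrightarrow> bilinear V W fld (\<lambda>v w. f v * g w)"
  by (auto simp: bilinear_def lin_map_def algebra_simps)

section \<open>Tensors as finite sums of pure tensors\<close>

lemma tensor_sel [simp]: "scale (tensor V W) = fscale"
  and tpower_sel [simp]: "scale (tpower V n) = fscale"
  by (simp_all add: tensor_def tpower_def)

lemma is_vspace_span: "is_vspace \<lparr>scale = fscale, carr = module.span fscale X\<rparr>"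
proof -
  interpret vector_space "fscale :: 'f::field \<Rightarrow> ('i \<Rightarrow> 'f) \<Rightarrow> 'i \<Rightarrow> 'f"
    by (rule vector_space_fscale)
  show ?thesis by (simp add: is_vspace_def vector_space_fscale)
qed

lemma is_vspace_tensor [simp]: "is_vspace (tensor V W)"
  and is_vspace_tpower [simp]: "is_vspace (tpower V n)"
  unfolding tensor_def tpower_def by (rule is_vspace_span)+

lemma module_fscale: "module (fscale :: 'f::field \<Rightarrow> ('i \<Rightarrow> 'f) \<Rightarrow> 'i \<Rightarrow> 'f)"
  by (auto simp: module_def fscale_def algebra_simps fun_eq_iff)

lemma tens_carr: "v \<in> carr V \<Longrightarrow> w \<in> carr W \<Longrightarrow> tens V W v w \<in> carr (tensor V W)"
  unfolding tensor_def by (simp, rule module.span_base[OF module_fscale]) auto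

lemma ptens_carr: "xs \<in> tuples V n \<Longrightarrow> ptens V n xs \<in> carr (tpower V n)"
  unfolding tpower_def by (simp, rule module.span_base[OF module_fscale]) auto

text \<open>A pure tensor is evaluation of bilinear forms, so its bilinearity is theirs; off the
  bilinear forms every pure tensor is 0.\<close>

lemma bilinear_tens: "bilinear V W (tensor V W) (tens V W)"
proof -
  have *: "\<beta> (v + v', w) = \<beta> (v, w) + \<beta> (v', w)" "\<beta> (scale V c v, w) = c * \<beta> (v, w)"
    if "bilinear V W fld (curry \<beta>)" "v \<in> carr V" "v' \<in> carr V" "w \<in> carr W" for \<beta> v v' w c
    using bilinear_left[OF that(1,4)] that(2,3)
    by (auto simp: lin_map_def)
  have **: "\<beta> (v, w + w') = \<beta> (v, w) + \<beta> (v, w')" "\<beta> (v, scale W c w) = c * \<beta> (v, w)"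
    if "bilinear V W fld (curry \<beta>)" "v \<in> carr V" "w' \<in> carr W" "w \<in> carr W" for \<beta> v w' w c
    using bilinear_right[OF that(1,2)] that(3,4)
    by (auto simp: lin_map_def)
  show ?thesis
    by (intro bilinearI lin_mapI tens_carr)
      (auto simp: tens_def fun_eq_iff plus_fun_def fscale_def * **)
qed

lemma tens_add_left: "v \<in> carr V \<Longrightarrow> v' \<in> carr V \<Longrightarrow> w \<in> carr W \<Longrightarrow>
    tens V W (v + v') w = tens V W v w + tens V W v' w"
  and tens_add_right: "v \<in> carr V \<Longrightarrow> w \<in> carr W \<Longrightarrow> w' \<in> carr W \<Longrightarrow>
    tens V W v (w + w') = tens V W v w + tens V W v w'"
  and tens_scale_left: "v \<in> carr V \<Longrightarrow> w \<in> carr W \<Longrightarrow>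
    tens V W (scale V c v) w = fscale c (tens V W v w)"
  and tens_scale_right: "v \<in> carr V \<Longrightarrow> w \<in> carr W \<Longrightarrow>
    tens V W v (scale W c w) = fscale c (tens V W v w)"
  using bilinear_left[OF bilinear_tens, of w W V] bilinear_right[OF bilinear_tens, of v V W]
  by (auto simp: lin_map_def)

lemma tlift_Hom: "is_vspace U \<Longrightarrow> bilinear V W U \<beta> \<Longrightarrow> tlift V W U \<beta> \<in> Hom (tensor V W) U"
  and tlift_tens: "is_vspace U \<Longrightarrow> bilinear V W U \<beta> \<Longrightarrow> v \<in> carr V \<Longrightarrow> w \<in> carr W \<Longrightarrow>
    tlift V W U \<beta> (tens V W v w) = \<beta> v w"
  using theI'[OF tensor_universal[of U V W \<beta>]] unfolding tlift_def by blast+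

lemmas tlift_lin = tlift_Hom[THEN Hom_lin]

lemma plift_Hom: "is_vspace U \<Longrightarrow> multilinear V n U \<beta> \<Longrightarrow> plift V n U \<beta> \<in> Hom (tpower V n) U"
  and plift_ptens: "is_vspace U \<Longrightarrow> multilinear V n U \<beta> \<Longrightarrow> xs \<in> tuples V n \<Longrightarrow>
    plift V n U \<beta> (ptens V n xs) = \<beta> xs"
  using theI'[OF tpower_universal[of U V n \<beta>]] unfolding plift_def by blast+

lemmas plift_lin = plift_Hom[THEN Hom_lin]

definition tsum where
  "tsum V W xs = (\<Sum>(v, w)\<leftarrow>xs. tens V W v w)"

lemma tsum_carr: "set xs \<subseteq> carr V \<times> carr W \<Longrightarrow> tsum V W xs \<in> carr (tensor V W)"
  unfolding tsum_def by (intro carr_sum_list) (auto intro: tens_carr)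

lemma tlift_tsum:
  assumes "is_vspace U" "bilinear V W U \<beta>" "set xs \<subseteq> carr V \<times> carr W"
  shows "tlift V W U \<beta> (tsum V W xs) = (\<Sum>(v, w)\<leftarrow>xs. \<beta> v w)"
  unfolding tsum_def
  by (subst lin_map_sum_list[OF tlift_lin[OF assms(1,2)]])
    (use assms in \<open>auto intro!: tens_carr sum_list_cong tlift_tens\<close>)

text \<open>The carrier is a span. Absorbing each coefficient into the left factor leaves a plain
  sum, so lists of pairs without scalars are enough.\<close>

lemma tensor_obtain:
  fixes V :: "('a::field, 'b::ab_group_add, 'm) vspace_scheme"
    and W :: "('a, 'c::ab_group_add, 'n) vspace_scheme"
  assumes "is_vspace V" "t \<in> carr (tensor V W)"
  shows "\<exists>xs. set xs \<subseteq> carr V \<times> carr W \<and> t = tsum V W xs"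
proof -
  interpret T: vector_space "fscale :: 'a \<Rightarrow> (('b \<times> 'c \<Rightarrow> 'a) \<Rightarrow> 'a) \<Rightarrow> _"
    by (rule vector_space_fscale)
  have "t \<in> T.span {tens V W v w | v w. v \<in> carr V \<and> w \<in> carr W}"
    using assms(2) by (simp add: tensor_def)
  then show ?thesis
  proof (induction rule: T.span_induct_alt)
    case base
    then show ?case by (intro exI[of _ "[]"]) (auto simp: tsum_def zero_fun_def)
  next
    case (step c x y)
    then obtain v w xs where "v \<in> carr V" "w \<in> carr W" "x = tens V W v w"
      "set xs \<subseteq> carr V \<times> carr W" "y = tsum V W xs" by blast
    then show ?case
      by (intro exI[of _ "(scale V c v, w) # xs"])
        (auto simp: tsum_def tens_scale_left carr_scale assms(1) plus_fun_def)
  qed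
qed

text \<open>
  Every tensor is a finite sum of pure tensors; \<open>trep\<close> chooses one such list of pairs, which turns
  \<open>tlift\<close> into a finite sum.
\<close>

definition trep where
  "trep V W t = (SOME xs. set xs \<subseteq> carr V \<times> carr W \<and> t = tsum V W xs)"

lemma trep:
  assumes "is_vspace V" "t \<in> carr (tensor V W)"
  shows "set (trep V W t) \<subseteq> carr V \<times> carr W" "tsum V W (trep V W t) = t"
  using someI_ex[OF tensor_obtain[OF assms]] unfolding trep_def by auto

lemma tlift_trep:
  assumes "is_vspace V" "is_vspace U" "bilinear V W U \<beta>" "t \<in> carr (tensor V W)"
  shows "tlift V W U \<beta> t = (\<Sum>(v, w)\<leftarrow>trep V W t. \<beta> v w)"
  using tlift_tsum[OF assms(2,3) trep(1)[OF assms(1,4)]] trep(2)[OF assms(1,4)] by simp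

text \<open>Unlike the uniqueness part of \<open>tensor_universal\<close>, this asks nothing of the
  maps outside the carrier, so it applies to composites and sums that are not normalised to 0
  there.\<close>

lemma tensor_lin_eq:
  assumes "lin_map (tensor V W) U g" "lin_map (tensor V W) U h" "is_vspace V"
    and "\<And>v w. v \<in> carr V \<Longrightarrow> w \<in> carr W \<Longrightarrow> g (tens V W v w) = h (tens V W v w)"
    and "t \<in> carr (tensor V W)"
  shows "g t = h t"
proof -
  obtain xs where xs: "set xs \<subseteq> carr V \<times> carr W" "t = tsum V W xs"
    using tensor_obtain[OF assms(3,5)] by blast
  have *: "k (tsum V W xs) = (\<Sum>x\<leftarrow>xs. k (case x of (v, w) \<Rightarrow> tens V W v w))"
    if "lin_map (tensor V W) U k" for k
    unfolding tsum_def by (rule lin_map_sum_list[OF that]) (use xs in \<open>auto intro: tens_carr\<close>)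
  show ?thesis
    unfolding xs(2) *[OF assms(1)] *[OF assms(2)]
    by (rule sum_list_cong) (use xs assms in auto)
qed

lemma tpower_lin_eq:
  fixes V :: "('a::field, 'b::ab_group_add, 'm) vspace_scheme"
  assumes "lin_map (tpower V n) U g" "lin_map (tpower V n) U h" "is_vspace U"
    and "\<And>xs. xs \<in> tuples V n \<Longrightarrow> g (ptens V n xs) = h (ptens V n xs)"
    and "t \<in> carr (tpower V n)"
  shows "g t = h t"
proof -
  interpret T: vector_space "fscale :: 'a \<Rightarrow> (('b list \<Rightarrow> 'a) \<Rightarrow> 'a) \<Rightarrow> _"
    by (rule vector_space_fscale)
  have "t \<in> T.span (ptens V n ` tuples V n)"
    using assms(5) by (simp add: tpower_def)
  \<comment> \<open>Membership is carried through the induction, since \<open>g\<close> and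
    \<open>h\<close> are additive only on the carrier.\<close>
  then have "t \<in> carr (tpower V n) \<and> g t = h t"
  proof (induction rule: T.span_induct_alt)
    case base
    then show ?case using lin_map_zero[OF assms(1)] lin_map_zero[OF assms(2)]
      by (auto simp: zero_fun_def[symmetric] carr_zero)
  next
    case (step c x y)
    then have x: "x \<in> carr (tpower V n)" "g x = h x" using assms(4) by (auto intro: ptens_carr)
    then have cx: "fscale c x \<in> carr (tpower V n)" using carr_scale[of "tpower V n" x c] by simp
    moreover have "g (fscale c x) = h (fscale c x)"
      using x lin_map_scale[OF assms(1), of x c] lin_map_scale[OF assms(2), of x c] by simp
    ultimately show ?case
      using carr_add[of "tpower V n", OF _ cx, of y] lin_map_add[OF assms(1) cx, of y]
        lin_map_add[OF assms(2) cx, of y] step by (simp add: plus_fun_def)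
  qed
  then show ?thesis ..
qed

section \<open>Maps and forms applied to one tensor factor\<close>

definition tmap where
  "tmap V W U h = tlift V W (tensor V U) (\<lambda>v w. tens V U v (h w))"

text \<open>This is \<open>id \<otimes> f\<close> followed by the identification of
  \<open>V \<otimes> F\<close> with \<open>V\<close>. For the tensor \<open>\<rho> a\<close> it
  gives the action of the form \<open>f\<close> on \<open>a\<close>.\<close>

definition tcontr where
  "tcontr V W f = tlift V W V (\<lambda>v w. scale V (f w) v)"

lemma bilinear_tmap: "lin_map W U h \<Longrightarrow> bilinear V W (tensor V U) (\<lambda>v w. tens V U v (h w))"
  by (rule bilinear_maps[OF bilinear_tens lin_map_ident])

lemma tmap_lin: "lin_map W U h \<Longrightarrow> lin_map (tensor V W) (tensor V U) (tmap V W U h)"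
  and tmap_tens: "lin_map W U h \<Longrightarrow> v \<in> carr V \<Longrightarrow> w \<in> carr W \<Longrightarrow>
    tmap V W U h (tens V W v w) = tens V U v (h w)"
  unfolding tmap_def by (auto intro!: tlift_lin tlift_tens[of "tensor V U"] bilinear_tmap)

lemma tcontr_lin: "is_vspace V \<Longrightarrow> lin_map W fld f \<Longrightarrow> lin_map (tensor V W) V (tcontr V W f)"
  and tcontr_tens: "is_vspace V \<Longrightarrow> lin_map W fld f \<Longrightarrow> v \<in> carr V \<Longrightarrow> w \<in> carr W \<Longrightarrow>
    tcontr V W f (tens V W v w) = scale V (f w) v"
  unfolding tcontr_def by (auto intro!: tlift_lin tlift_tens[of V] bilinear_scale_right)

lemma tcontr_tmap:
  assumes "is_vspace V" "lin_map W U h" "lin_map U fld f" "t \<in> carr (tensor V W)"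
  shows "tcontr V U f (tmap V W U h t) = tcontr V W (\<lambda>w. f (h w)) t"
  using assms(4)
  by (rule tensor_lin_eq[rotated 4, OF _ lin_map_comp[OF tmap_lin tcontr_lin] tcontr_lin])
    (use assms in \<open>auto simp: tmap_tens tcontr_tens lin_map_comp lin_map_carr\<close>)

lemma tmap_tmap:
  assumes "is_vspace V" "lin_map W U h" "lin_map U T k" "t \<in> carr (tensor V W)"
  shows "tmap V U T k (tmap V W U h t) = tmap V W T (\<lambda>w. k (h w)) t"
  using assms(4)
  by (rule tensor_lin_eq[rotated 4, OF _ lin_map_comp[OF tmap_lin tmap_lin] tmap_lin])
    (use assms in \<open>auto simp: tmap_tens lin_map_comp lin_map_carr\<close>)

lemma tmap_ident:
  assumes "is_vspace V" "t \<in> carr (tensor V W)" "\<And>w. w \<in> carr W \<Longrightarrow> h w = w" "is_vspace W"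
  shows "tmap V W W h t = t"
proof -
  have "lin_map W W h" using assms(3,4) by (auto simp: lin_map_def vs_carr)
  then show ?thesis
    by (intro tensor_lin_eq[OF tmap_lin lin_map_ident assms(1) _ assms(2)])
      (auto simp: tmap_tens assms(3))
qed

section \<open>Dual bases and separation of tensors\<close>

text \<open>A maximal independent subset of \<open>S\<close> is a finite basis of the span, and its
  coordinate forms extend to the whole type. Basis and forms are packed into one list of pairs so
  that expansions are list sums, as for tensors.\<close>

lemma finite_dual_basis:
  fixes V :: "('f::field, 'v::ab_group_add, 'm) vspace_scheme"
  assumes V: "is_vspace V" and S: "finite S" "S \<subseteq> carr V"
  shows "\<exists>L. (\<forall>(\<alpha>, b)\<in>set L. b \<in> S \<and> Vector_Spaces.linear (scale V) (*) \<alpha>) \<and>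
    (\<forall>v\<in>module.span (scale V) S. v = (\<Sum>(\<alpha>, b)\<leftarrow>L. scale V (\<alpha> v) b))"
proof -
  interpret V: vector_space "scale V" using V by (simp add: is_vspace_def)
  interpret F: vector_space "(*) :: 'f \<Rightarrow> 'f \<Rightarrow> 'f"
    by unfold_locales (auto simp: algebra_simps)
  interpret VF: vector_space_pair "scale V" "(*) :: 'f \<Rightarrow> 'f \<Rightarrow> 'f" ..
  obtain B where B: "B \<subseteq> S" "V.independent B" "S \<subseteq> V.span B"
    using V.maximal_independent_subset by blast
  have finB: "finite B" using B(1) S(1) finite_subset by blast
  \<comment> \<open>The dual basis: prescribe 1 at \<open>b\<close> and 0 at the other members of
    the independent set \<open>B\<close>, and extend linearly.\<close>
  have "\<forall>b. \<exists>\<alpha>. Vector_Spaces.linear (scale V) (*) \<alpha> \<and>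
      (\<forall>b'\<in>B. \<alpha> b' = (if b' = b then 1 else 0))"
    using VF.linear_independent_extend[OF B(2), of "\<lambda>b'. if b' = _ then 1 else 0"]
    by (intro allI)
  then obtain \<alpha> where \<alpha>: "\<And>b. Vector_Spaces.linear (scale V) (*) (\<alpha> b)"
    "\<And>b b'. b' \<in> B \<Longrightarrow> \<alpha> b b' = (if b' = b then 1 else 0)" by metis
  obtain bs where bs: "set bs = B" "distinct bs" using finB finite_distinct_list by blast
  have eq: "v = (\<Sum>b\<leftarrow>bs. scale V (\<alpha> b v) b)" if "v \<in> V.span B" for v
    using that
  proof (induction rule: V.span_induct_alt)
    case base
    have "\<alpha> b 0 = 0" for b
      using module_hom.zero[of "scale V" "(*)" "\<alpha> b"] \<alpha>(1)[of b] by (simp add: Vector_Spaces.linear_def)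
    then show ?case by simp
  next
    case (step c x y)
    have lin: "\<alpha> b (scale V c x + y) = c * \<alpha> b x + \<alpha> b y" for b
    proof -
      interpret l: Vector_Spaces.linear "scale V" "(*)" "\<alpha> b" by (rule \<alpha>(1))
      show ?thesis by (simp add: l.add l.scale)
    qed
    have "(\<Sum>b\<leftarrow>bs. scale V (\<alpha> b x) b) = (\<Sum>b\<in>B. scale V (if x = b then 1 else 0) b)"
      using step \<alpha>(2)[of x] bs by (simp add: sum_list_distinct_conv_sum_set)
    also have "\<dots> = x"
      using step finB by (simp add: if_distrib[of "\<lambda>c. scale V c _"] cong: if_cong)
    finally have x: "(\<Sum>b\<leftarrow>bs. scale V (\<alpha> b x) b) = x" .
    have "(\<Sum>b\<leftarrow>bs. scale V (\<alpha> b (scale V c x + y)) b) =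
        scale V c (\<Sum>b\<leftarrow>bs. scale V (\<alpha> b x) b) + (\<Sum>b\<leftarrow>bs. scale V (\<alpha> b y) b)"
      by (simp add: lin scale_add_left[OF V] sum_list_addf scale_sum_list[OF V] scale_scale[OF V])
    then show ?case using x step by simp
  qed
  have "V.span S \<subseteq> V.span B" using B(3) V.span_minimal by auto
  then show ?thesis
    using eq \<alpha>(1) B(1) bs(1)
    by (intro exI[of _ "map (\<lambda>b. (\<alpha> b, b)) bs"]) (auto simp: comp_def)
qed

lemma linear_lin_map:
  assumes "Vector_Spaces.linear (scale V) (*) \<alpha>"
  shows "lin_map V fld \<alpha>"
  using assms by (auto simp: lin_map_def Vector_Spaces.linear_def module_hom.add module_hom.scale)

text \<open>Choose a basis of the image among the values of \<open>G\<close> and lift it to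
  preimages \<open>y\<close>. All finiteness arguments use this form: translates of a form, cofinite
  ideals, finitely many functionals, and the orbit of a vector under a measuring.\<close>

lemma fin_dim_image:
  assumes Q: "is_vspace Q" and U: "is_vspace U" and G: "lin_map Q U G"
    and E: "finite E" "G ` carr Q \<subseteq> module.span (scale U) E"
  shows "\<exists>L. (\<forall>(\<alpha>, y)\<in>set L. Vector_Spaces.linear (scale U) (*) \<alpha> \<and> y \<in> carr Q) \<and>
    (\<forall>x\<in>carr Q. G x = (\<Sum>(\<alpha>, y)\<leftarrow>L. scale U (\<alpha> (G x)) (G y)))"
proof -
  interpret U: vector_space "scale U" using U by (simp add: is_vspace_def)
  obtain B where B: "B \<subseteq> G ` carr Q" "U.independent B" "G ` carr Q \<subseteq> U.span B"
    using U.maximal_independent_subset by blast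
  have finB: "finite B" using U.independent_span_bound[OF E(1) B(2)] B(1) E(2) by blast
  have "B \<subseteq> carr U" using B(1) lin_map_carr[OF G] by blast
  from finite_dual_basis[OF U finB this] obtain L where
    L: "\<forall>(\<alpha>, b)\<in>set L. b \<in> B \<and> Vector_Spaces.linear (scale U) (*) \<alpha>"
    "\<And>v. v \<in> U.span B \<Longrightarrow> v = (\<Sum>(\<alpha>, b)\<leftarrow>L. scale U (\<alpha> v) b)" by blast
  define pick where "pick b = (SOME y. y \<in> carr Q \<and> G y = b)" for b
  have pick: "pick b \<in> carr Q" "G (pick b) = b" if "b \<in> B" for b
  proof -
    have "\<exists>y. y \<in> carr Q \<and> G y = b" using B(1) that by blast
    then show "pick b \<in> carr Q" "G (pick b) = b" unfolding pick_def by (metis (mono_tags, lifting) someI_ex)+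
  qed
  have "G x = (\<Sum>(\<alpha>, y)\<leftarrow>map (\<lambda>(\<alpha>, b). (\<alpha>, pick b)) L. scale U (\<alpha> (G x)) (G y))"
    if "x \<in> carr Q" for x
  proof -
    have "G x \<in> U.span B" using B(3) that by blast
    from L(2)[OF this] have "G x = (\<Sum>(\<alpha>, b)\<leftarrow>L. scale U (\<alpha> (G x)) b)" .
    also have "\<dots> = (\<Sum>(\<alpha>, b)\<leftarrow>L. scale U (\<alpha> (G x)) (G (pick b)))"
      using L(1) pick by (intro sum_list_cong) auto
    finally show ?thesis by (simp add: comp_def case_prod_unfold)
  qed
  then show ?thesis
    using L(1) pick by (intro exI[of _ "map (\<lambda>(\<alpha>, b). (\<alpha>, pick b)) L"]) auto
qed

text \<open>This is \<open>\<alpha> \<otimes> id\<close> with \<open>F \<otimes> W\<close>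
  identified with \<open>W\<close>. For the tensor \<open>\<rho> a\<close> its values are the matrix
  coefficients of the coaction.\<close>

definition tcoeff where
  "tcoeff V W \<alpha> = tlift V W W (\<lambda>v w. scale W (\<alpha> v) w)"

lemma tcoeff_lin: "is_vspace W \<Longrightarrow> lin_map V fld f \<Longrightarrow> lin_map (tensor V W) W (tcoeff V W f)"
  and tcoeff_tens: "is_vspace W \<Longrightarrow> lin_map V fld f \<Longrightarrow> v \<in> carr V \<Longrightarrow> w \<in> carr W \<Longrightarrow>
    tcoeff V W f (tens V W v w) = scale W (f v) w"
  unfolding tcoeff_def by (auto intro!: tlift_lin tlift_tens[of W] bilinear_scale_left)

text \<open>Both sides are \<open>\<alpha> \<otimes> f\<close>: the two factors may be contracted in
  either order.\<close>

lemma tcoeff_tcontr: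
  assumes "is_vspace V" "is_vspace W" "lin_map V fld \<alpha>" "lin_map W fld f" "t \<in> carr (tensor V W)"
  shows "f (tcoeff V W \<alpha> t) = \<alpha> (tcontr V W f t)"
  using assms(5)
  by (rule tensor_lin_eq[rotated 4, OF _ lin_map_comp[OF tcoeff_lin] lin_map_comp[OF tcontr_lin]])
    (use assms in \<open>auto simp: tcoeff_tens tcontr_tens lin_map_comp lin_map_carr lin_map_scale\<close>)

text \<open>Expand the left factors of a presentation of \<open>t\<close> in a basis of their span
  and collect terms: the right factor at \<open>b\<close> becomes the coefficient of
  \<open>t\<close> along the form dual to \<open>b\<close>.\<close>

lemma tensor_expand:
  assumes V: "is_vspace V" and W: "is_vspace W" and t: "t \<in> carr (tensor V W)"
  shows "\<exists>L. (\<forall>(\<alpha>, b)\<in>set L. b \<in> carr V \<and> lin_map V fld \<alpha>) \<and>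
    t = (\<Sum>(\<alpha>, b)\<leftarrow>L. tens V W b (tcoeff V W \<alpha> t))"
proof -
  interpret V: vector_space "scale V" using V by (simp add: is_vspace_def)
  obtain xs where xs: "set xs \<subseteq> carr V \<times> carr W" "t = tsum V W xs"
    using tensor_obtain[OF V t] by blast
  have "fst ` set xs \<subseteq> carr V" using xs by auto
  from finite_dual_basis[OF V _ this] obtain L where
    L: "\<And>\<alpha> b. (\<alpha>, b) \<in> set L \<Longrightarrow> b \<in> carr V \<and> lin_map V fld \<alpha>"
    "\<And>v. v \<in> V.span (fst ` set xs) \<Longrightarrow> v = (\<Sum>(\<alpha>, b)\<leftarrow>L. scale V (\<alpha> v) b)"
    using \<open>fst ` set xs \<subseteq> carr V\<close> linear_lin_map by (fastforce simp: case_prod_beta)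
  have 1: "tens V W v w = (\<Sum>(\<alpha>, b)\<leftarrow>L. tens V W b (tcoeff V W \<alpha> (tens V W v w)))"
    if vw: "(v, w) \<in> set xs" for v w
  proof -
    have vwc: "v \<in> carr V" "w \<in> carr W" using vw xs by auto
    have "v \<in> V.span (fst ` set xs)" using vw by (force intro: V.span_base)
    then have "tens V W v w = tens V W (\<Sum>x\<leftarrow>L. case x of (\<alpha>, b) \<Rightarrow> scale V (\<alpha> v) b) w"
      using L(2) by simp
    also have "\<dots> = (\<Sum>x\<leftarrow>L. tens V W (case x of (\<alpha>, b) \<Rightarrow> scale V (\<alpha> v) b) w)"
      by (rule lin_map_sum_list[OF bilinear_left[OF bilinear_tens]])
        (use vwc V L(1) in \<open>auto intro: carr_scale\<close>)
    also have "\<dots> = (\<Sum>(\<alpha>, b)\<leftarrow>L. tens V W b (tcoeff V W \<alpha> (tens V W v w)))"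
      by (rule sum_list_cong)
        (use vwc V W L(1) in \<open>auto simp: tcoeff_tens tens_scale_left tens_scale_right\<close>)
    finally show ?thesis .
  qed
  \<comment> \<open>One list \<open>L\<close> serves all summands, and the expansion is linear in
    the tensor, so it passes from the pure summands to their sum.\<close>
  have lin: "lin_map (tensor V W) (tensor V W)
      (\<lambda>t. \<Sum>x\<leftarrow>L. case x of (\<alpha>, b) \<Rightarrow> tens V W b (tcoeff V W \<alpha> t))"
    using L(1) W by (intro lin_map_sum)
      (auto intro: lin_map_comp[OF tcoeff_lin bilinear_right[OF bilinear_tens]])
  have "t = (\<Sum>x\<leftarrow>xs. case x of (v, w) \<Rightarrow> tens V W v w)" using xs(2) by (simp add: tsum_def)
  also have "\<dots> = (\<Sum>x\<leftarrow>xs. \<Sum>(\<alpha>, b)\<leftarrow>L. tens V W b (tcoeff V W \<alpha> (case x of (v, w) \<Rightarrow> tens V W v w)))"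
    by (rule sum_list_cong) (use 1 in auto)
  also have "\<dots> = (\<Sum>(\<alpha>, b)\<leftarrow>L. tens V W b (tcoeff V W \<alpha> t))"
    unfolding xs(2) tsum_def
    by (rule lin_map_sum_list[OF lin is_vspace_tensor, symmetric]) (use xs in \<open>auto intro: tens_carr\<close>)
  finally show ?thesis using L(1) by blast
qed

lemma tens_zero: "is_vspace W \<Longrightarrow> v \<in> carr V \<Longrightarrow> tens V W v 0 = 0"
  using lin_map_zero[OF bilinear_right[OF bilinear_tens]] .

text \<open>By \<open>tensor_expand\<close> the difference is determined by its coefficients in
  \<open>W\<close>. Each of them is killed by every form in \<open>\<Psi>\<close>, since
  coefficients and contractions commute. Any separating family will do; in the applications it often
  consists of evaluations.\<close>

lemma tensor_eqI:
  assumes V: "is_vspace V" and W: "is_vspace W"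
    and s: "s \<in> carr (tensor V W)" and t: "t \<in> carr (tensor V W)"
    and \<Psi>: "\<And>f. f \<in> \<Psi> \<Longrightarrow> lin_map W fld f"
    and sep: "\<And>w. w \<in> carr W \<Longrightarrow> (\<And>f. f \<in> \<Psi> \<Longrightarrow> f w = 0) \<Longrightarrow> w = 0"
    and eq: "\<And>f. f \<in> \<Psi> \<Longrightarrow> tcontr V W f s = tcontr V W f t"
  shows "s = t"
proof -
  have d: "s - t \<in> carr (tensor V W)" using s t by (intro carr_diff) auto
  obtain L where L: "\<And>\<alpha> b. (\<alpha>, b) \<in> set L \<Longrightarrow> b \<in> carr V \<and> lin_map V fld \<alpha>"
    "s - t = (\<Sum>(\<alpha>, b)\<leftarrow>L. tens V W b (tcoeff V W \<alpha> (s - t)))"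
    using tensor_expand[OF V W d] by fastforce
  have "tcoeff V W \<alpha> (s - t) = 0" if "(\<alpha>, b) \<in> set L" for \<alpha> b
  proof (rule sep)
    have \<alpha>: "lin_map V fld \<alpha>" using L(1) that by blast
    show "tcoeff V W \<alpha> (s - t) \<in> carr W" by (rule lin_map_carr[OF tcoeff_lin[OF W \<alpha>] d])
    show "f (tcoeff V W \<alpha> (s - t)) = 0" if f: "f \<in> \<Psi>" for f
      using lin_map_diff[OF tcontr_lin[OF V \<Psi>[OF f]] _ V s t] lin_map_zero[OF \<alpha> V] eq[OF f]
      by (simp add: tcoeff_tcontr[OF V W \<alpha> \<Psi>[OF f] d])
  qed
  then have "(\<Sum>(\<alpha>, b)\<leftarrow>L. tens V W b (tcoeff V W \<alpha> (s - t))) = (\<Sum>x\<leftarrow>L. 0)"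
    using L(1) by (intro sum_list_cong) (auto simp: tens_zero W)
  then show ?thesis using L(2) by simp
qed

lemma tlift_prod_tcontr:
  assumes "is_vspace V" "lin_map V fld \<phi>" "lin_map W fld f" "t \<in> carr (tensor V W)"
  shows "tlift V W fld (\<lambda>v w. \<phi> v * f w) t = \<phi> (tcontr V W f t)"
  using assms(4)
  by (rule tensor_lin_eq[rotated 4, OF _ tlift_lin lin_map_comp[OF tcontr_lin]])
    (use assms in \<open>auto simp: tlift_tens bilinear_mult tcontr_tens lin_map_scale\<close>)

text \<open>Two uses of separation, one per factor: contracting by \<open>g\<close> reduces the
  claim to an equality in \<open>V\<close>, which is then tested by the forms
  \<open>f\<close>.\<close>

lemma tensor_eqI2:
  assumes V: "is_vspace V" and W: "is_vspace W"
    and s: "s \<in> carr (tensor V W)" and t: "t \<in> carr (tensor V W)"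
    and \<Phi>: "\<And>f. f \<in> \<Phi> \<Longrightarrow> lin_map V fld f" and \<Psi>: "\<And>f. f \<in> \<Psi> \<Longrightarrow> lin_map W fld f"
    and sepV: "\<And>v. v \<in> carr V \<Longrightarrow> (\<And>f. f \<in> \<Phi> \<Longrightarrow> f v = 0) \<Longrightarrow> v = 0"
    and sepW: "\<And>w. w \<in> carr W \<Longrightarrow> (\<And>f. f \<in> \<Psi> \<Longrightarrow> f w = 0) \<Longrightarrow> w = 0"
    and eq: "\<And>f g. f \<in> \<Phi> \<Longrightarrow> g \<in> \<Psi> \<Longrightarrow> tlift V W fld (\<lambda>v w. f v * g w) s = tlift V W fld (\<lambda>v w. f v * g w) t"
  shows "s = t"
proof (rule tensor_eqI[OF V W s t \<Psi> sepW])
  fix g assume g: "g \<in> \<Psi>"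
  have c: "tcontr V W g s \<in> carr V" "tcontr V W g t \<in> carr V"
    using lin_map_carr[OF tcontr_lin[OF V \<Psi>[OF g]]] s t by auto
  have "tcontr V W g s - tcontr V W g t = 0"
  proof (rule sepV)
    show "tcontr V W g s - tcontr V W g t \<in> carr V" using c by (intro carr_diff V)
    show "f (tcontr V W g s - tcontr V W g t) = 0" if f: "f \<in> \<Phi>" for f
      using eq[OF f g] lin_map_diff[OF \<Phi>[OF f] V _ c]
      by (simp add: tlift_prod_tcontr V \<Phi>[OF f] \<Psi>[OF g] s t)
  qed
  then show "tcontr V W g s = tcontr V W g t" by simp
qed

text \<open>A basis of \<open>X\<close> is independent in the whole space, so some form takes the
  values of \<open>g\<close> on it; the two then agree on all of \<open>X\<close>. Later this shows
  that restricting a comeasuring to a subalgebra does not enlarge its cosupport.\<close>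

lemma form_extend:
  fixes V :: "('f::field, 'v::ab_group_add, 'm) vspace_scheme"
  assumes V: "is_vspace V" and X: "module.subspace (scale V) X"
    and g: "\<And>x y. x \<in> X \<Longrightarrow> y \<in> X \<Longrightarrow> g (x + y) = g x + g y"
      "\<And>c x. x \<in> X \<Longrightarrow> g (scale V c x) = c * g x"
  shows "\<exists>h. Vector_Spaces.linear (scale V) (*) h \<and> (\<forall>x\<in>X. h x = g x)"
proof -
  interpret V: vector_space "scale V" using V by (simp add: is_vspace_def)
  interpret F: vector_space "(*) :: 'f \<Rightarrow> 'f \<Rightarrow> 'f"
    by unfold_locales (auto simp: algebra_simps)
  interpret VF: vector_space_pair "scale V" "(*) :: 'f \<Rightarrow> 'f \<Rightarrow> 'f" ..
  obtain B where B: "B \<subseteq> X" "V.independent B" "X \<subseteq> V.span B"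
    using V.maximal_independent_subset by blast
  obtain h where h: "Vector_Spaces.linear (scale V) (*) h" "\<And>x. x \<in> B \<Longrightarrow> h x = g x"
    using VF.linear_independent_extend[OF B(2), of g] by blast
  interpret h: Vector_Spaces.linear "scale V" "(*)" h by (rule h)
  have "x \<in> X \<and> h x = g x" if "x \<in> V.span B" for x
    using that
  proof (induction rule: V.span_induct_alt)
    case base
    have "g 0 = 0" using g(2)[of 0 0] V.subspace_0[OF X] by simp
    then show ?case using V.subspace_0[OF X] h.zero by simp
  next
    case (step c x y)
    then show ?case
      using g(1)[of "scale V c x" y] g(2)[of x c] V.subspace_scale[OF X, of x c] B(1) h(2)[of x]
        V.subspace_add[OF X, of "scale V c x" y] h.add[of "scale V c x" y] h.scale[of c x] by auto
  qed
  then show ?thesis using B(3) h(1) by blast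
qed

text \<open>The dual basis expansion of \<open>v\<close> over the set \<open>{v}\<close> would have
  only zero coordinates.\<close>

lemma forms_separate:
  fixes V :: "('f::field, 'v::ab_group_add, 'm) vspace_scheme"
  assumes V: "is_vspace V" and v: "v \<in> carr V" "\<And>f. f \<in> Hom V fld \<Longrightarrow> f v = 0"
  shows "v = 0"
proof (rule ccontr)
  assume nz: "v \<noteq> 0"
  from finite_dual_basis[OF V, of "{v}"] v obtain L where
    L: "\<And>\<alpha> b. (\<alpha>, b) \<in> set L \<Longrightarrow> Vector_Spaces.linear (scale V) (*) \<alpha>"
    "v = (\<Sum>(\<alpha>, b)\<leftarrow>L. scale V (\<alpha> v) b)"
    using module.span_base[of "scale V" v "{v}"] V
    by (fastforce simp: is_vspace_def module_def vector_space_def)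
  have "\<alpha> v = 0" if "(\<alpha>, b) \<in> set L" for \<alpha> b
    using v(2)[OF zrestr_Hom[OF V linear_lin_map[OF L(1)[OF that]]]] v(1) by simp
  then have "(\<Sum>(\<alpha>, b)\<leftarrow>L. scale V (\<alpha> v) b) = (\<Sum>x\<leftarrow>L. 0)"
    by (intro sum_list_cong) (metis (mono_tags, lifting) case_prod_conv scale_zero_left[OF V] surj_pair)
  then show False using L(2) nz by simp
qed

section \<open>Sweedler sums\<close>

text \<open>Linear notions see only the scalars and the carrier of a record. This identifies the
  spaces underlying \<open>coalg_of B\<close> and \<open>B\<close>, or \<open>fdual B\<close> and
  \<open>fdual_space B\<close>, which are different records.\<close>

lemma space_cong:
  assumes "scale V = scale V'" "carr V = carr V'"
  shows lin_map_cong_dom: "lin_map V = lin_map V'"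
    and lin_map_cong_ran: "lin_map U V = lin_map U V'"
    and is_vspace_cong: "is_vspace V = is_vspace V'"
    and tens_cong: "tens V V = tens V' V'"
    and tensor_cong: "tensor V V = tensor V' V'"
    and tlift_cong: "tlift V V = tlift V' V'"
    and trep_cong: "trep V V = trep V' V'"
    and bilinear_cong: "bilinear V V W = bilinear V' V' W"
proof -
  show 1: "lin_map V = lin_map V'" for W :: "('a, 'x::ab_group_add, 'y) vspace_scheme"
    using assms by (simp add: lin_map_def fun_eq_iff)
  show 2: "lin_map U V = lin_map U V'"
    using assms by (simp add: lin_map_def fun_eq_iff)
  show 3: "is_vspace V = is_vspace V'"
    using assms by (simp add: is_vspace_def)
  have b: "bilinear V V W \<beta> = bilinear V' V' W \<beta>" for W :: "('a, 'x::ab_group_add, 'y) vspace_scheme" and \<beta>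
    using assms by (simp add: bilinear_def lin_map_def)
  then show "bilinear V V W = bilinear V' V' W" by (intro ext)
  show 4: "tens V V = tens V' V'"
    by (simp add: tens_def fun_eq_iff b)
  show 5: "tensor V V = tensor V' V'"
    using assms by (simp add: tensor_def 4)
  show "tlift V V = tlift V' V'"
    using assms by (intro ext) (simp add: tlift_def 4 5)
  show "trep V V = trep V' V'"
    using assms by (intro ext) (simp add: trep_def tsum_def 4)
qed

lemma coalg_of_sel [simp]:
  "scale (coalg_of B) = scale B" "carr (coalg_of B) = carr B"
  "comul (coalg_of B) = bcomul B" "counit (coalg_of B) = bcounit B"
  by (simp_all add: coalg_of_def)

lemmas coalg_of_cong [simp] = space_cong[of "coalg_of B" B for B, simplified]

text \<open>Sweedler notation: \<open>\<Sum>(x, y)\<leftarrow>cop P p. \<beta> x y\<close> stands for \<open>\<beta>(p\<^sub>(\<^sub>1\<^sub>), p\<^sub>(\<^sub>2\<^sub>))\<close>.\<close>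

definition cop where
  "cop P p = trep P P (comul P p)"

text \<open>For Sweedler sums with three factors a function of three arguments is handier than
  \<open>multilinear\<close>, which takes lists.\<close>

definition trilinear where
  "trilinear V U \<gamma> \<longleftrightarrow> (\<forall>a\<in>carr V. \<forall>b\<in>carr V.
     lin_map V U (\<lambda>x. \<gamma> x a b) \<and> lin_map V U (\<lambda>x. \<gamma> a x b) \<and> lin_map V U (\<lambda>x. \<gamma> a b x))"

lemma tuples_3: "xs \<in> tuples V 3 \<longleftrightarrow> (\<exists>a\<in>carr V. \<exists>b\<in>carr V. \<exists>c\<in>carr V. xs = [a, b, c])"
  by (auto simp: tuples_def numeral_3_eq_3 length_Suc_conv)

lemma trilinear_multilinear:
  "trilinear V U \<gamma> \<Longrightarrow> multilinear V 3 U (\<lambda>l. \<gamma> (l ! 0) (l ! 1) (l ! 2))"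
  unfolding multilinear_def Ball_def tuples_3
  by (auto simp: trilinear_def less_Suc_eq numeral_2_eq_2 numeral_3_eq_3
      intro: lin_map_carr[of V U "\<gamma> _ _"])

lemma multilinear_trilinear:
  assumes "multilinear V 3 U \<gamma>"
  shows "trilinear V U (\<lambda>a b c. \<gamma> [a, b, c])"
  unfolding trilinear_def
proof (intro ballI conjI)
  fix a b assume ab: "a \<in> carr V" "b \<in> carr V"
  have *: "lin_map V U (\<lambda>x. \<gamma> (list_update [x', y', z'] i x))"
    if "x' \<in> carr V" "y' \<in> carr V" "z' \<in> carr V" "i < 3" for x' y' z' i
  proof -
    have "[x', y', z'] \<in> tuples V 3" using that by (simp add: tuples_3)
    then show ?thesis using assms that(4) unfolding multilinear_def by blast
  qed
  show "lin_map V U (\<lambda>x. \<gamma> [x, a, b])" using *[of a a b 0] ab by (simp add: numeral_2_eq_2)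
  show "lin_map V U (\<lambda>x. \<gamma> [a, x, b])" using *[of a a b 1] ab by (simp add: numeral_2_eq_2)
  show "lin_map V U (\<lambda>x. \<gamma> [a, b, x])" using *[of a b b 2] ab by (simp add: numeral_2_eq_2)
qed

lemma trilinear_mult: "lin_map V fld f \<Longrightarrow> lin_map V fld g \<Longrightarrow> lin_map V fld h \<Longrightarrow>
    trilinear V fld (\<lambda>a b c. f a * g b * h c)"
  by (auto simp: trilinear_def lin_map_def algebra_simps)

lemma multilinear_ptens: "multilinear V n (tpower V n) (ptens V n)"
  unfolding multilinear_def
proof (intro conjI ballI allI impI)
  fix xs i assume xs: "xs \<in> tuples V n" and i: "i < n"
  have t: "xs[i := x] \<in> tuples V n" if "x \<in> carr V" for x
    using xs i that by (auto simp: tuples_def dest!: set_update_subset_insert[THEN subsetD])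
  have lin: "lin_map V fld (\<lambda>x. \<beta> (xs[i := x]))" if "multilinear V n fld \<beta>" for \<beta>
    using that xs i by (auto simp: multilinear_def)
  show "lin_map V (tpower V n) (\<lambda>x. ptens V n (xs[i := x]))"
  proof (rule lin_mapI)
    show "ptens V n (xs[i := x]) \<in> carr (tpower V n)" if "x \<in> carr V" for x
      using that by (intro ptens_carr t)
  qed (auto simp: ptens_def fun_eq_iff plus_fun_def fscale_def
        lin_map_add[OF lin] lin_map_scale[OF lin])
qed (rule ptens_carr)

text \<open>The linear part of a coalgebra is kept apart, because Sweedler sums have to be used for
  the finite dual and for transported structures before their coassociativity is known.\<close>

locale precoalg =
  fixes P :: "('f::field, 'p::ab_group_add, 'm) coalg_scheme"
  assumes vs: "is_vspace P"
    and comul_lin: "lin_map P (tensor P P) (comul P)"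
    and counit_lin: "lin_map P fld (counit P)"
begin

lemma cop_carr: "p \<in> carr P \<Longrightarrow> (x, y) \<in> set (cop P p) \<Longrightarrow> x \<in> carr P"
  "p \<in> carr P \<Longrightarrow> (x, y) \<in> set (cop P p) \<Longrightarrow> y \<in> carr P"
  using trep(1)[OF vs lin_map_carr[OF comul_lin]] by (auto simp: cop_def)

lemma cop_tlift: "is_vspace U \<Longrightarrow> bilinear P P U \<beta> \<Longrightarrow> p \<in> carr P \<Longrightarrow>
    tlift P P U \<beta> (comul P p) = (\<Sum>(x, y)\<leftarrow>cop P p. \<beta> x y)"
  unfolding cop_def by (rule tlift_trep[OF vs _ _ lin_map_carr[OF comul_lin]])

lemma cop_lin:
  assumes "is_vspace U" "bilinear P P U \<beta>"
  shows "lin_map P U (\<lambda>p. \<Sum>(x, y)\<leftarrow>cop P p. \<beta> x y)"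
proof -
  have "lin_map P U (\<lambda>p. tlift P P U \<beta> (comul P p))"
    by (rule lin_map_comp[OF comul_lin tlift_lin[OF assms]])
  then show ?thesis
    by (rule lin_map_cong[THEN iffD1, rotated 2]) (use assms vs in \<open>auto simp: cop_tlift\<close>)
qed

lemma cop_cong: "p \<in> carr P \<Longrightarrow> (\<And>x y. x \<in> carr P \<Longrightarrow> y \<in> carr P \<Longrightarrow> \<beta> x y = \<beta>' x y) \<Longrightarrow>
    (\<Sum>(x, y)\<leftarrow>cop P p. \<beta> x y) = (\<Sum>(x, y)\<leftarrow>cop P p. \<beta>' x y)"
  by (intro sum_list_cong) (auto dest: cop_carr)

lemma trilinear_bilinear_left:
  assumes "is_vspace U" "trilinear P U \<gamma>"
  shows "bilinear P P U (\<lambda>x y. \<Sum>(x1, x2)\<leftarrow>cop P x. \<gamma> x1 x2 y)"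
proof (rule bilinearI)
  show "lin_map P U (\<lambda>y. \<Sum>(x1, x2)\<leftarrow>cop P x. \<gamma> x1 x2 y)" if "x \<in> carr P" for x
    using assms that by (intro lin_map_sum) (auto simp: trilinear_def dest: cop_carr)
  show "lin_map P U (\<lambda>x. \<Sum>(x1, x2)\<leftarrow>cop P x. \<gamma> x1 x2 y)" if "y \<in> carr P" for y
    using assms that by (intro cop_lin bilinearI) (auto simp: trilinear_def)
qed

lemma trilinear_bilinear_right:
  assumes "is_vspace U" "trilinear P U \<gamma>"
  shows "bilinear P P U (\<lambda>x y. \<Sum>(y1, y2)\<leftarrow>cop P y. \<gamma> x y1 y2)"
proof (rule bilinearI)
  show "lin_map P U (\<lambda>x. \<Sum>(y1, y2)\<leftarrow>cop P y. \<gamma> x y1 y2)" if "y \<in> carr P" for y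
    using assms that by (intro lin_map_sum) (auto simp: trilinear_def dest: cop_carr)
  show "lin_map P U (\<lambda>y. \<Sum>(y1, y2)\<leftarrow>cop P y. \<gamma> x y1 y2)" if "x \<in> carr P" for x
    using assms that by (intro cop_lin bilinearI) (auto simp: trilinear_def)
qed

lemma ptens3_trilinear: "trilinear P (tpower P 3) (\<lambda>a b c. ptens P 3 [a, b, c])"
  by (rule multilinear_trilinear[OF multilinear_ptens])

lemma tlift_left:
  assumes "is_vspace U" "trilinear P U \<gamma>" "p \<in> carr P"
  shows "tlift P P U (\<lambda>x y. tlift P P U (\<lambda>x1 x2. \<gamma> x1 x2 y) (comul P x)) (comul P p) =
    (\<Sum>(x, y)\<leftarrow>cop P p. \<Sum>(x1, x2)\<leftarrow>cop P x. \<gamma> x1 x2 y)"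
proof -
  have b: "bilinear P P U (\<lambda>x1 x2. \<gamma> x1 x2 y)" if "y \<in> carr P" for y
    using assms that by (intro bilinearI) (auto simp: trilinear_def)
  have "bilinear P P U (\<lambda>x y. tlift P P U (\<lambda>x1 x2. \<gamma> x1 x2 y) (comul P x))"
    using trilinear_bilinear_left[OF assms(1,2)] vs assms(1) b
    by (auto simp: bilinear_def lin_map_def cop_tlift vs_carr)
  then show ?thesis
    using assms b by (simp add: cop_tlift) (intro cop_cong, auto simp: cop_tlift)
qed

lemma tlift_right:
  assumes "is_vspace U" "trilinear P U \<gamma>" "p \<in> carr P"
  shows "tlift P P U (\<lambda>x y. tlift P P U (\<lambda>y1 y2. \<gamma> x y1 y2) (comul P y)) (comul P p) =
    (\<Sum>(x, y)\<leftarrow>cop P p. \<Sum>(y1, y2)\<leftarrow>cop P y. \<gamma> x y1 y2)"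
proof -
  have b: "bilinear P P U (\<lambda>y1 y2. \<gamma> x y1 y2)" if "x \<in> carr P" for x
    using assms that by (intro bilinearI) (auto simp: trilinear_def)
  have "bilinear P P U (\<lambda>x y. tlift P P U (\<lambda>y1 y2. \<gamma> x y1 y2) (comul P y))"
    using trilinear_bilinear_right[OF assms(1,2)] vs assms(1) b
    by (auto simp: bilinear_def lin_map_def cop_tlift vs_carr)
  then show ?thesis
    using assms b by (simp add: cop_tlift) (intro cop_cong, auto simp: cop_tlift)
qed

end

locale coalg =
  fixes P :: "('f::field, 'p::ab_group_add, 'm) coalg_scheme"
  assumes coalgebra: "coalgebra P"

sublocale coalg \<subseteq> precoalg
  using coalgebra by unfold_locales (auto simp: coalgebra_def)

context coalg
begin

lemma counit_left:
  assumes "is_vspace U" "lin_map P U h" "p \<in> carr P"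
  shows "(\<Sum>(x, y)\<leftarrow>cop P p. scale U (counit P x) (h y)) = h p"
proof -
  have "h p = h (\<Sum>(x, y)\<leftarrow>cop P p. scale P (counit P x) y)"
    using coalgebra assms vs counit_lin unfolding coalgebra_def
    by (simp add: cop_tlift bilinear_scale_left)
  also have "\<dots> = (\<Sum>z\<leftarrow>cop P p. h (case z of (x, y) \<Rightarrow> scale P (counit P x) y))"
    using assms vs by (intro lin_map_sum_list) (auto intro!: carr_scale dest: cop_carr)
  also have "\<dots> = (\<Sum>(x, y)\<leftarrow>cop P p. scale U (counit P x) (h y))"
    using assms by (intro sum_list_cong) (auto simp: lin_map_scale dest: cop_carr)
  finally show ?thesis by simp
qed

lemma counit_right:
  assumes "is_vspace U" "lin_map P U h" "p \<in> carr P"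
  shows "(\<Sum>(x, y)\<leftarrow>cop P p. scale U (counit P y) (h x)) = h p"
proof -
  have "h p = h (\<Sum>(x, y)\<leftarrow>cop P p. scale P (counit P y) x)"
    using coalgebra assms vs counit_lin unfolding coalgebra_def
    by (simp add: cop_tlift bilinear_scale_right)
  also have "\<dots> = (\<Sum>z\<leftarrow>cop P p. h (case z of (x, y) \<Rightarrow> scale P (counit P y) x))"
    using assms vs by (intro lin_map_sum_list) (auto intro!: carr_scale dest: cop_carr)
  also have "\<dots> = (\<Sum>(x, y)\<leftarrow>cop P p. scale U (counit P y) (h x))"
    using assms by (intro sum_list_cong) (auto simp: lin_map_scale dest: cop_carr)
  finally show ?thesis by simp
qed

text \<open>Apply the linear map out of the tensor cube induced by \<open>\<gamma>\<close> to the
  defining identity between sums of pure tensors.\<close>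

lemma coassoc:
  assumes U: "is_vspace U" and \<gamma>: "trilinear P U \<gamma>" and p: "p \<in> carr P"
  shows "(\<Sum>(x, y)\<leftarrow>cop P p. \<Sum>(x1, x2)\<leftarrow>cop P x. \<gamma> x1 x2 y) =
    (\<Sum>(x, y)\<leftarrow>cop P p. \<Sum>(y1, y2)\<leftarrow>cop P y. \<gamma> x y1 y2)"
proof -
  let ?h = "plift P 3 U (\<lambda>l. \<gamma> (l ! 0) (l ! 1) (l ! 2))"
  note m = trilinear_multilinear[OF \<gamma>]
  note hl = plift_lin[OF U m]
  have h: "?h (ptens P 3 [a, b, c]) = \<gamma> a b c" if "a \<in> carr P" "b \<in> carr P" "c \<in> carr P" for a b c
    using plift_ptens[OF U m, of "[a, b, c]"] that by (simp add: tuples_3)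
  have c: "ptens P 3 [a, b, c] \<in> carr (tpower P 3)" if "a \<in> carr P" "b \<in> carr P" "c \<in> carr P" for a b c
    using that by (intro ptens_carr) (simp add: tuples_3)
  have eq: "(\<Sum>(x, y)\<leftarrow>cop P p. \<Sum>(x1, x2)\<leftarrow>cop P x. ptens P 3 [x1, x2, y]) =
    (\<Sum>(x, y)\<leftarrow>cop P p. \<Sum>(y1, y2)\<leftarrow>cop P y. ptens P 3 [x, y1, y2])"
    using coalgebra p unfolding coalgebra_def
    by (simp add: tlift_left[OF _ ptens3_trilinear] tlift_right[OF _ ptens3_trilinear])
  note * = lin_map_sum_list2[OF hl is_vspace_tpower]
  have cc: "fst z \<in> carr P" "snd z \<in> carr P" if "z \<in> set (cop P q)" "q \<in> carr P" for z q
    using cop_carr[of q "fst z" "snd z"] that by auto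
  have "(\<Sum>(x, y)\<leftarrow>cop P p. \<Sum>(x1, x2)\<leftarrow>cop P x. \<gamma> x1 x2 y) =
      ?h (\<Sum>(x, y)\<leftarrow>cop P p. \<Sum>(x1, x2)\<leftarrow>cop P x. ptens P 3 [x1, x2, y])"
    unfolding case_prod_unfold
    by (subst *) (use p in \<open>auto simp del: One_nat_def intro!: c sum_list_cong h[symmetric] cc\<close>)
  also have "\<dots> = (\<Sum>(x, y)\<leftarrow>cop P p. \<Sum>(y1, y2)\<leftarrow>cop P y. \<gamma> x y1 y2)"
    unfolding eq unfolding case_prod_unfold
    by (subst *) (use p in \<open>auto simp del: One_nat_def intro!: c sum_list_cong h cc\<close>)
  finally show ?thesis .
qed

end

text \<open>Both lists define tensors in \<open>(V \<otimes> V) \<otimes> V\<close>, where products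
  of three forms from \<open>\<Phi>\<close> separate points; every trilinear \<open>\<gamma>\<close>
  factors through that space.\<close>

lemma trilinear_sum_eqI:
  fixes V :: "('f::field, 'v::ab_group_add, 'm) vspace_scheme"
    and U :: "('f::field, 'u::ab_group_add, 'n) vspace_scheme"
  assumes V: "is_vspace V"
    and \<Phi>: "\<And>f. f \<in> \<Phi> \<Longrightarrow> lin_map V fld f"
    and sep: "\<And>v. v \<in> carr V \<Longrightarrow> (\<And>f. f \<in> \<Phi> \<Longrightarrow> f v = 0) \<Longrightarrow> v = 0"
    and xs: "set xs \<subseteq> carr V \<times> carr V \<times> carr V" and ys: "set ys \<subseteq> carr V \<times> carr V \<times> carr V"
    and eq: "\<And>f g h. f \<in> \<Phi> \<Longrightarrow> g \<in> \<Phi> \<Longrightarrow> h \<in> \<Phi> \<Longrightarrow>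
      (\<Sum>(a, b, c)\<leftarrow>xs. f a * g b * h c) = (\<Sum>(a, b, c)\<leftarrow>ys. f a * g b * h c)"
    and U: "is_vspace U" and \<gamma>: "trilinear V U \<gamma>"
  shows "(\<Sum>(a, b, c)\<leftarrow>xs. \<gamma> a b c) = (\<Sum>(a, b, c)\<leftarrow>ys. \<gamma> a b c)"
proof -
  let ?VV = "tensor V V"
  \<comment> \<open>An iterated twofold tensor product replaces the tensor cube, because
    \<open>tensor_eqI2\<close> handles two factors.\<close>
  define T where "T zs = tsum ?VV V (map (\<lambda>(a, b, c). (tens V V a b, c)) zs)" for zs
  have sub: "set (map (\<lambda>(a, b, c). (tens V V a b, c)) zs) \<subseteq> carr ?VV \<times> carr V"
    if "set zs \<subseteq> carr V \<times> carr V \<times> carr V" for zs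
    using that by (auto intro: tens_carr)
  have T: "tlift ?VV V W \<beta> (T zs) = (\<Sum>(a, b, c)\<leftarrow>zs. \<beta> (tens V V a b) c)"
    if "set zs \<subseteq> carr V \<times> carr V \<times> carr V" "is_vspace W" "bilinear ?VV V W \<beta>"
    for zs \<beta> and W :: "('f, 'w::ab_group_add, 'k) vspace_scheme"
    unfolding T_def by (subst tlift_tsum[OF that(2,3) sub[OF that(1)]]) (simp add: comp_def case_prod_unfold)
  have T': "tlift ?VV V fld \<beta> (T zs) = (\<Sum>(a, b, c)\<leftarrow>zs. \<beta> (tens V V a b) c)"
    if "set zs \<subseteq> carr V \<times> carr V \<times> carr V" "bilinear ?VV V fld \<beta>" for zs \<beta>
    unfolding T_def by (subst tlift_tsum[OF is_vspace_fld that(2) sub[OF that(1)]]) (simp add: comp_def case_prod_unfold)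
  \<comment> \<open>Products of two forms from \<open>\<Phi>\<close>. They separate
    \<open>V \<otimes> V\<close> by a first use of \<open>tensor_eqI2\<close>, which makes the
    second use possible.\<close>
  let ?\<Phi> = "{tlift V V fld (\<lambda>a b. f a * g b) | f g. f \<in> \<Phi> \<and> g \<in> \<Phi>}"
  have lin: "lin_map ?VV fld F" if "F \<in> ?\<Phi>" for F
    using that by (auto intro!: tlift_lin bilinear_mult \<Phi>)
  have "T xs = T ys"
  proof (rule tensor_eqI2[where \<Phi> = ?\<Phi> and \<Psi> = \<Phi>])
    show "T xs \<in> carr (tensor ?VV V)" "T ys \<in> carr (tensor ?VV V)"
      unfolding T_def using xs ys by (intro tsum_carr sub; simp)+
    show "v = 0" if "v \<in> carr ?VV" "\<And>f. f \<in> ?\<Phi> \<Longrightarrow> f v = 0" for v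
    proof (rule tensor_eqI2[OF V V that(1) _ \<Phi> \<Phi> sep sep])
      fix f g assume fg: "f \<in> \<Phi>" "g \<in> \<Phi>"
      have "tlift V V fld (\<lambda>a b. f a * g b) 0 = 0"
        using fg by (intro lin_map_zero[OF tlift_lin]) (auto intro: bilinear_mult \<Phi>)
      then show "tlift V V fld (\<lambda>v w. f v * g w) v = tlift V V fld (\<lambda>v w. f v * g w) 0"
        using that(2)[of "tlift V V fld (\<lambda>a b. f a * g b)"] fg by auto
    qed (auto simp: carr_zero)
    show "tlift ?VV V fld (\<lambda>v w. F v * h w) (T xs) = tlift ?VV V fld (\<lambda>v w. F v * h w) (T ys)"
      if F: "F \<in> ?\<Phi>" and h: "h \<in> \<Phi>" for F h
    proof -
      obtain f g where fg: "f \<in> \<Phi>" "g \<in> \<Phi>" "F = tlift V V fld (\<lambda>a b. f a * g b)" using F by blast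
      have "tlift ?VV V fld (\<lambda>v w. F v * h w) (T zs) = (\<Sum>(a, b, c)\<leftarrow>zs. f a * g b * h c)"
        if "set zs \<subseteq> carr V \<times> carr V \<times> carr V" for zs
        unfolding T'[OF that bilinear_mult[OF lin[OF F] \<Phi>[OF h]]]
        using that by (intro sum_list_cong) (auto simp: fg(3) tlift_tens bilinear_mult \<Phi> fg(1,2))
      then show ?thesis using eq[OF fg(1,2) h] xs ys by simp
    qed
  qed (use V lin \<Phi> sep in auto)
  moreover
  let ?H = "tlift ?VV V U (\<lambda>t c. tlift V V U (\<lambda>a b. \<gamma> a b c) t)"
  have b: "bilinear V V U (\<lambda>a b. \<gamma> a b c)" if "c \<in> carr V" for c
    using \<gamma> that by (intro bilinearI) (auto simp: trilinear_def)
  have "bilinear ?VV V U (\<lambda>t c. tlift V V U (\<lambda>a b. \<gamma> a b c) t)"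
  proof (rule bilinearI)
    show "lin_map V U (\<lambda>c. tlift V V U (\<lambda>a b. \<gamma> a b c) t)" if t: "t \<in> carr ?VV" for t
    proof -
      have "lin_map V U (\<lambda>c. \<Sum>x\<leftarrow>trep V V t. case x of (a, b) \<Rightarrow> \<gamma> a b c)"
        using \<gamma> trep(1)[OF V t] by (intro lin_map_sum U) (auto simp: trilinear_def)
      then show ?thesis
        by (rule lin_map_cong[THEN iffD1, rotated 2]) (auto simp: V tlift_trep U b t)
    qed
  qed (auto intro: tlift_lin U b)
  then have "?H (T zs) = (\<Sum>(a, b, c)\<leftarrow>zs. \<gamma> a b c)" if "set zs \<subseteq> carr V \<times> carr V \<times> carr V" for zs
    using that by (subst T[OF that U]) (auto intro!: sum_list_cong simp: tlift_tens U b)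
  ultimately show ?thesis using xs ys by metis
qed

context precoalg
begin

text \<open>Coassociativity need only hold after applying three forms from a separating family. For
  the finite dual these are the evaluations, where it becomes associativity of the algebra; for a
  transported coalgebra all linear forms are used.\<close>

lemma coalgebraI_sep:
  assumes \<Phi>: "\<And>f. f \<in> \<Phi> \<Longrightarrow> lin_map P fld f"
    and sep: "\<And>v. v \<in> carr P \<Longrightarrow> (\<And>f. f \<in> \<Phi> \<Longrightarrow> f v = 0) \<Longrightarrow> v = 0"
    and coassoc: "\<And>f g h p. f \<in> \<Phi> \<Longrightarrow> g \<in> \<Phi> \<Longrightarrow> h \<in> \<Phi> \<Longrightarrow> p \<in> carr P \<Longrightarrow>
      (\<Sum>(x, y)\<leftarrow>cop P p. \<Sum>(x1, x2)\<leftarrow>cop P x. f x1 * g x2 * h y) =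
      (\<Sum>(x, y)\<leftarrow>cop P p. \<Sum>(y1, y2)\<leftarrow>cop P y. f x * g y1 * h y2)"
    and left: "\<And>p. p \<in> carr P \<Longrightarrow> (\<Sum>(x, y)\<leftarrow>cop P p. scale P (counit P x) y) = p"
    and right: "\<And>p. p \<in> carr P \<Longrightarrow> (\<Sum>(x, y)\<leftarrow>cop P p. scale P (counit P y) x) = p"
  shows "coalgebra P"
proof -
  have "(\<Sum>(x, y)\<leftarrow>cop P p. \<Sum>(x1, x2)\<leftarrow>cop P x. ptens P 3 [x1, x2, y]) =
    (\<Sum>(x, y)\<leftarrow>cop P p. \<Sum>(y1, y2)\<leftarrow>cop P y. ptens P 3 [x, y1, y2])" if p: "p \<in> carr P" for p
  proof -
    \<comment> \<open>The two iterated coproducts, flattened to lists of triples to fit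
      \<open>trilinear_sum_eqI\<close>.\<close>
    let ?xs = "concat (map (\<lambda>(x, y). map (\<lambda>(x1, x2). (x1, x2, y)) (cop P x)) (cop P p))"
    let ?ys = "concat (map (\<lambda>(x, y). map (\<lambda>(y1, y2). (x, y1, y2)) (cop P y)) (cop P p))"
    have xs: "(\<Sum>(a, b, c)\<leftarrow>?xs. \<gamma> a b c) = (\<Sum>(x, y)\<leftarrow>cop P p. \<Sum>(x1, x2)\<leftarrow>cop P x. \<gamma> x1 x2 y)"
      for \<gamma> :: "'p \<Rightarrow> 'p \<Rightarrow> 'p \<Rightarrow> 'u::comm_monoid_add"
      by (simp add: sum_list_concat comp_def case_prod_unfold)
    have ys: "(\<Sum>(a, b, c)\<leftarrow>?ys. \<gamma> a b c) = (\<Sum>(x, y)\<leftarrow>cop P p. \<Sum>(y1, y2)\<leftarrow>cop P y. \<gamma> x y1 y2)"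
      for \<gamma> :: "'p \<Rightarrow> 'p \<Rightarrow> 'p \<Rightarrow> 'u::comm_monoid_add"
      by (simp add: sum_list_concat comp_def case_prod_unfold)
    have "(\<Sum>(a, b, c)\<leftarrow>?xs. ptens P 3 [a, b, c]) = (\<Sum>(a, b, c)\<leftarrow>?ys. ptens P 3 [a, b, c])"
    proof (rule trilinear_sum_eqI[where \<Phi> = \<Phi>, OF vs])
      show "trilinear P (tpower P 3) (\<lambda>a b c. ptens P 3 [a, b, c])" by (rule ptens3_trilinear)
      show "set ?xs \<subseteq> carr P \<times> carr P \<times> carr P" "set ?ys \<subseteq> carr P \<times> carr P \<times> carr P"
        using p by (auto dest: cop_carr)
      show "(\<Sum>(a, b, c)\<leftarrow>?xs. f a * g b * h c) = (\<Sum>(a, b, c)\<leftarrow>?ys. f a * g b * h c)"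
        if "f \<in> \<Phi>" "g \<in> \<Phi>" "h \<in> \<Phi>" for f g h
        unfolding xs ys by (rule coassoc[OF that p])
    qed (use \<Phi> sep in auto)
    then show ?thesis unfolding xs ys .
  qed
  then show ?thesis
    unfolding coalgebra_def using vs comul_lin counit_lin left right
    by (simp add: tlift_left[OF _ ptens3_trilinear] tlift_right[OF _ ptens3_trilinear]
        cop_tlift bilinear_scale_left bilinear_scale_right)
qed

end

section \<open>The convolution algebra of a coalgebra\<close>

lemma fscale_apply [simp]: "fscale c f x = c * f x"
  by (simp add: fscale_def)

text \<open>Serves as coordinate space in finite rank arguments and, with index type
  \<open>'u\<close>, as the space into which test objects are embedded.\<close>

definition fun_space :: "('f::field, 'i \<Rightarrow> 'f) vspace" where
  "fun_space = \<lparr>scale = fscale, carr = UNIV\<rparr>"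

lemma fun_space_sel [simp]: "scale fun_space = fscale" "carr fun_space = UNIV"
  by (simp_all add: fun_space_def)

lemma is_vspace_fun_space [simp]: "is_vspace fun_space"
  using module.subspace_UNIV[OF module_fscale] by (simp add: is_vspace_def vector_space_fscale)

lemma is_vspace_Hom:
  assumes V: "is_vspace V"
  shows "is_vspace \<lparr>scale = fscale, carr = Hom V fld\<rparr>"
proof -
  have "module.subspace fscale (Hom V fld)"
    unfolding module.subspace_def[OF module_fscale]
    by (auto simp: Hom_def lin_map_def fscale_def algebra_simps zero_fun_def)
  then show ?thesis by (simp add: is_vspace_def vector_space_fscale)
qed

definition dual_alg :: "('f::field, 'p::ab_group_add, 'm) coalg_scheme \<Rightarrow> ('f, 'p \<Rightarrow> 'f) alg" where
  "dual_alg P = \<lparr>scale = fscale, carr = Hom P fld,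
     mul = (\<lambda>f g. zrestr P (\<lambda>p. tlift P P fld (\<lambda>x y. f x * g y) (comul P p))),
     one = zrestr P (counit P)\<rparr>"

lemma dual_alg_sel [simp]: "scale (dual_alg P) = fscale" "carr (dual_alg P) = Hom P fld"
  "one (dual_alg P) = zrestr P (counit P)"
  by (simp_all add: dual_alg_def)

lemma (in precoalg) dual_mul: "lin_map P fld f \<Longrightarrow> lin_map P fld g \<Longrightarrow> p \<in> carr P \<Longrightarrow>
    mul (dual_alg P) f g p = (\<Sum>(x, y)\<leftarrow>cop P p. f x * g y)"
  by (simp add: dual_alg_def cop_tlift bilinear_mult)

lemma (in precoalg) dual_mul_lin:
  assumes "lin_map P fld f" "lin_map P fld g"
  shows "mul (dual_alg P) f g \<in> Hom P fld"
proof -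
  have "lin_map P fld (\<lambda>p. \<Sum>(x, y)\<leftarrow>cop P p. f x * g y)"
    using assms by (intro cop_lin bilinear_mult) auto
  then have "lin_map P fld (mul (dual_alg P) f g)"
    by (rule lin_map_cong[THEN iffD1, rotated 2]) (use assms vs in \<open>auto simp: dual_mul\<close>)
  then show ?thesis by (simp add: Hom_def) (simp add: dual_alg_def zrestr_def)
qed

text \<open>Associativity is coassociativity evaluated on a product of three forms, and the unit
  laws are the counit laws.\<close>

lemma (in coalg) algebra_dual: "algebra (dual_alg P)"
proof -
  note ml = dual_mul_lin[OF Hom_lin Hom_lin]
  have m: "mul (dual_alg P) f g p = (\<Sum>(x, y)\<leftarrow>cop P p. f x * g y)"
    if "f \<in> Hom P fld" "g \<in> Hom P fld" "p \<in> carr P" for f g p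
    using that by (simp add: dual_mul Hom_lin)
  note vsH = is_vspace_Hom[OF vs]
  have vsD: "is_vspace (dual_alg P)" using vsH by (simp add: is_vspace_def)
  have cl: "f \<in> Hom P fld \<Longrightarrow> g \<in> Hom P fld \<Longrightarrow> f + g \<in> Hom P fld"
    "f \<in> Hom P fld \<Longrightarrow> fscale c f \<in> Hom P fld" for f g c
    using carr_add[OF vsH] carr_scale[OF vsH] by auto
  have bil: "bilinear (dual_alg P) (dual_alg P) (dual_alg P) (mul (dual_alg P))"
  proof (intro bilinearI lin_mapI)
    fix f g h assume "f \<in> carr (dual_alg P)" "g \<in> carr (dual_alg P)" "h \<in> carr (dual_alg P)"
    then have H: "f \<in> Hom P fld" "g \<in> Hom P fld" "h \<in> Hom P fld" by auto
    show "mul (dual_alg P) f (g + h) = mul (dual_alg P) f g + mul (dual_alg P) f h"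
      by (rule Hom_eqI[OF ml cl(1)[OF ml ml]])
        (auto simp: H m cl case_prod_unfold distrib_left sum_list_addf)
    show "mul (dual_alg P) (g + h) f = mul (dual_alg P) g f + mul (dual_alg P) h f"
      by (rule Hom_eqI[OF ml cl(1)[OF ml ml]])
        (auto simp: H m cl case_prod_unfold distrib_right sum_list_addf)
  next
    fix f g c assume "f \<in> carr (dual_alg P)" "g \<in> carr (dual_alg P)"
    then have H: "f \<in> Hom P fld" "g \<in> Hom P fld" by auto
    show "mul (dual_alg P) f g \<in> carr (dual_alg P)" by (simp add: ml H)
    show "mul (dual_alg P) f g \<in> carr (dual_alg P)" by (simp add: ml H)
    have "mul (dual_alg P) f (fscale c g) = fscale c (mul (dual_alg P) f g)"
      by (rule Hom_eqI[OF ml cl(2)[OF ml]])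
        (auto simp: H m cl case_prod_unfold fscale_apply sum_list_mult_left algebra_simps)
    then show "mul (dual_alg P) f (scale (dual_alg P) c g) = scale (dual_alg P) c (mul (dual_alg P) f g)"
      by simp
    have "mul (dual_alg P) (fscale c f) g = fscale c (mul (dual_alg P) f g)"
      by (rule Hom_eqI[OF ml cl(2)[OF ml]])
        (auto simp: H m cl case_prod_unfold fscale_apply sum_list_mult_left algebra_simps)
    then show "mul (dual_alg P) (scale (dual_alg P) c f) g = scale (dual_alg P) c (mul (dual_alg P) f g)"
      by simp
  qed
  have assoc: "mul (dual_alg P) (mul (dual_alg P) f g) h = mul (dual_alg P) f (mul (dual_alg P) g h)"
    if H: "f \<in> Hom P fld" "g \<in> Hom P fld" "h \<in> Hom P fld" for f g h
  proof (rule Hom_eqI[OF ml ml])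
    fix p assume p: "p \<in> carr P"
    have "mul (dual_alg P) (mul (dual_alg P) f g) h p =
        (\<Sum>(x, y)\<leftarrow>cop P p. \<Sum>(x1, x2)\<leftarrow>cop P x. f x1 * g x2 * h y)"
      unfolding m[OF ml[OF H(1,2)] H(3) p]
      by (rule cop_cong[OF p]) (simp add: m H sum_list_mult_right case_prod_unfold)
    also have "\<dots> = (\<Sum>(x, y)\<leftarrow>cop P p. \<Sum>(y1, y2)\<leftarrow>cop P y. f x * g y1 * h y2)"
      by (rule coassoc[OF is_vspace_fld trilinear_mult p]) (use H in \<open>auto intro: Hom_lin\<close>)
    also have "\<dots> = mul (dual_alg P) f (mul (dual_alg P) g h) p"
      unfolding m[OF H(1) ml[OF H(2,3)] p]
      by (rule cop_cong[OF p]) (simp add: m H sum_list_mult_left case_prod_unfold mult.assoc)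
    finally show "mul (dual_alg P) (mul (dual_alg P) f g) h p =
        mul (dual_alg P) f (mul (dual_alg P) g h) p" .
  qed (use H in \<open>auto intro: ml\<close>)
  have e: "zrestr P (counit P) \<in> Hom P fld" by (rule zrestr_Hom[OF vs counit_lin])
  have unit: "mul (dual_alg P) (zrestr P (counit P)) f = f" "mul (dual_alg P) f (zrestr P (counit P)) = f"
    if f: "f \<in> Hom P fld" for f
  proof -
    have "(\<Sum>(x, y)\<leftarrow>cop P p. zrestr P (counit P) x * f y) = f p"
      "(\<Sum>(x, y)\<leftarrow>cop P p. f x * zrestr P (counit P) y) = f p" if p: "p \<in> carr P" for p
      using counit_left[OF is_vspace_fld Hom_lin[OF f] p] counit_right[OF is_vspace_fld Hom_lin[OF f] p]
      by (simp_all add: mult.commute cong: cop_cong[OF p])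
    then show "mul (dual_alg P) (zrestr P (counit P)) f = f" "mul (dual_alg P) f (zrestr P (counit P)) = f"
      by (auto intro!: Hom_eqI[OF ml] simp: f e m)
  qed
  show ?thesis
    unfolding algebra_def using vsD bil assoc unit e by simp
qed

section \<open>The finite dual\<close>

lemma fdual_space_sel [simp]: "scale (fdual_space Q) = fscale"
  by (simp add: fdual_space_def)

lemma fdual_Hom: "f \<in> carr (fdual_space Q) \<Longrightarrow> f \<in> Hom Q fld"
  by (simp add: fdual_space_def)

text \<open>Used to see that a linear map into functions vanishing off a fixed finite set has finite
  dimensional image.\<close>

lemma finite_support_span:
  assumes "finite S" "\<And>s. s \<notin> S \<Longrightarrow> f s = 0"
  shows "f \<in> module.span (fscale :: 'f::field \<Rightarrow> ('i \<Rightarrow> 'f) \<Rightarrow> _) ((\<lambda>s t. if t = s then 1 else 0) ` S)"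
proof -
  interpret F: vector_space "fscale :: 'f \<Rightarrow> ('i \<Rightarrow> 'f) \<Rightarrow> _" by (rule vector_space_fscale)
  have "f = (\<Sum>s\<in>S. fscale (f s) (\<lambda>t. if t = s then 1 else 0))"
  proof
    fix t
    have "(\<Sum>s\<in>S. fscale (f s) (\<lambda>t. if t = s then 1 else 0)) t = (\<Sum>s\<in>S. if t = s then f s else 0)"
      using assms(1) by (induction S rule: finite_induct) auto
    then show "f t = (\<Sum>s\<in>S. fscale (f s) (\<lambda>t. if t = s then 1 else 0)) t"
      using assms by simp
  qed
  also have "\<dots> \<in> F.span ((\<lambda>s t. if t = s then 1 else 0) ` S)"
    by (intro F.span_sum F.span_scale F.span_base) auto
  finally show ?thesis .
qed

text \<open>Witness that the bilinear form \<open>f (x y)\<close> has finite rank. For linear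
  \<open>f\<close> this is equivalent to membership in the finite dual, and it is easier to handle
  than cofinite ideals.\<close>

definition mul_rep where
  "mul_rep Q f xs \<longleftrightarrow> (\<forall>(g, h)\<in>set xs. lin_map Q fld g \<and> lin_map Q fld h) \<and>
     (\<forall>x\<in>carr Q. \<forall>y\<in>carr Q. f (mul Q x y) = (\<Sum>(g, h)\<leftarrow>xs. g x * h y))"

text \<open>The translate \<open>f(x \<cdot>)\<close>, set to 0 off the carrier so that equality of
  translates is equality of functions.\<close>

definition shift where
  "shift Q f x = zrestr Q (\<lambda>z. f (mul Q x z))"

definition forms :: "('f::field, 'v::ab_group_add, 'm) vspace_scheme \<Rightarrow> ('f, 'v \<Rightarrow> 'f) vspace" where
  "forms V = \<lparr>scale = fscale, carr = Hom V fld\<rparr>"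

lemma forms_sel [simp]: "scale (forms V) = fscale" "carr (forms V) = Hom V fld"
  by (simp_all add: forms_def)

lemma is_vspace_forms: "is_vspace V \<Longrightarrow> is_vspace (forms V)"
  unfolding forms_def by (rule is_vspace_Hom)

locale alg_struct =
  fixes Q :: "('f::field, 'q::ab_group_add, 'm) alg_scheme"
  assumes algebra: "algebra Q"
begin

lemma avs: "is_vspace Q"
  and mul_bilinear: "bilinear Q Q Q (mul Q)"
  and one_carr: "one Q \<in> carr Q"
  and mul_assoc: "x \<in> carr Q \<Longrightarrow> y \<in> carr Q \<Longrightarrow> z \<in> carr Q \<Longrightarrow>
    mul Q (mul Q x y) z = mul Q x (mul Q y z)"
  and mul_one_left: "x \<in> carr Q \<Longrightarrow> mul Q (one Q) x = x"
  and mul_one_right: "x \<in> carr Q \<Longrightarrow> mul Q x (one Q) = x"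
  using algebra by (auto simp: algebra_def)

lemma mul_lin_right: "x \<in> carr Q \<Longrightarrow> lin_map Q Q (mul Q x)"
  and mul_lin_left: "y \<in> carr Q \<Longrightarrow> lin_map Q Q (\<lambda>x. mul Q x y)"
  using mul_bilinear by (auto simp: bilinear_def)

lemma mul_carr: "x \<in> carr Q \<Longrightarrow> y \<in> carr Q \<Longrightarrow> mul Q x y \<in> carr Q"
  using mul_lin_right lin_map_carr by blast

lemma shift_apply: "z \<in> carr Q \<Longrightarrow> shift Q f x z = f (mul Q x z)"
  by (simp add: shift_def)

lemma shift_Hom: "lin_map Q fld f \<Longrightarrow> x \<in> carr Q \<Longrightarrow> shift Q f x \<in> Hom Q fld"
  unfolding shift_def by (intro zrestr_Hom avs lin_map_comp[OF mul_lin_right])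

lemma shift_lin:
  assumes f: "lin_map Q fld f"
  shows "lin_map Q (forms Q) (shift Q f)"
proof (rule lin_mapI)
  fix x y c assume x: "x \<in> carr Q"
  show "shift Q f x \<in> carr (forms Q)" using shift_Hom[OF f x] by simp
  show "shift Q f (scale Q c x) = scale (forms Q) c (shift Q f x)"
    using x mul_carr[OF x] lin_map_scale[OF mul_lin_left x] lin_map_scale[OF f mul_carr[OF x]]
    by (auto simp: shift_def zrestr_def fun_eq_iff)
  assume y: "y \<in> carr Q"
  show "shift Q f (x + y) = shift Q f x + shift Q f y"
    using lin_map_add[OF mul_lin_left x y] lin_map_add[OF f mul_carr[OF x] mul_carr[OF y]]
    by (auto simp: shift_def zrestr_def fun_eq_iff)
qed

text \<open>
  The translates \<open>f(x \<cdot>)\<close> span a finite dimensional space: finitely many translates by the elements \<open>y\<close>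
  span it, with coordinates \<open>\<alpha>\<close>. The coordinates, viewed as functions of \<open>x\<close>, again satisfy such a
  factorisation, which is why \<open>f(x z)\<close> splits inside the finite dual.
\<close>

definition shift_basis where
  "shift_basis f L \<longleftrightarrow>
    (\<forall>(\<alpha>, y)\<in>set L. Vector_Spaces.linear fscale (*) \<alpha> \<and> y \<in> carr Q) \<and>
    (\<forall>x\<in>carr Q. shift Q f x = (\<Sum>(\<alpha>, y)\<leftarrow>L. fscale (\<alpha> (shift Q f x)) (shift Q f y)))"

lemma shift_basis_of_span:
  assumes "lin_map Q fld f" "finite E" "shift Q f ` carr Q \<subseteq> module.span fscale E"
  shows "\<exists>L. shift_basis f L"
  using fin_dim_image[OF avs is_vspace_forms[OF avs] shift_lin[OF assms(1)] assms(2)] assms(3)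
  by (simp add: shift_basis_def)

text \<open>If \<open>f (x z)\<close> is the sum of the \<open>g x * h z\<close>, every translate
  lies in the span of the finitely many \<open>h\<close>.\<close>

lemma shift_basis_of_mul_rep:
  assumes f: "lin_map Q fld f" and xs: "mul_rep Q f xs"
  shows "\<exists>L. shift_basis f L"
proof (rule shift_basis_of_span[OF f])
  let ?E = "set (map (\<lambda>(g, h). zrestr Q h) xs)"
  interpret F: vector_space "fscale :: 'f \<Rightarrow> ('q \<Rightarrow> 'f) \<Rightarrow> _" by (rule vector_space_fscale)
  show "finite ?E" by simp
  show "shift Q f ` carr Q \<subseteq> F.span ?E"
  proof clarify
    fix x assume x: "x \<in> carr Q"
    have "shift Q f x = (\<Sum>(g, h)\<leftarrow>xs. fscale (g x) (zrestr Q h))"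
    proof
      fix z show "shift Q f x z = (\<Sum>(g, h)\<leftarrow>xs. fscale (g x) (zrestr Q h)) z"
        using xs x by (cases "z \<in> carr Q")
          (auto simp: shift_def zrestr_def mul_rep_def sum_list_fun case_prod_unfold)
    qed
    also have "\<dots> \<in> carr \<lparr>scale = fscale, carr = F.span ?E\<rparr>"
    proof (rule carr_sum_list[OF is_vspace_span])
      fix z assume "z \<in> set xs"
      then have "zrestr Q (snd z) \<in> F.span ?E" by (intro F.span_base) (auto simp: case_prod_unfold)
      then show "(case z of (g, h) \<Rightarrow> fscale (g x) (zrestr Q h)) \<in> carr \<lparr>scale = fscale, carr = F.span ?E\<rparr>"
        by (simp add: case_prod_unfold F.span_scale)
    qed
    finally show "shift Q f x \<in> F.span ?E" by simp
  qed
qed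

text \<open>An element of the ideal gives the zero translate, so all translates are spanned by those
  at the finite set \<open>E\<close> that spans the algebra modulo the ideal.\<close>

lemma shift_basis_of_fdual:
  assumes f: "f \<in> carr (fdual_space Q)"
  shows "\<exists>L. shift_basis f L"
proof -
  have fl: "lin_map Q fld f" using fdual_Hom[OF f] by (rule Hom_lin)
  obtain I E where I: "ideal Q I" "\<And>x. x \<in> I \<Longrightarrow> f x = 0"
    and E: "finite E" "E \<subseteq> carr Q" "\<And>x. x \<in> carr Q \<Longrightarrow> \<exists>y\<in>module.span (scale Q) E. \<exists>z\<in>I. x = y + z"
    using f by (auto simp: fdual_space_def cofinite_def)
  interpret F: vector_space "fscale :: 'f \<Rightarrow> ('q \<Rightarrow> 'f) \<Rightarrow> _" by (rule vector_space_fscale)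
  interpret V: vector_space "scale Q" using avs by (simp add: is_vspace_def)
  have sp: "y \<in> carr Q \<and> shift Q f y \<in> F.span (shift Q f ` E)" if "y \<in> V.span E" for y
    using that
  proof (induction rule: V.span_induct_alt)
    case base
    have "shift Q f 0 \<in> F.span (shift Q f ` E)"
      unfolding lin_map_zero[OF shift_lin[OF fl] avs] by (rule F.span_zero)
    then show ?case using carr_zero[OF avs] by blast
  next
    case (step c x y)
    then have x: "x \<in> carr Q" "scale Q c x \<in> carr Q" using E(2) carr_scale[OF avs] by auto
    have y: "y \<in> carr Q" "shift Q f y \<in> F.span (shift Q f ` E)" using step by blast+
    have "shift Q f (scale Q c x + y) = fscale c (shift Q f x) + shift Q f y"
      using lin_map_add[OF shift_lin[OF fl] x(2) y(1)] lin_map_scale[OF shift_lin[OF fl] x(1), of c]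
      by simp
    moreover have "fscale c (shift Q f x) + shift Q f y \<in> F.span (shift Q f ` E)"
      by (intro F.span_add[OF F.span_scale[OF F.span_base] y(2)] imageI step(1))
    ultimately have "shift Q f (scale Q c x + y) \<in> F.span (shift Q f ` E)" by (simp only:)
    then show ?case using carr_add[OF avs x(2) y(1)] by blast
  qed
  have "shift Q f ` carr Q \<subseteq> F.span (shift Q f ` E)"
  proof clarify
    fix x assume x: "x \<in> carr Q"
    obtain y z where yz: "y \<in> V.span E" "z \<in> I" "x = y + z" using E(3)[OF x] by blast
    have z: "z \<in> carr Q" "\<And>w. w \<in> carr Q \<Longrightarrow> mul Q z w \<in> I"
      using I(1) yz(2) by (auto simp: ideal_def)
    have "shift Q f z = 0" using z I(2) by (auto simp: shift_def zrestr_def fun_eq_iff)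
    then have "shift Q f x = shift Q f y"
      using lin_map_add[OF shift_lin[OF fl] _ z(1), of y] sp[OF yz(1)] yz(3) by simp
    then show "shift Q f x \<in> F.span (shift Q f ` E)" using sp[OF yz(1)] by simp
  qed
  then show ?thesis using shift_basis_of_span[OF fl] E(1) by blast
qed

lemma shift_basis_mul:
  assumes f: "lin_map Q fld f" and L: "shift_basis f L" and x: "x \<in> carr Q" and z: "z \<in> carr Q"
  shows "f (mul Q x z) = (\<Sum>(\<alpha>, y)\<leftarrow>L. \<alpha> (shift Q f x) * f (mul Q y z))"
proof -
  have "f (mul Q x z) = shift Q f x z" by (simp add: shift_apply z)
  also have "\<dots> = (\<Sum>(\<alpha>, y)\<leftarrow>L. fscale (\<alpha> (shift Q f x)) (shift Q f y)) z"
    using L x by (simp add: shift_basis_def)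
  finally show ?thesis by (simp add: sum_list_fun case_prod_unfold shift_apply z)
qed

text \<open>By associativity \<open>f (u v z)\<close> can be expanded in \<open>u\<close> alone: the
  coordinates depend on \<open>u\<close>, while \<open>v\<close> only moves the basis elements. Thus
  the coordinate functions have finite rank as well.\<close>

lemma shift_mul:
  assumes f: "lin_map Q fld f" and L: "shift_basis f L" and u: "u \<in> carr Q" and v: "v \<in> carr Q"
  shows "shift Q f (mul Q u v) = (\<Sum>(\<beta>, w)\<leftarrow>L. fscale (\<beta> (shift Q f u)) (shift Q f (mul Q w v)))"
proof
  fix z
  have Lc: "\<And>\<beta> w. (\<beta>, w) \<in> set L \<Longrightarrow> w \<in> carr Q" using L by (auto simp: shift_basis_def)
  show "shift Q f (mul Q u v) z = (\<Sum>(\<beta>, w)\<leftarrow>L. fscale (\<beta> (shift Q f u)) (shift Q f (mul Q w v))) z"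
  proof (cases "z \<in> carr Q")
    case True
    have "shift Q f (mul Q u v) z = f (mul Q u (mul Q v z))"
      by (simp add: shift_apply True mul_assoc u v)
    also have "\<dots> = (\<Sum>(\<beta>, w)\<leftarrow>L. \<beta> (shift Q f u) * f (mul Q w (mul Q v z)))"
      by (rule shift_basis_mul[OF f L u mul_carr[OF v True]])
    also have "\<dots> = (\<Sum>(\<beta>, w)\<leftarrow>L. fscale (\<beta> (shift Q f u)) (shift Q f (mul Q w v)) z)"
      by (rule sum_list_cong) (auto simp: shift_apply True mul_assoc v dest: Lc)
    finally show ?thesis by (simp add: sum_list_fun case_prod_unfold)
  next
    case False
    then show ?thesis by (simp add: shift_def zrestr_def sum_list_fun case_prod_unfold)
  qed
qed

lemma coord_lin:
  assumes "lin_map Q fld f" "Vector_Spaces.linear fscale (*) \<alpha>"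
  shows "lin_map Q fld (\<lambda>x. \<alpha> (shift Q f x))"
  using linear_lin_map[of fun_space \<alpha>] assms(2)
  by (intro lin_map_comp[OF shift_lin[OF assms(1)]]) (auto simp: lin_map_def)

lemma coord_mul_rep:
  assumes f: "lin_map Q fld f" and L: "shift_basis f L" and \<alpha>: "Vector_Spaces.linear fscale (*) \<alpha>"
  shows "mul_rep Q (\<lambda>x. \<alpha> (shift Q f x))
    (map (\<lambda>(\<beta>, w). (\<lambda>u. \<beta> (shift Q f u), \<lambda>v. \<alpha> (shift Q f (mul Q w v)))) L)"
proof -
  have Lc: "\<And>\<beta> w. (\<beta>, w) \<in> set L \<Longrightarrow> w \<in> carr Q \<and> Vector_Spaces.linear fscale (*) \<beta>"
    using L by (auto simp: shift_basis_def)
  have al: "lin_map fun_space fld \<alpha>" by (rule linear_lin_map) (simp add: \<alpha>)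
  have "\<alpha> (shift Q f (mul Q u v)) = (\<Sum>(\<beta>, w)\<leftarrow>L. \<beta> (shift Q f u) * \<alpha> (shift Q f (mul Q w v)))"
    if u: "u \<in> carr Q" and v: "v \<in> carr Q" for u v
    unfolding shift_mul[OF f L u v]
    by (subst lin_map_sum_list[OF al is_vspace_fun_space]) (auto intro!: sum_list_cong simp: lin_map_scale[OF al, simplified])
  then show ?thesis
    unfolding mul_rep_def using Lc f \<alpha>
    by (auto simp: comp_def case_prod_unfold intro!: coord_lin lin_map_comp[OF mul_lin_right coord_lin])
qed

text \<open>Finite rank yields a cofinite two-sided ideal in the kernel of \<open>f\<close>:
  vanishing of \<open>f (y x z)\<close> for all \<open>y\<close> and \<open>z\<close> follows from
  finitely many linear conditions on \<open>x\<close>.\<close>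

lemma fdualI:
  assumes f: "f \<in> Hom Q fld" and xs: "mul_rep Q f xs"
  shows "f \<in> carr (fdual_space Q)"
proof -
  have fl: "lin_map Q fld f" using f by (rule Hom_lin)
  obtain L where L: "shift_basis f L" using shift_basis_of_mul_rep[OF fl xs] by blast
  have Lc: "\<And>\<alpha> y. (\<alpha>, y) \<in> set L \<Longrightarrow> y \<in> carr Q \<and> Vector_Spaces.linear fscale (*) \<alpha>"
    using L by (auto simp: shift_basis_def)
  \<comment> \<open>The largest two-sided ideal contained in the kernel of \<open>f\<close>.\<close>
  define I where "I = {x \<in> carr Q. \<forall>y\<in>carr Q. \<forall>z\<in>carr Q. f (mul Q (mul Q y x) z) = 0}"
  \<comment> \<open>\<open>N x\<close> records the coordinates of the translates at
    \<open>y x\<close> for the finitely many basis elements \<open>y\<close>. It is 0 off a finite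
    index set, so the image of \<open>N\<close> is finite dimensional.\<close>
  define N where "N x = (\<lambda>(\<beta>, y). if \<beta> \<in> fst ` set L \<and> y \<in> snd ` set L
    then \<beta> (shift Q f (mul Q y x)) else 0)" for x
  let ?U = "fun_space :: ('f, (('q \<Rightarrow> 'f) \<Rightarrow> 'f) \<times> 'q \<Rightarrow> 'f) vspace"
  have cl: "lin_map Q fld (\<lambda>x. \<beta> (shift Q f (mul Q y x)))"
    if "\<beta> \<in> fst ` set L" "y \<in> snd ` set L" for \<beta> y
    using that Lc by (intro lin_map_comp[OF mul_lin_right coord_lin[OF fl]]) force+
  have Nl: "lin_map Q ?U N"
    by (rule lin_mapI)
      (auto simp: N_def fun_eq_iff lin_map_add[OF cl] lin_map_scale[OF cl])
  let ?S = "fst ` set L \<times> snd ` set L"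
  have "N ` carr Q \<subseteq> module.span (scale ?U) ((\<lambda>s t. if t = s then 1 else 0) ` ?S)"
  proof clarify
    fix x
    have "N x \<in> module.span fscale ((\<lambda>s t. if t = s then 1 else 0) ` ?S)"
      by (rule finite_support_span) (auto simp: N_def split: if_splits)
    then show "N x \<in> module.span (scale ?U) ((\<lambda>s t. if t = s then 1 else 0) ` ?S)" by simp
  qed
  from fin_dim_image[OF avs is_vspace_fun_space Nl _ this]
  obtain M where M: "\<And>\<alpha> y. (\<alpha>, y) \<in> set M \<Longrightarrow> y \<in> carr Q"
    "\<And>x. x \<in> carr Q \<Longrightarrow> N x = (\<Sum>(\<alpha>, y)\<leftarrow>M. fscale (\<alpha> (N x)) (N y))"
    by fastforce
  \<comment> \<open>Expand \<open>f (y x z)\<close> in \<open>y\<close>, which leaves terms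
    \<open>f (w x z)\<close> with basis elements \<open>w\<close>; expanding these in
    \<open>w x\<close> produces entries of \<open>N x\<close> as coefficients.\<close>
  have kerI: "x \<in> I" if x: "x \<in> carr Q" and N: "N x = 0" for x
  proof -
    have "f (mul Q (mul Q y x) z) = 0" if y: "y \<in> carr Q" and z: "z \<in> carr Q" for y z
    proof -
      have "f (mul Q (mul Q y x) z) = f (mul Q y (mul Q x z))" by (simp add: mul_assoc x y z)
      also have "\<dots> = (\<Sum>(\<alpha>, w)\<leftarrow>L. \<alpha> (shift Q f y) * f (mul Q w (mul Q x z)))"
        by (rule shift_basis_mul[OF fl L y mul_carr[OF x z]])
      also have "\<dots> = (\<Sum>w\<leftarrow>L. 0)"
      proof (rule sum_list_cong, clarify)
        fix \<alpha> w assume w: "(\<alpha>, w) \<in> set L"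
        then have wc: "w \<in> carr Q" using Lc by blast
        have "f (mul Q w (mul Q x z)) = f (mul Q (mul Q w x) z)" by (simp add: mul_assoc x wc z)
        also have "\<dots> = (\<Sum>(\<beta>, v)\<leftarrow>L. \<beta> (shift Q f (mul Q w x)) * f (mul Q v z))"
          by (rule shift_basis_mul[OF fl L mul_carr[OF wc x] z])
        also have "\<dots> = (\<Sum>v\<leftarrow>L. 0)"
        proof (rule sum_list_cong, clarify)
          fix \<beta> v assume "(\<beta>, v) \<in> set L"
          then have "N x (\<beta>, w) = \<beta> (shift Q f (mul Q w x))" using w by (force simp: N_def)
          then show "\<beta> (shift Q f (mul Q w x)) * f (mul Q v z) = 0" using N by simp
        qed
        finally show "\<alpha> (shift Q f y) * f (mul Q w (mul Q x z)) = 0" by simp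
      qed
      finally show ?thesis by simp
    qed
    then show ?thesis using x by (simp add: I_def)
  qed
  have "ideal Q I"
    unfolding ideal_def
  proof (intro conjI ballI)
    interpret V: vector_space "scale Q" using avs by (simp add: is_vspace_def)
    note m = lin_map_comp[OF lin_map_comp[OF mul_lin_right mul_lin_left] fl]
    show "V.subspace I"
      unfolding V.subspace_def I_def
      by (auto simp: vs_carr avs lin_map_zero[OF m avs] lin_map_add[OF m] lin_map_scale[OF m])
    fix x y assume x: "x \<in> carr Q" and y: "y \<in> I"
    show "mul Q x y \<in> I" "mul Q y x \<in> I"
    proof -
      have yc: "y \<in> carr Q" and y0: "\<And>u v. u \<in> carr Q \<Longrightarrow> v \<in> carr Q \<Longrightarrow> f (mul Q (mul Q u y) v) = 0"
        using y by (auto simp: I_def)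
      have "f (mul Q (mul Q u (mul Q x y)) v) = 0" "f (mul Q (mul Q u (mul Q y x)) v) = 0"
        if "u \<in> carr Q" "v \<in> carr Q" for u v
        using y0[of "mul Q u x" v] y0[of u "mul Q x v"] that x yc by (simp_all add: mul_assoc mul_carr)
      then show "mul Q x y \<in> I" "mul Q y x \<in> I" using x yc by (simp_all add: I_def mul_carr)
    qed
  qed (auto simp: I_def)
  moreover have "cofinite Q I"
    unfolding cofinite_def
  \<comment> \<open>The \<open>y\<close> in \<open>M\<close> are preimages of vectors spanning the
    image of \<open>N\<close>. Subtracting from \<open>x\<close> the combination with the same value
    under \<open>N\<close> leaves an element of the kernel, hence of \<open>I\<close>.\<close>
  proof (intro exI[of _ "snd ` set M"] conjI ballI)
    fix x assume x: "x \<in> carr Q"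
    interpret V: vector_space "scale Q" using avs by (simp add: is_vspace_def)
    let ?y = "\<Sum>(\<alpha>, y)\<leftarrow>M. scale Q (\<alpha> (N x)) y"
    have "?y \<in> carr \<lparr>scale = scale Q, carr = V.span (snd ` set M)\<rparr>"
    proof (rule carr_sum_list)
      show "is_vspace \<lparr>scale = scale Q, carr = V.span (snd ` set M)\<rparr>"
        by (simp add: is_vspace_def V.vector_space_axioms)
      fix z assume "z \<in> set M"
      then have "snd z \<in> V.span (snd ` set M)" by (intro V.span_base) auto
      then show "(case z of (\<alpha>, y) \<Rightarrow> scale Q (\<alpha> (N x)) y) \<in> carr \<lparr>scale = scale Q, carr = V.span (snd ` set M)\<rparr>"
        by (simp add: case_prod_unfold V.span_scale)
    qed
    then have ys: "?y \<in> V.span (snd ` set M)" by simp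
    have yc: "?y \<in> carr Q" by (intro carr_sum_list avs) (auto intro: carr_scale avs dest: M(1))
    have "N ?y = (\<Sum>z\<leftarrow>M. N (case z of (\<alpha>, y) \<Rightarrow> scale Q (\<alpha> (N x)) y))"
      by (rule lin_map_sum_list[OF Nl avs]) (auto intro: carr_scale avs dest: M(1))
    also have "\<dots> = (\<Sum>(\<alpha>, y)\<leftarrow>M. fscale (\<alpha> (N x)) (N y))"
      by (rule sum_list_cong) (auto simp: lin_map_scale[OF Nl] dest: M(1))
    finally have "N (x - ?y) = 0"
      using lin_map_diff[OF Nl avs is_vspace_fun_space x yc] M(2)[OF x] by simp
    then have "x - ?y \<in> I" by (intro kerI carr_diff avs x yc)
    then show "\<exists>y\<in>V.span (snd ` set M). \<exists>z\<in>I. x = y + z"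
      using ys by (intro bexI[of _ ?y] bexI[of _ "x - ?y"]) auto
  qed (auto dest: M(1))
  moreover have "f x = 0" if "x \<in> I" for x
    using that one_carr by (force simp: I_def mul_one_left mul_one_right)
  ultimately show ?thesis using f by (auto simp: fdual_space_def)
qed

lemma mul_rep_zrestr: "mul_rep Q (zrestr Q f) xs \<longleftrightarrow> mul_rep Q f xs"
  by (simp add: mul_rep_def mul_carr)

text \<open>In the expansion of \<open>f (x z)\<close> along a basis of translates both kinds of
  factors have finite rank again: the coordinates by \<open>coord_mul_rep\<close>, the translates by
  the same expansion applied to \<open>y u\<close>. This is what makes the comultiplication land in
  the finite dual.\<close>

lemma fdual_rep:
  assumes f: "f \<in> carr (fdual_space Q)"
  shows "\<exists>xs. set xs \<subseteq> carr (fdual_space Q) \<times> carr (fdual_space Q) \<and>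
    (\<forall>x\<in>carr Q. \<forall>y\<in>carr Q. f (mul Q x y) = (\<Sum>(g, h)\<leftarrow>xs. g x * h y))"
proof -
  have fl: "lin_map Q fld f" using fdual_Hom[OF f] by (rule Hom_lin)
  obtain L where L: "shift_basis f L" using shift_basis_of_fdual[OF f] by blast
  have Lc: "\<And>\<alpha> y. (\<alpha>, y) \<in> set L \<Longrightarrow> y \<in> carr Q \<and> Vector_Spaces.linear fscale (*) \<alpha>"
    using L by (auto simp: shift_basis_def)
  let ?xs = "map (\<lambda>(\<alpha>, y). (zrestr Q (\<lambda>x. \<alpha> (shift Q f x)), shift Q f y)) L"
  have 1: "zrestr Q (\<lambda>x. \<alpha> (shift Q f x)) \<in> carr (fdual_space Q)"
    if \<alpha>: "Vector_Spaces.linear fscale (*) \<alpha>" for \<alpha>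
    by (rule fdualI[OF zrestr_Hom[OF avs coord_lin[OF fl \<alpha>]] mul_rep_zrestr[THEN iffD2, OF coord_mul_rep[OF fl L \<alpha>]]])
  have 2: "shift Q f y \<in> carr (fdual_space Q)" if y: "y \<in> carr Q" for y
  proof (rule fdualI[OF shift_Hom[OF fl y]])
    show "mul_rep Q (shift Q f y) (map (\<lambda>(\<beta>, w). (\<lambda>u. \<beta> (shift Q f (mul Q y u)), shift Q f w)) L)"
      unfolding mul_rep_def
    proof (intro conjI ballI)
      fix u v assume u: "u \<in> carr Q" and v: "v \<in> carr Q"
      show "shift Q f y (mul Q u v) = (\<Sum>(g, h)\<leftarrow>map (\<lambda>(\<beta>, w). (\<lambda>u. \<beta> (shift Q f (mul Q y u)), shift Q f w)) L. g u * h v)"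
        using shift_basis_mul[OF fl L mul_carr[OF y u] v]
        by (simp add: shift_apply mul_carr u v mul_assoc y comp_def case_prod_unfold)
    qed (auto intro: lin_map_comp[OF mul_lin_right[OF y] coord_lin[OF fl]] Hom_lin[OF shift_Hom[OF fl]] dest!: Lc)
  qed
  have "f (mul Q x z) = (\<Sum>(g, h)\<leftarrow>?xs. g x * h z)" if "x \<in> carr Q" "z \<in> carr Q" for x z
    using shift_basis_mul[OF fl L that] that by (simp add: comp_def case_prod_unfold shift_apply)
  then show ?thesis using 1 2 Lc by (intro exI[of _ ?xs]) auto
qed

text \<open>Through finite rank, closure under addition is concatenation of lists, and no
  intersection of ideals has to be shown cofinite.\<close>

lemma is_vspace_fdual: "is_vspace (fdual_space Q)"
proof -
  note H = is_vspace_Hom[OF avs]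
  have "f + g \<in> carr (fdual_space Q)" if f: "f \<in> carr (fdual_space Q)" and g: "g \<in> carr (fdual_space Q)" for f g
  proof -
    obtain xs ys where xs: "set xs \<subseteq> carr (fdual_space Q) \<times> carr (fdual_space Q)"
      "\<forall>x\<in>carr Q. \<forall>y\<in>carr Q. f (mul Q x y) = (\<Sum>(g, h)\<leftarrow>xs. g x * h y)"
      and ys: "set ys \<subseteq> carr (fdual_space Q) \<times> carr (fdual_space Q)"
      "\<forall>x\<in>carr Q. \<forall>y\<in>carr Q. g (mul Q x y) = (\<Sum>(g, h)\<leftarrow>ys. g x * h y)"
      using fdual_rep f g by meson
    have "mul_rep Q (f + g) (xs @ ys)"
      using xs ys by (auto simp: mul_rep_def dest!: subsetD intro: Hom_lin fdual_Hom)
    then show ?thesis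
      using carr_add[OF H, of f g] fdual_Hom[OF f] fdual_Hom[OF g] by (intro fdualI) auto
  qed
  moreover have "fscale c f \<in> carr (fdual_space Q)" if f: "f \<in> carr (fdual_space Q)" for f c
  proof -
    obtain xs where xs: "set xs \<subseteq> carr (fdual_space Q) \<times> carr (fdual_space Q)"
      "\<forall>x\<in>carr Q. \<forall>y\<in>carr Q. f (mul Q x y) = (\<Sum>(g, h)\<leftarrow>xs. g x * h y)"
      using fdual_rep f by meson
    have "lin_map Q fld g" "lin_map Q fld h" if "(g, h) \<in> set xs" for g h
      using xs(1) that by (auto intro: Hom_lin fdual_Hom)
    then have "mul_rep Q (fscale c f) (map (\<lambda>(g, h). (\<lambda>x. scale fld c (g x), h)) xs)"
      using xs(2) unfolding mul_rep_def
      by (auto simp del: fld_simps intro: lin_map_scaled)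
        (simp add: comp_def case_prod_unfold sum_list_mult_left mult.assoc)
    then show ?thesis
      using carr_scale[OF H, of f c] fdual_Hom[OF f] by (intro fdualI) auto
  qed
  moreover have "0 \<in> carr (fdual_space Q)"
    using carr_zero[OF H] by (intro fdualI[of _ "[]"]) (auto simp: mul_rep_def)
  ultimately show ?thesis
    by (simp add: is_vspace_def vector_space_fscale module.subspace_def[OF module_fscale])
qed

end

lemma Hom_coalg_of [simp]: "Hom (coalg_of B) W = Hom B W"
  by (simp add: Hom_def)

text \<open>Replaces the two nested lifts of \<open>tensor_mul\<close> by sums over chosen
  presentations, the form needed for Sweedler computations.\<close>

lemma (in alg_struct) tensor_mul_sum:
  assumes s: "s \<in> carr (tensor Q Q)" and t: "t \<in> carr (tensor Q Q)"
    and U: "is_vspace U" and \<beta>: "bilinear Q Q U \<beta>"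
  shows "tensor_mul Q s t \<in> carr (tensor Q Q)" (is ?C)
    and "tlift Q Q U \<beta> (tensor_mul Q s t) =
      (\<Sum>(x1, x2)\<leftarrow>trep Q Q s. \<Sum>(y1, y2)\<leftarrow>trep Q Q t. \<beta> (mul Q x1 y1) (mul Q x2 y2))" (is ?E)
proof -
  let ?T = "tensor Q Q"
  have b: "bilinear Q Q ?T (\<lambda>y1 y2. tens Q Q (mul Q x1 y1) (mul Q x2 y2))"
    if "x1 \<in> carr Q" "x2 \<in> carr Q" for x1 x2
    using that by (intro bilinear_maps[OF bilinear_tens] mul_lin_right)
  have b': "bilinear Q Q ?T (\<lambda>x1 x2. tens Q Q (mul Q x1 y1) (mul Q x2 y2))"
    if "y1 \<in> carr Q" "y2 \<in> carr Q" for y1 y2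
    using that by (intro bilinear_maps[OF bilinear_tens] mul_lin_left)
  have rs: "fst z \<in> carr Q" "snd z \<in> carr Q" if "z \<in> set (trep Q Q s)" for z
    using trep(1)[OF avs s] that by auto
  have rt: "fst z \<in> carr Q" "snd z \<in> carr Q" if "z \<in> set (trep Q Q t)" for z
    using trep(1)[OF avs t] that by auto
  have "bilinear Q Q ?T (\<lambda>x1 x2. \<Sum>z\<leftarrow>trep Q Q t. tens Q Q (mul Q x1 (fst z)) (mul Q x2 (snd z)))"
    by (intro bilinear_sum is_vspace_tensor b' rt)
  then have bb: "bilinear Q Q ?T (\<lambda>x1 x2. tlift Q Q ?T (\<lambda>y1 y2. tens Q Q (mul Q x1 y1) (mul Q x2 y2)) t)"
    by (rule bilinear_congr[THEN iffD1, rotated 3])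
      (auto simp: avs tlift_trep b t case_prod_unfold)
  have eq: "tensor_mul Q s t =
    (\<Sum>z\<leftarrow>trep Q Q s. \<Sum>w\<leftarrow>trep Q Q t. tens Q Q (mul Q (fst z) (fst w)) (mul Q (snd z) (snd w)))"
    unfolding tensor_mul_def tlift_trep[OF avs is_vspace_tensor bb s]
    by (rule sum_list_cong) (auto simp: tlift_trep avs b t rs case_prod_unfold)
  show ?C unfolding eq by (intro carr_sum_list is_vspace_tensor tens_carr mul_carr rs rt)
  have c: "tens Q Q (mul Q (fst z) (fst w)) (mul Q (snd z) (snd w)) \<in> carr ?T"
    if "z \<in> set (trep Q Q s)" "w \<in> set (trep Q Q t)" for z w
    using rs[OF that(1)] rt[OF that(2)] by (intro tens_carr mul_carr)
  have "tlift Q Q U \<beta> (tensor_mul Q s t) = (\<Sum>z\<leftarrow>trep Q Q s. \<Sum>w\<leftarrow>trep Q Q t.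
      tlift Q Q U \<beta> (tens Q Q (mul Q (fst z) (fst w)) (mul Q (snd z) (snd w))))"
    unfolding eq by (rule lin_map_sum_list2[OF tlift_lin[OF U \<beta>] is_vspace_tensor c])
  also have "\<dots> = (\<Sum>z\<leftarrow>trep Q Q s. \<Sum>w\<leftarrow>trep Q Q t. \<beta> (mul Q (fst z) (fst w)) (mul Q (snd z) (snd w)))"
    using rs rt by (intro sum_list_cong tlift_tens U \<beta> mul_carr)
  finally show ?E by (simp add: case_prod_unfold)
qed

text \<open>The comultiplication of the finite dual depends on the product only, so it is available
  for an arbitrary algebra \<open>Q\<close>.\<close>

definition dcomul where
  "dcomul Q f = (THE t. t \<in> carr (tensor (fdual_space Q) (fdual_space Q)) \<and>
        (\<forall>x\<in>carr Q. \<forall>y\<in>carr Q.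
           tlift (fdual_space Q) (fdual_space Q) fld (\<lambda>f1 f2. f1 x * f2 y) t = f (mul Q x y)))"

context alg_struct
begin

lemma eval_lin: "lin_map (fdual_space Q) fld (\<lambda>f. f x)"
  using fdual_Hom by (auto simp: lin_map_def)

lemma eval_bilinear: "bilinear (fdual_space Q) (fdual_space Q) fld (\<lambda>f1 f2. f1 x * f2 y)"
  by (intro bilinear_mult eval_lin)

lemma eval_separates: "f \<in> carr (fdual_space Q) \<Longrightarrow> (\<And>x. x \<in> carr Q \<Longrightarrow> f x = 0) \<Longrightarrow> f = 0"
  using fdual_Hom[of f Q] by (auto simp: Hom_def fun_eq_iff)

text \<open>Evaluations at points of \<open>Q\<close> separate the finite dual, so pairs of
  evaluations separate its tensor square. This makes the description in \<open>dcomul\<close>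
  unique.\<close>

lemma tensor_fdual_eqI:
  assumes "s \<in> carr (tensor (fdual_space Q) (fdual_space Q))"
    "t \<in> carr (tensor (fdual_space Q) (fdual_space Q))"
    "\<And>x y. x \<in> carr Q \<Longrightarrow> y \<in> carr Q \<Longrightarrow>
      tlift (fdual_space Q) (fdual_space Q) fld (\<lambda>f1 f2. f1 x * f2 y) s =
      tlift (fdual_space Q) (fdual_space Q) fld (\<lambda>f1 f2. f1 x * f2 y) t"
  shows "s = t"
proof (rule tensor_eqI2[where \<Phi> = "(\<lambda>x f. f x) ` carr Q" and \<Psi> = "(\<lambda>x f. f x) ` carr Q",
        OF is_vspace_fdual is_vspace_fdual assms(1,2)])
  show "f = 0" if "f \<in> carr (fdual_space Q)" "\<And>g. g \<in> (\<lambda>x f. f x) ` carr Q \<Longrightarrow> g f = 0" for f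
    using that(2)[OF imageI] by (rule eval_separates[OF that(1)])
  then show "f = 0" if "f \<in> carr (fdual_space Q)" "\<And>g. g \<in> (\<lambda>x f. f x) ` carr Q \<Longrightarrow> g f = 0" for f
    using that .
qed (use eval_lin assms(3) in auto)

lemma dcomul_ex:
  assumes f: "f \<in> carr (fdual_space Q)"
  shows "\<exists>t. t \<in> carr (tensor (fdual_space Q) (fdual_space Q)) \<and>
        (\<forall>x\<in>carr Q. \<forall>y\<in>carr Q.
           tlift (fdual_space Q) (fdual_space Q) fld (\<lambda>f1 f2. f1 x * f2 y) t = f (mul Q x y))"
proof -
  obtain xs where xs: "set xs \<subseteq> carr (fdual_space Q) \<times> carr (fdual_space Q)"
    "\<And>x y. x \<in> carr Q \<Longrightarrow> y \<in> carr Q \<Longrightarrow> f (mul Q x y) = (\<Sum>(g, h)\<leftarrow>xs. g x * h y)"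
    using fdual_rep[OF f] by blast
  then show ?thesis
    by (intro exI[of _ "tsum (fdual_space Q) (fdual_space Q) xs"])
      (simp add: tsum_carr tlift_tsum eval_bilinear)
qed

lemma dcomul_eqI:
  assumes "t \<in> carr (tensor (fdual_space Q) (fdual_space Q))"
    "\<And>x y. x \<in> carr Q \<Longrightarrow> y \<in> carr Q \<Longrightarrow>
      tlift (fdual_space Q) (fdual_space Q) fld (\<lambda>f1 f2. f1 x * f2 y) t = f (mul Q x y)"
  shows "dcomul Q f = t"
  unfolding dcomul_def using assms by (intro the_equality) (auto intro: tensor_fdual_eqI)

lemma dcomul:
  assumes "f \<in> carr (fdual_space Q)"
  shows dcomul_carr: "dcomul Q f \<in> carr (tensor (fdual_space Q) (fdual_space Q))"
    and dcomul_eval: "x \<in> carr Q \<Longrightarrow> y \<in> carr Q \<Longrightarrow>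
      tlift (fdual_space Q) (fdual_space Q) fld (\<lambda>f1 f2. f1 x * f2 y) (dcomul Q f) = f (mul Q x y)"
proof -
  obtain t where t: "t \<in> carr (tensor (fdual_space Q) (fdual_space Q))"
    "\<And>x y. x \<in> carr Q \<Longrightarrow> y \<in> carr Q \<Longrightarrow>
      tlift (fdual_space Q) (fdual_space Q) fld (\<lambda>f1 f2. f1 x * f2 y) t = f (mul Q x y)"
    using dcomul_ex[OF assms] by blast
  have "dcomul Q f = t" by (rule dcomul_eqI[OF t])
  then show "dcomul Q f \<in> carr (tensor (fdual_space Q) (fdual_space Q))"
    "x \<in> carr Q \<Longrightarrow> y \<in> carr Q \<Longrightarrow>
      tlift (fdual_space Q) (fdual_space Q) fld (\<lambda>f1 f2. f1 x * f2 y) (dcomul Q f) = f (mul Q x y)"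
    using t by auto
qed

lemma dcomul_lin: "lin_map (fdual_space Q) (tensor (fdual_space Q) (fdual_space Q)) (dcomul Q)"
proof (rule lin_mapI)
  let ?D = "fdual_space Q"
  note l = tlift_lin[OF is_vspace_fld eval_bilinear]
  fix f g c assume f: "f \<in> carr ?D"
  show "dcomul Q f \<in> carr (tensor ?D ?D)" by (rule dcomul_carr[OF f])
  show "dcomul Q (scale ?D c f) = scale (tensor ?D ?D) c (dcomul Q f)"
    using lin_map_scale[OF l dcomul_carr[OF f]] carr_scale[OF is_vspace_tensor dcomul_carr[OF f]]
    by (intro dcomul_eqI) (simp_all add: dcomul_eval f)
  assume g: "g \<in> carr ?D"
  show "dcomul Q (f + g) = dcomul Q f + dcomul Q g"
    using lin_map_add[OF l dcomul_carr[OF f] dcomul_carr[OF g]]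
      carr_add[OF is_vspace_tensor dcomul_carr[OF f] dcomul_carr[OF g]]
    by (intro dcomul_eqI) (simp_all add: dcomul_eval f g)
qed

end

lemma fdual_sel [simp]:
  "scale (fdual B) = fscale" "carr (fdual B) = carr (fdual_space B)"
  "one (fdual B) = zrestr B (bcounit B)" "bcomul (fdual B) = dcomul B"
  "bcounit (fdual B) = (\<lambda>f. f (one B))"
  by (simp_all add: fdual_def dcomul_def fun_eq_iff)

lemmas fdual_cong [simp] = space_cong[of "fdual B" "fdual_space B" for B, simplified]

lemma fdual_mul: "mul (fdual B) = mul (dual_alg (coalg_of B))"
  by (simp add: fdual_def dual_alg_def fun_eq_iff zrestr_def)

section \<open>The finite dual of a bialgebra is a bialgebra\<close>

locale bialg_struct =
  fixes B :: "('f::field, 'b::ab_group_add) bialg"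
  assumes bialgebra: "bialgebra B"

sublocale bialg_struct \<subseteq> alg_struct B
  using bialgebra by unfold_locales (auto simp: bialgebra_def)

sublocale bialg_struct \<subseteq> co: coalg "coalg_of B"
  using bialgebra by unfold_locales (auto simp: bialgebra_def)

context bialg_struct
begin

lemma cop_mul:
  assumes "is_vspace U" "bilinear B B U \<beta>" "x \<in> carr B" "y \<in> carr B"
  shows "(\<Sum>(a, b)\<leftarrow>cop (coalg_of B) (mul B x y). \<beta> a b) =
    (\<Sum>(x1, x2)\<leftarrow>cop (coalg_of B) x. \<Sum>(y1, y2)\<leftarrow>cop (coalg_of B) y. \<beta> (mul B x1 y1) (mul B x2 y2))"
proof -
  have c: "bcomul B z \<in> carr (tensor B B)" if "z \<in> carr B" for z
    using lin_map_carr[OF co.comul_lin] that by simp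
  have "(\<Sum>(a, b)\<leftarrow>cop (coalg_of B) (mul B x y). \<beta> a b) = tlift B B U \<beta> (bcomul B (mul B x y))"
    using co.cop_tlift[of U \<beta> "mul B x y"] assms mul_carr by simp
  also have "\<dots> = tlift B B U \<beta> (tensor_mul B (bcomul B x) (bcomul B y))"
    using bialgebra assms(3,4) by (simp add: bialgebra_def)
  finally show ?thesis
    using tensor_mul_sum(2)[OF c c assms(1,2)] assms(3,4) by (simp add: cop_def)
qed

lemma cop_one:
  assumes "is_vspace U" "bilinear B B U \<beta>"
  shows "(\<Sum>(a, b)\<leftarrow>cop (coalg_of B) (one B). \<beta> a b) = \<beta> (one B) (one B)"
proof -
  have "(\<Sum>(a, b)\<leftarrow>cop (coalg_of B) (one B). \<beta> a b) = tlift B B U \<beta> (bcomul B (one B))"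
    using co.cop_tlift[of U \<beta> "one B"] assms one_carr by simp
  then show ?thesis
    using bialgebra assms one_carr by (simp add: bialgebra_def tlift_tens)
qed

lemma counit_mul: "x \<in> carr B \<Longrightarrow> y \<in> carr B \<Longrightarrow> bcounit B (mul B x y) = bcounit B x * bcounit B y"
  and counit_one: "bcounit B (one B) = 1"
  using bialgebra by (auto simp: bialgebra_def)

lemma conv_apply: "f \<in> Hom B fld \<Longrightarrow> g \<in> Hom B fld \<Longrightarrow> x \<in> carr B \<Longrightarrow>
    mul (fdual B) f g x = (\<Sum>(a, b)\<leftarrow>cop (coalg_of B) x. f a * g b)"
  using co.dual_mul[of f g x] by (simp add: fdual_mul Hom_lin)

lemma conv_Hom: "f \<in> Hom B fld \<Longrightarrow> g \<in> Hom B fld \<Longrightarrow> mul (fdual B) f g \<in> Hom B fld"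
  using co.dual_mul_lin[of f g] Hom_lin[of f B fld] Hom_lin[of g B fld] by (simp add: fdual_mul)

text \<open>Multiplicativity of the comultiplication gives
  \<open>f (x\<^sub>1 y\<^sub>1) * g (x\<^sub>2 y\<^sub>2)\<close>; splitting both factors and
  regrouping produces convolutions. The splittings are arbitrary, so the lemma serves chosen ones,
  those given by \<open>dcomul\<close>, and those coming from the coproduct of
  \<open>Bl\<close>.\<close>

lemma conv_mul:
  assumes f: "f \<in> Hom B fld" and g: "g \<in> Hom B fld"
    and xs: "set xs \<subseteq> Hom B fld \<times> Hom B fld" and ys: "set ys \<subseteq> Hom B fld \<times> Hom B fld"
    and fx: "\<And>x y. x \<in> carr B \<Longrightarrow> y \<in> carr B \<Longrightarrow> f (mul B x y) = (\<Sum>(f1, f2)\<leftarrow>xs. f1 x * f2 y)"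
    and gy: "\<And>x y. x \<in> carr B \<Longrightarrow> y \<in> carr B \<Longrightarrow> g (mul B x y) = (\<Sum>(g1, g2)\<leftarrow>ys. g1 x * g2 y)"
    and x: "x \<in> carr B" and y: "y \<in> carr B"
  shows "mul (fdual B) f g (mul B x y) =
    (\<Sum>(f1, f2)\<leftarrow>xs. \<Sum>(g1, g2)\<leftarrow>ys. mul (fdual B) f1 g1 x * mul (fdual B) f2 g2 y)"
proof -
  let ?C = "cop (coalg_of B)"
  have cc: "fst z \<in> carr B" "snd z \<in> carr B" if "z \<in> set (?C u)" "u \<in> carr B" for z u
    using co.cop_carr[of u "fst z" "snd z"] that by auto
  have "mul (fdual B) f g (mul B x y) =
    (\<Sum>z\<leftarrow>?C x. \<Sum>w\<leftarrow>?C y. f (mul B (fst z) (fst w)) * g (mul B (snd z) (snd w)))"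
    using cop_mul[OF is_vspace_fld bilinear_mult[OF Hom_lin[OF f] Hom_lin[OF g]] x y]
    by (simp add: conv_apply f g mul_carr x y case_prod_unfold)
  also have "\<dots> = (\<Sum>z\<leftarrow>?C x. \<Sum>w\<leftarrow>?C y. \<Sum>i\<leftarrow>xs. \<Sum>j\<leftarrow>ys.
      (fst i (fst z) * fst j (snd z)) * (snd i (fst w) * snd j (snd w)))"
  proof (intro sum_list_cong)
    fix z w assume "z \<in> set (?C x)" "w \<in> set (?C y)"
    then have "f (mul B (fst z) (fst w)) * g (mul B (snd z) (snd w)) =
        (\<Sum>i\<leftarrow>xs. fst i (fst z) * snd i (fst w)) * (\<Sum>j\<leftarrow>ys. fst j (snd z) * snd j (snd w))"
      by (simp add: fx gy cc x y case_prod_unfold)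
    then show "f (mul B (fst z) (fst w)) * g (mul B (snd z) (snd w)) =
        (\<Sum>i\<leftarrow>xs. \<Sum>j\<leftarrow>ys. (fst i (fst z) * fst j (snd z)) * (snd i (fst w) * snd j (snd w)))"
      by (simp add: sum_list_product mult_ac)
  qed
  \<comment> \<open>With the splitting indices outside, the sum over the coproducts factors into a
    convolution at \<open>x\<close> times a convolution at \<open>y\<close>.\<close>
  also have "\<dots> = (\<Sum>i\<leftarrow>xs. \<Sum>j\<leftarrow>ys. \<Sum>z\<leftarrow>?C x. \<Sum>w\<leftarrow>?C y.
      (fst i (fst z) * fst j (snd z)) * (snd i (fst w) * snd j (snd w)))"
    by (rule sum_list_swap4)
  also have "\<dots> = (\<Sum>i\<leftarrow>xs. \<Sum>j\<leftarrow>ys. mul (fdual B) (fst i) (fst j) x * mul (fdual B) (snd i) (snd j) y)"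
  proof (intro sum_list_cong)
    fix i j assume "i \<in> set xs" "j \<in> set ys"
    then have "fst i \<in> Hom B fld" "snd i \<in> Hom B fld" "fst j \<in> Hom B fld" "snd j \<in> Hom B fld"
      using xs ys by auto
    then show "(\<Sum>z\<leftarrow>?C x. \<Sum>w\<leftarrow>?C y. (fst i (fst z) * fst j (snd z)) * (snd i (fst w) * snd j (snd w))) =
        mul (fdual B) (fst i) (fst j) x * mul (fdual B) (snd i) (snd j) y"
      using x y by (simp add: conv_apply case_prod_unfold sum_list_product)
  qed
  finally show ?thesis by (simp add: case_prod_unfold)
qed

lemma fdual_repH:
  assumes f: "f \<in> carr (fdual_space B)"
  obtains xs where "set xs \<subseteq> Hom B fld \<times> Hom B fld"
    "\<And>x y. x \<in> carr B \<Longrightarrow> y \<in> carr B \<Longrightarrow> f (mul B x y) = (\<Sum>(g, h)\<leftarrow>xs. g x * h y)"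
proof -
  obtain xs where xs: "set xs \<subseteq> carr (fdual_space B) \<times> carr (fdual_space B)"
    "\<And>x y. x \<in> carr B \<Longrightarrow> y \<in> carr B \<Longrightarrow> f (mul B x y) = (\<Sum>(g, h)\<leftarrow>xs. g x * h y)"
    using fdual_rep[OF f] by blast
  have "set xs \<subseteq> Hom B fld \<times> Hom B fld" using xs(1) fdual_Hom by fast
  with xs(2) show ?thesis using that by blast
qed

lemma conv_carr:
  assumes f: "f \<in> carr (fdual_space B)" and g: "g \<in> carr (fdual_space B)"
  shows "mul (fdual B) f g \<in> carr (fdual_space B)"
proof -
  obtain xs where xs: "set xs \<subseteq> Hom B fld \<times> Hom B fld"
    "\<And>x y. x \<in> carr B \<Longrightarrow> y \<in> carr B \<Longrightarrow> f (mul B x y) = (\<Sum>(g, h)\<leftarrow>xs. g x * h y)"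
    using fdual_repH[OF f] by blast
  obtain ys where ys: "set ys \<subseteq> Hom B fld \<times> Hom B fld"
    "\<And>x y. x \<in> carr B \<Longrightarrow> y \<in> carr B \<Longrightarrow> g (mul B x y) = (\<Sum>(g, h)\<leftarrow>ys. g x * h y)"
    using fdual_repH[OF g] by blast
  let ?zs = "concat (map (\<lambda>(f1, f2). map (\<lambda>(g1, g2). (mul (fdual B) f1 g1, mul (fdual B) f2 g2)) ys) xs)"
  have "mul_rep B (mul (fdual B) f g) ?zs"
    unfolding mul_rep_def
  proof (intro conjI ballI)
    fix x y assume "x \<in> carr B" "y \<in> carr B"
    then show "mul (fdual B) f g (mul B x y) = (\<Sum>(g, h)\<leftarrow>?zs. g x * h y)"
      using conv_mul[OF fdual_Hom[OF f] fdual_Hom[OF g] xs(1) ys(1) xs(2) ys(2)]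
      by (simp add: sum_list_concat comp_def case_prod_unfold)
  next
    fix z assume "z \<in> set ?zs"
    then obtain f1 f2 g1 g2 where "(f1, f2) \<in> set xs" "(g1, g2) \<in> set ys"
      and z: "z = (mul (fdual B) f1 g1, mul (fdual B) f2 g2)" by auto
    then have "f1 \<in> Hom B fld" "f2 \<in> Hom B fld" "g1 \<in> Hom B fld" "g2 \<in> Hom B fld"
      using xs(1) ys(1) by auto
    then show "case z of (g, h) \<Rightarrow> lin_map B fld g \<and> lin_map B fld h"
      unfolding z by (simp add: Hom_lin[OF conv_Hom])
  qed
  then show ?thesis by (rule fdualI[OF conv_Hom[OF fdual_Hom[OF f] fdual_Hom[OF g]]])
qed

text \<open>Being multiplicative, the counit has a splitting with a single term.\<close>

lemma counit_fdual: "zrestr B (bcounit B) \<in> carr (fdual_space B)"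
proof (rule fdualI)
  show "zrestr B (bcounit B) \<in> Hom B fld" using zrestr_Hom[OF avs, of fld "bcounit B"] co.counit_lin by simp
  show "mul_rep B (zrestr B (bcounit B)) [(bcounit B, bcounit B)]"
    using co.counit_lin by (simp add: mul_rep_def mul_carr counit_mul)
qed

lemma algebra_fdual: "algebra (fdual B)"
proof -
  have A: "algebra (dual_alg (coalg_of B))" by (rule co.algebra_dual)
  have H: "Hom (coalg_of B) fld = Hom B fld" by (simp add: Hom_def)
  show ?thesis
    using A fdual_Hom[of _ B] conv_carr counit_fdual is_vspace_fdual
    unfolding algebra_def
    by (auto simp: fdual_mul[symmetric] bilinear_def lin_map_def H zrestr_def)
qed

lemma fdual_precoalg: "precoalg (coalg_of (fdual B))"
  using is_vspace_fdual dcomul_lin eval_lin by unfold_locales auto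

sublocale fd: precoalg "coalg_of (fdual B)"
  by (rule fdual_precoalg)

lemma cop_fdual:
  assumes "f \<in> carr (fdual_space B)" "x \<in> carr B" "y \<in> carr B"
  shows "f (mul B x y) = (\<Sum>(g, h)\<leftarrow>cop (coalg_of (fdual B)) f. g x * h y)"
  using fd.cop_tlift[OF is_vspace_fld, of "\<lambda>f1 f2. f1 x * f2 y" f] assms
  by (simp add: eval_bilinear dcomul_eval)

lemma cop_fdual_carr:
  assumes "f \<in> carr (fdual_space B)"
  shows "set (cop (coalg_of (fdual B)) f) \<subseteq> carr (fdual_space B) \<times> carr (fdual_space B)"
  using fd.cop_carr[of f] assms by auto

text \<open>Tested at points \<open>x\<close>, \<open>y\<close>, \<open>z\<close>, coassociativity
  says that \<open>f\<close> takes the same value at \<open>(x y) z\<close> and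
  \<open>x (y z)\<close>; the counit laws are the unit laws of \<open>B\<close> under
  \<open>f\<close>.\<close>

lemma coalgebra_fdual: "coalgebra (coalg_of (fdual B))"
proof (rule fd.coalgebraI_sep[where \<Phi> = "(\<lambda>x f. f x) ` carr B"])
  let ?C = "cop (coalg_of (fdual B))"
  fix F G H :: "('b \<Rightarrow> 'f) \<Rightarrow> 'f" and p assume "F \<in> (\<lambda>x f. f x) ` carr B" "G \<in> (\<lambda>x f. f x) ` carr B" "H \<in> (\<lambda>x f. f x) ` carr B"
    and p: "p \<in> carr (coalg_of (fdual B))"
  then obtain x y z where xyz: "x \<in> carr B" "y \<in> carr B" "z \<in> carr B"
    "F = (\<lambda>f. f x)" "G = (\<lambda>f. f y)" "H = (\<lambda>f. f z)" by auto
  have p': "p \<in> carr (fdual_space B)" using p by simp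
  have "(\<Sum>(u, v)\<leftarrow>?C p. \<Sum>(u1, u2)\<leftarrow>?C u. u1 x * u2 y * v z) = (\<Sum>(u, v)\<leftarrow>?C p. u (mul B x y) * v z)"
    by (rule fd.cop_cong[OF p]) (simp add: cop_fdual xyz case_prod_unfold sum_list_mult_right)
  also have "\<dots> = (\<Sum>(u, v)\<leftarrow>?C p. u x * v (mul B y z))"
    using cop_fdual[OF p' mul_carr[OF xyz(1,2)] xyz(3)] cop_fdual[OF p' xyz(1) mul_carr[OF xyz(2,3)]]
    by (simp add: mul_assoc xyz)
  also have "\<dots> = (\<Sum>(u, v)\<leftarrow>?C p. \<Sum>(v1, v2)\<leftarrow>?C v. u x * v1 y * v2 z)"
    by (rule fd.cop_cong[OF p]) (simp add: cop_fdual xyz case_prod_unfold sum_list_mult_left mult.assoc)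
  finally show "(\<Sum>(x, y)\<leftarrow>?C p. \<Sum>(x1, x2)\<leftarrow>?C x. F x1 * G x2 * H y) =
      (\<Sum>(x, y)\<leftarrow>?C p. \<Sum>(y1, y2)\<leftarrow>?C y. F x * G y1 * H y2)"
    by (simp add: xyz)
next
  let ?C = "cop (coalg_of (fdual B))"
  fix p assume p: "p \<in> carr (coalg_of (fdual B))"
  then have p': "p \<in> carr (fdual_space B)" by simp
  have c: "set (?C p) \<subseteq> carr (fdual_space B) \<times> carr (fdual_space B)" by (rule cop_fdual_carr[OF p'])
  \<comment> \<open>The counit laws are equalities of functions on the whole type, so points off the
    carrier, where everything is 0, have to be covered too.\<close>
  have out: "f z = 0" if "f \<in> carr (fdual_space B)" "z \<notin> carr B" for f z
    using fdual_Hom[OF that(1)] that(2) by (simp add: Hom_def)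
  have out': "(\<Sum>q\<leftarrow>?C p. F q * fst q z) = 0" "(\<Sum>q\<leftarrow>?C p. F q * snd q z) = 0" if "z \<notin> carr B" for z F
  proof -
    have "fst q z = 0" "snd q z = 0" if "q \<in> set (?C p)" for q
      using c that out \<open>z \<notin> carr B\<close> by fastforce+
    then show "(\<Sum>q\<leftarrow>?C p. F q * fst q z) = 0" "(\<Sum>q\<leftarrow>?C p. F q * snd q z) = 0"
      by (simp_all cong: map_cong)
  qed
  show "(\<Sum>(x, y)\<leftarrow>?C p. scale (coalg_of (fdual B)) (counit (coalg_of (fdual B)) x) y) = p"
  proof
    fix z show "(\<Sum>(x, y)\<leftarrow>?C p. scale (coalg_of (fdual B)) (counit (coalg_of (fdual B)) x) y) z = p z"
      using cop_fdual[OF p' one_carr, of z] out[OF p', of z] out'(2)[of z]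
      by (cases "z \<in> carr B") (simp_all add: sum_list_fun case_prod_unfold mul_one_left)
  qed
  show "(\<Sum>(x, y)\<leftarrow>?C p. scale (coalg_of (fdual B)) (counit (coalg_of (fdual B)) y) x) = p"
  proof
    fix z show "(\<Sum>(x, y)\<leftarrow>?C p. scale (coalg_of (fdual B)) (counit (coalg_of (fdual B)) y) x) z = p z"
      using cop_fdual[OF p' _ one_carr, of z] out[OF p', of z] out'(1)[of z "\<lambda>q. snd q (one B)"]
      by (cases "z \<in> carr B") (simp_all add: sum_list_fun case_prod_unfold mul_one_right mult.commute)
  qed
qed (auto simp: eval_lin intro: eval_separates)

text \<open>By uniqueness of \<open>dcomul\<close>, compatibility of product and coproduct is
  checked on pairs of points, where it is \<open>conv_mul\<close>. The remaining axioms are the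
  values of \<open>cop_one\<close> and of the multiplicative counit.\<close>

lemma bialgebra_fdual: "bialgebra (fdual B)"
proof -
  interpret FA: alg_struct "fdual B" by unfold_locales (rule algebra_fdual)
  let ?C = "cop (coalg_of (fdual B))"
  have "dcomul B (mul (fdual B) f g) = tensor_mul (fdual B) (dcomul B f) (dcomul B g)"
    if f: "f \<in> carr (fdual_space B)" and g: "g \<in> carr (fdual_space B)" for f g
  proof (rule dcomul_eqI)
    note tm = FA.tensor_mul_sum[of "dcomul B f" "dcomul B g", simplified, OF dcomul_carr[OF f] dcomul_carr[OF g]]
    show "tensor_mul (fdual B) (dcomul B f) (dcomul B g) \<in> carr (tensor (fdual_space B) (fdual_space B))"
      by (rule tm(1)[OF is_vspace_fld eval_bilinear])
    fix x y assume x: "x \<in> carr B" and y: "y \<in> carr B"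
    have cH: "set (?C h) \<subseteq> Hom B fld \<times> Hom B fld" if "h \<in> carr (fdual_space B)" for h
      using cop_fdual_carr[OF that] fdual_Hom by fast
    have "mul (fdual B) f g (mul B x y) =
        (\<Sum>(f1, f2)\<leftarrow>?C f. \<Sum>(g1, g2)\<leftarrow>?C g. mul (fdual B) f1 g1 x * mul (fdual B) f2 g2 y)"
      by (rule conv_mul[OF fdual_Hom[OF f] fdual_Hom[OF g] cH[OF f] cH[OF g] cop_fdual[OF f] cop_fdual[OF g] x y])
    then show "tlift (fdual_space B) (fdual_space B) fld (\<lambda>f1 f2. f1 x * f2 y)
        (tensor_mul (fdual B) (dcomul B f) (dcomul B g)) = mul (fdual B) f g (mul B x y)"
      by (simp add: tm(2)[OF is_vspace_fld eval_bilinear] cop_def)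
  qed
  moreover have "mul (fdual B) f g (one B) = f (one B) * g (one B)"
    if f: "f \<in> carr (fdual_space B)" and g: "g \<in> carr (fdual_space B)" for f g
    using cop_one[OF is_vspace_fld bilinear_mult[OF Hom_lin[OF fdual_Hom[OF f]] Hom_lin[OF fdual_Hom[OF g]]]]
    by (simp add: conv_apply fdual_Hom f g one_carr)
  moreover have "dcomul B (zrestr B (bcounit B)) =
      tens (fdual_space B) (fdual_space B) (zrestr B (bcounit B)) (zrestr B (bcounit B))"
    by (rule dcomul_eqI)
      (auto simp: tens_carr counit_fdual tlift_tens eval_bilinear counit_mul mul_carr)
  ultimately show ?thesis
    using algebra_fdual coalgebra_fdual
    by (simp add: bialgebra_def counit_one one_carr)
qed

end

section \<open>Tensor powers of comeasurings and measurings\<close>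

lemma tuples_0 [simp]: "xs \<in> tuples V 0 \<longleftrightarrow> xs = []"
  by (auto simp: tuples_def)

lemma tuples_Cons [simp]: "x # xs \<in> tuples V (Suc n) \<longleftrightarrow> x \<in> carr V \<and> xs \<in> tuples V n"
  by (auto simp: tuples_def)

lemma tuples_SucE:
  assumes "xs \<in> tuples V (Suc n)"
  obtains y ys where "xs = y # ys" "y \<in> carr V" "ys \<in> tuples V n"
  using assms by (cases xs) (auto simp: tuples_def)

lemma multilinear_0: "multilinear V 0 U \<beta> \<longleftrightarrow> \<beta> [] \<in> carr U"
  unfolding multilinear_def Ball_def tuples_0 by simp

text \<open>The definition updates positions of a list; splitting off the head makes induction on
  the length possible.\<close>

lemma multilinear_Suc:
  "multilinear V (Suc n) U \<beta> \<longleftrightarrow>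
    (\<forall>xs\<in>tuples V n. lin_map V U (\<lambda>x. \<beta> (x # xs))) \<and>
    (\<forall>x\<in>carr V. multilinear V n U (\<lambda>xs. \<beta> (x # xs)))" (is "?L \<longleftrightarrow> ?R")
proof
  assume L: ?L
  show ?R
  proof (intro conjI ballI)
    fix xs assume xs: "xs \<in> tuples V n"
    show "lin_map V U (\<lambda>x. \<beta> (x # xs))"
    \<comment> \<open>The hypothesis speaks of replacing an existing entry, so some vector must fill
      the first place. Over an empty carrier linearity holds vacuously.\<close>
    proof (cases "\<exists>v. v \<in> carr V")
      case True
      then obtain v where v: "v \<in> carr V" ..
      have "lin_map V U (\<lambda>x. \<beta> ((v # xs)[0 := x]))"
        using L xs v unfolding multilinear_def by (metis tuples_Cons zero_less_Suc)
      then show ?thesis by simp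
    qed (auto simp: lin_map_def)
  next
    fix x assume x: "x \<in> carr V"
    show "multilinear V n U (\<lambda>xs. \<beta> (x # xs))"
      unfolding multilinear_def
    proof (intro conjI ballI allI impI)
      fix xs assume xs: "xs \<in> tuples V n"
      show "\<beta> (x # xs) \<in> carr U" using L x xs by (auto simp: multilinear_def)
      fix i assume i: "i < n"
      have "lin_map V U (\<lambda>y. \<beta> ((x # xs)[Suc i := y]))"
        using L x xs i unfolding multilinear_def by (metis tuples_Cons Suc_mono)
      then show "lin_map V U (\<lambda>y. \<beta> (x # xs[i := y]))" by simp
    qed
  qed
next
  assume R: ?R
  show ?L
    unfolding multilinear_def
  proof (intro conjI ballI allI impI)
    fix xs assume "xs \<in> tuples V (Suc n)"
    then obtain y ys where xs: "xs = y # ys" "y \<in> carr V" "ys \<in> tuples V n" by (rule tuples_SucE)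
    show "\<beta> xs \<in> carr U" using R xs by (auto simp: multilinear_def)
    fix i assume i: "i < Suc n"
    show "lin_map V U (\<lambda>x. \<beta> (xs[i := x]))"
      using R xs i by (cases i) (auto simp: multilinear_def)
  qed
qed

lemma multilinear_carr: "multilinear V n U \<beta> \<Longrightarrow> xs \<in> tuples V n \<Longrightarrow> \<beta> xs \<in> carr U"
  by (simp add: multilinear_def)

lemma multilinear_comp: "multilinear V n U \<beta> \<Longrightarrow> lin_map U W h \<Longrightarrow> multilinear V n W (\<lambda>xs. h (\<beta> xs))"
  unfolding multilinear_def using lin_map_carr[of U W h] lin_map_comp[of V U _ W h] by blast

lemma multilinear_cong:
  "is_vspace V \<Longrightarrow> (\<And>xs. xs \<in> tuples V n \<Longrightarrow> \<beta> xs = \<gamma> xs) \<Longrightarrow>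
   multilinear V n U \<beta> = multilinear V n U \<gamma>"
proof (induction n arbitrary: \<beta> \<gamma>)
  case 0
  then show ?case by (simp add: multilinear_0)
next
  case (Suc n)
  have "multilinear V n U (\<lambda>xs. \<beta> (x # xs)) = multilinear V n U (\<lambda>xs. \<gamma> (x # xs))" if "x \<in> carr V" for x
    by (rule Suc.IH[OF Suc.prems(1) Suc.prems(2)]) (simp add: that)
  moreover have "lin_map V U (\<lambda>x. \<beta> (x # xs)) = lin_map V U (\<lambda>x. \<gamma> (x # xs))" if "xs \<in> tuples V n" for xs
    by (rule lin_map_cong[OF Suc.prems(1) Suc.prems(2)]) (simp add: that)
  ultimately show ?case unfolding multilinear_Suc by simp
qed

lemma tcons_multilinear:
  assumes "v \<in> carr V"
  shows "multilinear V n (tpower V (Suc n)) (\<lambda>xs. ptens V (Suc n) (v # xs))"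
  using multilinear_ptens[of V "Suc n"] assms unfolding multilinear_Suc by blast

lemma tcons_lin: "v \<in> carr V \<Longrightarrow> lin_map (tpower V n) (tpower V (Suc n)) (tcons V n v)"
  and tcons_ptens: "v \<in> carr V \<Longrightarrow> xs \<in> tuples V n \<Longrightarrow> tcons V n v (ptens V n xs) = ptens V (Suc n) (v # xs)"
  unfolding tcons_def
  by (auto intro!: plift_lin plift_ptens[of "tpower V (Suc n)"] tcons_multilinear)

text \<open>Both sides of each linearity law in \<open>x\<close> are linear in the tensor, so the
  law need only be checked at pure tensors.\<close>

lemma tpower_bilinearI:
  assumes "is_vspace X" "is_vspace U"
    and r: "\<And>x. x \<in> carr X \<Longrightarrow> lin_map (tpower V n) U (\<beta> x)"
    and l: "\<And>xs. xs \<in> tuples V n \<Longrightarrow> lin_map X U (\<lambda>x. \<beta> x (ptens V n xs))"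
  shows "bilinear X (tpower V n) U \<beta>"
proof (intro bilinearI r)
  fix t assume t: "t \<in> carr (tpower V n)"
  show "lin_map X U (\<lambda>x. \<beta> x t)"
  proof (rule lin_mapI)
    fix x y c assume x: "x \<in> carr X"
    show "\<beta> x t \<in> carr U" by (rule lin_map_carr[OF r[OF x] t])
    show "\<beta> (scale X c x) t = scale U c (\<beta> x t)"
      using lin_map_scale[OF l x] x
      by (intro tpower_lin_eq[OF r lin_map_scaled[OF _ r] _ _ t] carr_scale assms)
    assume y: "y \<in> carr X"
    show "\<beta> (x + y) t = \<beta> x t + \<beta> y t"
      using lin_map_add[OF l x y] x y
      by (intro tpower_lin_eq[OF r lin_map_plus[OF _ r r] _ _ t] carr_add assms)
  qed
qed

lemma tcons_bilinear:
  assumes "is_vspace V"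
  shows "bilinear V (tpower V n) (tpower V (Suc n)) (tcons V n)"
proof (rule tpower_bilinearI[OF assms is_vspace_tpower tcons_lin])
  fix xs assume xs: "xs \<in> tuples V n"
  have "lin_map V (tpower V (Suc n)) (\<lambda>x. ptens V (Suc n) (x # xs))"
    using multilinear_ptens[of V "Suc n"] xs unfolding multilinear_Suc by blast
  then show "lin_map V (tpower V (Suc n)) (\<lambda>v. tcons V n v (ptens V n xs))"
    by (rule lin_map_cong[THEN iffD1, rotated 2]) (auto simp: assms tcons_ptens xs)
qed

text \<open>The recursion step of \<open>rho_list\<close> for a general bilinear \<open>c\<close>:
  the pair \<open>a0 \<otimes> a1\<close>, \<open>x \<otimes> q\<close> goes to
  \<open>c a0 x \<otimes> a1 q\<close>.\<close>

definition tmul where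
  "tmul A X Y Q c s r = tlift A Q (tensor Y Q)
     (\<lambda>a0 a1. tlift X Q (tensor Y Q) (\<lambda>x q. tens Y Q (c a0 x) (mul Q a1 q)) r) s"

lemma rho_list_Cons:
  "rho_list A Q \<rho> (a # as) =
    tmul A (tpower A (length as)) (tpower A (Suc (length as))) Q (tcons A (length as)) (\<rho> a) (rho_list A Q \<rho> as)"
  by (simp add: tmul_def Let_def)

locale tmul_struct = alg_struct +
  fixes A :: "('a::field, 'd::ab_group_add, 'e) vspace_scheme"
    and X :: "('a, 'g::ab_group_add, 'h) vspace_scheme"
    and Y :: "('a, 'i::ab_group_add, 'j) vspace_scheme"
    and c :: "'d \<Rightarrow> 'g \<Rightarrow> 'i"
  assumes A: "is_vspace A" and X: "is_vspace X" and Y: "is_vspace Y"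
    and c: "bilinear A X Y c"
begin

lemma inner_bilinear:
  assumes "a0 \<in> carr A" "a1 \<in> carr Q"
  shows "bilinear X Q (tensor Y Q) (\<lambda>x q. tens Y Q (c a0 x) (mul Q a1 q))"
  by (intro bilinear_maps[OF bilinear_tens] mul_lin_right bilinear_right[OF c] assms)

lemma outer_bilinear:
  assumes r: "r \<in> carr (tensor X Q)"
  shows "bilinear A Q (tensor Y Q)
    (\<lambda>a0 a1. tlift X Q (tensor Y Q) (\<lambda>x q. tens Y Q (c a0 x) (mul Q a1 q)) r)"
proof -
  have rr: "fst z \<in> carr X" "snd z \<in> carr Q" if "z \<in> set (trep X Q r)" for z
    using trep(1)[OF X r] that by auto
  have "bilinear A Q (tensor Y Q) (\<lambda>a0 a1. tens Y Q (c a0 (fst z)) (mul Q a1 (snd z)))"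
    if "z \<in> set (trep X Q r)" for z
    by (intro bilinear_maps[OF bilinear_tens] mul_lin_left bilinear_left[OF c] rr[OF that])
  then have "bilinear A Q (tensor Y Q) (\<lambda>a0 a1. \<Sum>z\<leftarrow>trep X Q r. tens Y Q (c a0 (fst z)) (mul Q a1 (snd z)))"
    by (intro bilinear_sum) auto
  then show ?thesis
    by (rule bilinear_congr[THEN iffD1, rotated 3])
      (auto simp: A avs X tlift_trep inner_bilinear r case_prod_unfold)
qed

lemma tmul_tens:
  assumes "a0 \<in> carr A" "a1 \<in> carr Q" "x \<in> carr X" "q \<in> carr Q"
  shows "tmul A X Y Q c (tens A Q a0 a1) (tens X Q x q) = tens Y Q (c a0 x) (mul Q a1 q)"
  using assms unfolding tmul_def
  by (simp add: tlift_tens outer_bilinear tens_carr inner_bilinear)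

lemma tmul_bilinear: "bilinear (tensor A Q) (tensor X Q) (tensor Y Q) (tmul A X Y Q c)"
proof (rule bilinearI)
  show "lin_map (tensor A Q) (tensor Y Q) (\<lambda>s. tmul A X Y Q c s r)" if "r \<in> carr (tensor X Q)" for r
    unfolding tmul_def using that by (intro tlift_lin is_vspace_tensor outer_bilinear)
  show "lin_map (tensor X Q) (tensor Y Q) (tmul A X Y Q c s)" if s: "s \<in> carr (tensor A Q)" for s
  proof -
    have ss: "fst z \<in> carr A" "snd z \<in> carr Q" if "z \<in> set (trep A Q s)" for z
      using trep(1)[OF A s] that by auto
    have "lin_map (tensor X Q) (tensor Y Q) (\<lambda>r. \<Sum>z\<leftarrow>trep A Q s.
        tlift X Q (tensor Y Q) (\<lambda>x q. tens Y Q (c (fst z) x) (mul Q (snd z) q)) r)"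
      by (intro lin_map_sum is_vspace_tensor tlift_lin inner_bilinear ss)
    then show ?thesis
      by (rule lin_map_cong[THEN iffD1, rotated 2])
        (auto simp: tmul_def tlift_trep[OF A is_vspace_tensor outer_bilinear s] case_prod_unfold)
  qed
qed

text \<open>Induction steps about \<open>rho_list\<close> compare a linear map after
  \<open>tmul\<close> with a bilinear map of the two arguments; this reduces them to pure tensors in
  both.\<close>

lemma tmul_eqI:
  assumes g: "lin_map (tensor Y Q) U g" and b: "bilinear (tensor A Q) (tensor X Q) U b" and U: "is_vspace U"
    and eq: "\<And>a0 a1 x q. a0 \<in> carr A \<Longrightarrow> a1 \<in> carr Q \<Longrightarrow> x \<in> carr X \<Longrightarrow> q \<in> carr Q \<Longrightarrow>
      g (tens Y Q (c a0 x) (mul Q a1 q)) = b (tens A Q a0 a1) (tens X Q x q)"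
    and s: "s \<in> carr (tensor A Q)" and r: "r \<in> carr (tensor X Q)"
  shows "g (tmul A X Y Q c s r) = b s r"
proof (rule tensor_lin_eq[OF lin_map_comp[OF bilinear_left[OF tmul_bilinear r] g] bilinear_left[OF b r] A _ s])
  fix a0 a1 assume a: "a0 \<in> carr A" "a1 \<in> carr Q"
  then have t: "tens A Q a0 a1 \<in> carr (tensor A Q)" by (rule tens_carr)
  show "g (tmul A X Y Q c (tens A Q a0 a1) r) = b (tens A Q a0 a1) r"
    by (rule tensor_lin_eq[OF lin_map_comp[OF bilinear_right[OF tmul_bilinear t] g] bilinear_right[OF b t] X _ r])
      (simp add: tmul_tens a eq)
qed

end

lemma rho_list_multilinear:
  assumes A: "is_vspace A" and Q: "algebra Q" and \<rho>: "lin_map A (tensor A Q) \<rho>"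
  shows "multilinear A n (tensor (tpower A n) Q) (rho_list A Q \<rho>)"
proof (induction n)
  case 0
  have "one Q \<in> carr Q" using Q by (simp add: algebra_def)
  then show ?case by (simp add: multilinear_0 tens_carr ptens_carr)
next
  case (Suc n)
  interpret tmul_struct Q A "tpower A n" "tpower A (Suc n)" "tcons A n"
    using A Q by unfold_locales (auto simp: tcons_bilinear)
  let ?m = "tmul A (tpower A n) (tpower A (Suc n)) Q (tcons A n)"
  have len: "length xs = n" if "xs \<in> tuples A n" for xs using that by (simp add: tuples_def)
  show ?case
    unfolding multilinear_Suc
  proof (intro conjI ballI)
    fix xs assume xs: "xs \<in> tuples A n"
    show "lin_map A (tensor (tpower A (Suc n)) Q) (\<lambda>x. rho_list A Q \<rho> (x # xs))"
      unfolding rho_list_Cons len[OF xs]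
      by (rule lin_map_comp[OF \<rho> bilinear_left[OF tmul_bilinear multilinear_carr[OF Suc xs]]])
  next
    fix x assume x: "x \<in> carr A"
    have "multilinear A n (tensor (tpower A (Suc n)) Q) (\<lambda>xs. ?m (\<rho> x) (rho_list A Q \<rho> xs))"
      by (rule multilinear_comp[OF Suc bilinear_right[OF tmul_bilinear lin_map_carr[OF \<rho> x]]])
    then show "multilinear A n (tensor (tpower A (Suc n)) Q) (\<lambda>xs. rho_list A Q \<rho> (x # xs))"
      by (rule multilinear_cong[THEN iffD1, rotated 2]) (simp_all only: A rho_list_Cons len)
  qed
qed

lemma comeas_pow:
  assumes "is_vspace A" "algebra Q" "lin_map A (tensor A Q) \<rho>"
  shows comeas_pow_lin: "lin_map (tpower A n) (tensor (tpower A n) Q) (comeas_pow A Q \<rho> n)"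
    and comeas_pow_ptens: "xs \<in> tuples A n \<Longrightarrow> comeas_pow A Q \<rho> n (ptens A n xs) = rho_list A Q \<rho> xs"
  unfolding comeas_pow_def
  by (auto intro!: plift_lin plift_ptens[of "tensor (tpower A n) Q"] rho_list_multilinear assms)

lemma alg_homD:
  assumes "alg_hom Q R \<phi>"
  shows "\<phi> \<in> Hom Q R" "lin_map Q R \<phi>" "\<phi> (one Q) = one R"
    "x \<in> carr Q \<Longrightarrow> y \<in> carr Q \<Longrightarrow> \<phi> (mul Q x y) = mul R (\<phi> x) (\<phi> y)"
  using assms by (auto simp: alg_hom_def dest: Hom_lin)

text \<open>The coefficients belonging to a list are products in \<open>Q\<close>, which an algebra
  map takes to products in \<open>R\<close>; the empty list needs preservation of the unit.\<close>

lemma rho_list_tmap: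
  assumes A: "is_vspace A" and Q: "algebra Q" and R: "algebra R" and \<phi>: "alg_hom Q R \<phi>"
    and \<rho>: "lin_map A (tensor A Q) \<rho>" and \<rho>': "\<And>a. a \<in> carr A \<Longrightarrow> \<rho>' a = tmap A Q R \<phi> (\<rho> a)"
  shows "xs \<in> tuples A n \<Longrightarrow> rho_list A R \<rho>' xs = tmap (tpower A n) Q R \<phi> (rho_list A Q \<rho> xs)"
proof (induction n arbitrary: xs)
  case 0
  have "one Q \<in> carr Q" using Q by (simp add: algebra_def)
  then show ?case using 0 alg_homD[OF \<phi>] by (simp add: tmap_tens ptens_carr)
next
  case (Suc n)
  interpret q: tmul_struct Q A "tpower A n" "tpower A (Suc n)" "tcons A n"
    using A Q by unfold_locales (auto simp: tcons_bilinear)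
  interpret r: tmul_struct R A "tpower A n" "tpower A (Suc n)" "tcons A n"
    using A R by unfold_locales (auto simp: tcons_bilinear)
  note l = alg_homD(2)[OF \<phi>]
  from Suc.prems obtain y ys where xs: "xs = y # ys" "y \<in> carr A" "ys \<in> tuples A n" by (rule tuples_SucE)
  have len: "length ys = n" using xs by (simp add: tuples_def)
  note rc = multilinear_carr[OF rho_list_multilinear[OF A Q \<rho>] xs(3)]
  have tc: "tcons A n a0 x \<in> carr (tpower A (Suc n))" if "a0 \<in> carr A" "x \<in> carr (tpower A n)" for a0 x
    by (rule lin_map_carr[OF bilinear_right[OF q.c that(1)] that(2)])
  note b = bilinear_maps[OF r.tmul_bilinear tmap_lin[OF l] tmap_lin[OF l]]
  show ?case
    unfolding xs(1) rho_list_Cons len Suc.IH[OF xs(3)] \<rho>'[OF xs(2)]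
    by (rule q.tmul_eqI[OF tmap_lin[OF l] b is_vspace_tensor _ lin_map_carr[OF \<rho> xs(2)] rc, symmetric])
      (use alg_homD(4)[OF \<phi>] lin_map_carr[OF l] in
        \<open>auto simp: tmap_tens l r.tmul_tens q.mul_carr tc\<close>)
qed

lemma comeas_pow_tmap:
  assumes A: "is_vspace A" and Q: "algebra Q" and R: "algebra R" and \<phi>: "alg_hom Q R \<phi>"
    and \<rho>: "lin_map A (tensor A Q) \<rho>" and \<rho>': "\<And>a. a \<in> carr A \<Longrightarrow> \<rho>' a = tmap A Q R \<phi> (\<rho> a)"
    and t: "t \<in> carr (tpower A n)"
  shows "comeas_pow A R \<rho>' n t = tmap (tpower A n) Q R \<phi> (comeas_pow A Q \<rho> n t)"
proof -
  note l = alg_homD(2)[OF \<phi>]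
  have \<rho>l: "lin_map A (tensor A R) \<rho>'"
    using lin_map_comp[OF \<rho> tmap_lin[OF l]]
    by (rule lin_map_cong[THEN iffD1, rotated 2]) (simp_all add: A \<rho>')
  show ?thesis
    by (rule tpower_lin_eq[OF comeas_pow_lin[OF A R \<rho>l] lin_map_comp[OF comeas_pow_lin[OF A Q \<rho>] tmap_lin[OF l]]
          is_vspace_tensor _ t])
      (simp add: comeas_pow_ptens A R \<rho>l Q \<rho> rho_list_tmap[OF A Q R \<phi> \<rho> \<rho>'])
qed

definition tmapl where
  "tmapl V U W h = tlift V W (tensor U W) (\<lambda>v w. tens U W (h v) w)"

lemma tmapl_lin: "lin_map V U h \<Longrightarrow> lin_map (tensor V W) (tensor U W) (tmapl V U W h)"
  and tmapl_tens: "lin_map V U h \<Longrightarrow> v \<in> carr V \<Longrightarrow> w \<in> carr W \<Longrightarrow>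
    tmapl V U W h (tens V W v w) = tens U W (h v) w"
  unfolding tmapl_def
  by (auto intro!: tlift_lin tlift_tens[of "tensor U W"] bilinear_maps[OF bilinear_tens _ lin_map_ident])

lemma tmap_tmapl:
  assumes "is_vspace V" "lin_map V U h" "lin_map W T k" "t \<in> carr (tensor V W)"
  shows "tmap U W T k (tmapl V U W h t) = tmapl V U T h (tmap V W T k t)"
  using assms(4)
  by (rule tensor_lin_eq[rotated 4, OF _ lin_map_comp[OF tmapl_lin tmap_lin] lin_map_comp[OF tmap_lin tmapl_lin]])
    (use assms in \<open>auto simp: tmap_tens tmapl_tens lin_map_carr\<close>)

lemma tcontr_tmapl:
  assumes "is_vspace V" "is_vspace U" "lin_map V U h" "lin_map W fld f" "t \<in> carr (tensor V W)"
  shows "tcontr U W f (tmapl V U W h t) = h (tcontr V W f t)"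
  using assms(5)
  by (rule tensor_lin_eq[rotated 4, OF _ lin_map_comp[OF tmapl_lin tcontr_lin] lin_map_comp[OF tcontr_lin]])
    (use assms in \<open>auto simp: tcontr_tens tmapl_tens lin_map_carr lin_map_scale\<close>)

lemma comeasuring_iff:
  "comeasuring S A Q \<rho> \<longleftrightarrow> lin_map A (tensor A Q) \<rho> \<and>
     (\<forall>\<omega>\<in>opset S. \<forall>x\<in>carr (tpower A (src S \<omega>)).
        comeas_pow A Q \<rho> (tgt S \<omega>) (oper A \<omega> x) =
        tmapl (tpower A (src S \<omega>)) (tpower A (tgt S \<omega>)) Q (oper A \<omega>) (comeas_pow A Q \<rho> (src S \<omega>) x))"
  by (simp add: comeasuring_def tmapl_def)

text \<open>Tensoring over a field keeps injectivity: the forms of \<open>U\<close> composed with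
  \<open>h\<close> separate \<open>W\<close>, and contractions by them factor through
  \<open>tmap\<close>.\<close>

lemma tmap_inj:
  assumes V: "is_vspace V" and W: "is_vspace W" and U: "is_vspace U"
    and h: "lin_map W U h" and inj: "\<And>w. w \<in> carr W \<Longrightarrow> h w = 0 \<Longrightarrow> w = 0"
    and s: "s \<in> carr (tensor V W)" and t: "t \<in> carr (tensor V W)"
    and eq: "tmap V W U h s = tmap V W U h t"
  shows "s = t"
proof (rule tensor_eqI[where \<Psi> = "{\<lambda>w. f (h w) | f. f \<in> Hom U fld}", OF V W s t])
  show "w = 0" if "w \<in> carr W" "\<And>f. f \<in> {\<lambda>w. f (h w) | f. f \<in> Hom U fld} \<Longrightarrow> f w = 0" for w
    using that(2) by (intro inj[OF that(1)] forms_separate[OF U] lin_map_carr[OF h that(1)]) auto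
  show "lin_map W fld f" if "f \<in> {\<lambda>w. f (h w) | f. f \<in> Hom U fld}" for f
    using that by (auto intro: lin_map_comp[OF h] Hom_lin)
  show "tcontr V W f s = tcontr V W f t" if "f \<in> {\<lambda>w. f (h w) | f. f \<in> Hom U fld}" for f
    using that eq tcontr_tmap[OF V h Hom_lin s] tcontr_tmap[OF V h Hom_lin t] by auto
qed

lemma omega_algebraD:
  assumes "omega_algebra S A"
  shows "is_vspace A" "\<omega> \<in> opset S \<Longrightarrow> lin_map (tpower A (src S \<omega>)) (tpower A (tgt S \<omega>)) (oper A \<omega>)"
  using assms by (auto simp: omega_algebra_def)

lemma comeasuring_tmap:
  assumes O: "omega_algebra S A" and Q: "algebra Q" and R: "algebra R" and \<phi>: "alg_hom Q R \<phi>"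
    and \<rho>: "comeasuring S A Q \<rho>" and \<rho>': "\<And>a. a \<in> carr A \<Longrightarrow> \<rho>' a = tmap A Q R \<phi> (\<rho> a)"
  shows "comeasuring S A R \<rho>'"
proof -
  note A = omega_algebraD(1)[OF O] and op = omega_algebraD(2)[OF O]
  note l = alg_homD(2)[OF \<phi>]
  have \<rho>l: "lin_map A (tensor A Q) \<rho>" using \<rho> by (simp add: comeasuring_iff)
  have \<rho>l': "lin_map A (tensor A R) \<rho>'"
    using lin_map_comp[OF \<rho>l tmap_lin[OF l]]
    by (rule lin_map_cong[THEN iffD1, rotated 2]) (simp_all add: A \<rho>')
  note cp = comeas_pow_tmap[OF A Q R \<phi> \<rho>l \<rho>']
  show ?thesis
    unfolding comeasuring_iff
  proof (intro conjI ballI \<rho>l')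
    fix \<omega> x assume \<omega>: "\<omega> \<in> opset S" and x: "x \<in> carr (tpower A (src S \<omega>))"
    have "comeas_pow A Q \<rho> (tgt S \<omega>) (oper A \<omega> x) =
        tmapl (tpower A (src S \<omega>)) (tpower A (tgt S \<omega>)) Q (oper A \<omega>) (comeas_pow A Q \<rho> (src S \<omega>) x)"
      using \<rho> \<omega> x by (simp add: comeasuring_iff)
    then show "comeas_pow A R \<rho>' (tgt S \<omega>) (oper A \<omega> x) =
        tmapl (tpower A (src S \<omega>)) (tpower A (tgt S \<omega>)) R (oper A \<omega>) (comeas_pow A R \<rho>' (src S \<omega>) x)"
      using tmap_tmapl[OF is_vspace_tpower op[OF \<omega>] l lin_map_carr[OF comeas_pow_lin[OF A Q \<rho>l] x]]
      by (simp add: cp lin_map_carr[OF op[OF \<omega>] x] x)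
  qed
qed

text \<open>The law holds after pushing forward along the injective \<open>\<phi>\<close>, and
  \<open>tmap_inj\<close> cancels it. This restricts a comeasuring to a subalgebra that contains its
  coefficients.\<close>

lemma comeasuring_of_tmap:
  assumes O: "omega_algebra S A" and Q: "algebra Q" and R: "algebra R" and \<phi>: "alg_hom Q R \<phi>"
    and inj: "\<And>q. q \<in> carr Q \<Longrightarrow> \<phi> q = 0 \<Longrightarrow> q = 0"
    and \<rho>: "lin_map A (tensor A Q) \<rho>" and c: "comeasuring S A R \<rho>'"
    and \<rho>': "\<And>a. a \<in> carr A \<Longrightarrow> \<rho>' a = tmap A Q R \<phi> (\<rho> a)"
  shows "comeasuring S A Q \<rho>"
proof -
  note A = omega_algebraD(1)[OF O] and op = omega_algebraD(2)[OF O]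
  note l = alg_homD(2)[OF \<phi>]
  have vs: "is_vspace Q" "is_vspace R" using Q R by (auto simp: algebra_def)
  note cp = comeas_pow_tmap[OF A Q R \<phi> \<rho> \<rho>']
  note cl = lin_map_carr[OF comeas_pow_lin[OF A Q \<rho>]]
  show ?thesis
    unfolding comeasuring_iff
  proof (intro conjI ballI \<rho>)
    fix \<omega> x assume \<omega>: "\<omega> \<in> opset S" and x: "x \<in> carr (tpower A (src S \<omega>))"
    note ox = lin_map_carr[OF op[OF \<omega>] x]
    show "comeas_pow A Q \<rho> (tgt S \<omega>) (oper A \<omega> x) =
        tmapl (tpower A (src S \<omega>)) (tpower A (tgt S \<omega>)) Q (oper A \<omega>) (comeas_pow A Q \<rho> (src S \<omega>) x)"
    proof (rule tmap_inj[OF is_vspace_tpower vs l inj])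
      have "comeas_pow A R \<rho>' (tgt S \<omega>) (oper A \<omega> x) =
        tmapl (tpower A (src S \<omega>)) (tpower A (tgt S \<omega>)) R (oper A \<omega>) (comeas_pow A R \<rho>' (src S \<omega>) x)"
        using c \<omega> x by (simp add: comeasuring_iff)
      then show "tmap (tpower A (tgt S \<omega>)) Q R \<phi> (comeas_pow A Q \<rho> (tgt S \<omega>) (oper A \<omega> x)) =
        tmap (tpower A (tgt S \<omega>)) Q R \<phi>
          (tmapl (tpower A (src S \<omega>)) (tpower A (tgt S \<omega>)) Q (oper A \<omega>) (comeas_pow A Q \<rho> (src S \<omega>) x))"
        by (simp add: cp ox x tmap_tmapl[OF is_vspace_tpower op[OF \<omega>] l cl[OF x]])
    qed (auto intro: cl ox lin_map_carr[OF tmapl_lin[OF op[OF \<omega>]] cl[OF x]])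
  qed
qed

section \<open>Iterated coproducts acting on tensor powers\<close>

lemma map2_tuples:
  assumes "bilinear P A A \<psi>" "ps \<in> tuples P n" "as \<in> tuples A n"
  shows "map2 \<psi> ps as \<in> tuples A n"
proof -
  have "\<psi> p a \<in> carr A" if "p \<in> carr P" "a \<in> carr A" for p a
    by (rule lin_map_carr[OF bilinear_right[OF assms(1) that(1)] that(2)])
  then show ?thesis
    using assms(2,3) by (auto simp: tuples_def) (meson set_zip_leftD set_zip_rightD subsetD)
qed

lemma multilinear_sum:
  "is_vspace U \<Longrightarrow> (\<And>i. i \<in> set xs \<Longrightarrow> multilinear V n U (\<beta> i)) \<Longrightarrow>
   multilinear V n U (\<lambda>l. \<Sum>i\<leftarrow>xs. \<beta> i l)"
  unfolding multilinear_def by (auto intro!: lin_map_sum carr_sum_list)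

lemma map2_multilinear:
  assumes A: "is_vspace A" and P: "is_vspace P" and \<psi>: "bilinear P A A \<psi>" and as: "as \<in> tuples A n"
  shows "multilinear P n (tpower A n) (\<lambda>ps. ptens A n (map2 \<psi> ps as))"
  using as
proof (induction n arbitrary: as)
  case 0
  then show ?case by (simp add: multilinear_0 ptens_carr)
next
  case (Suc n)
  from Suc.prems obtain b bs where as: "as = b # bs" "b \<in> carr A" "bs \<in> tuples A n" by (rule tuples_SucE)
  note \<psi>c = lin_map_carr[OF bilinear_left[OF \<psi> as(2)]]
  show ?case
    unfolding multilinear_Suc
  proof (intro conjI ballI)
    fix ps assume ps: "ps \<in> tuples P n"
    have "lin_map A (tpower A (Suc n)) (\<lambda>x. ptens A (Suc n) (x # map2 \<psi> ps bs))"
      using multilinear_ptens[of A "Suc n"] map2_tuples[OF \<psi> ps as(3)] unfolding multilinear_Suc by blast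
    from lin_map_comp[OF bilinear_left[OF \<psi> as(2)] this]
    show "lin_map P (tpower A (Suc n)) (\<lambda>x. ptens A (Suc n) (map2 \<psi> (x # ps) as))"
      by (simp add: as(1))
  next
    fix p assume p: "p \<in> carr P"
    have "multilinear P n (tpower A (Suc n)) (\<lambda>ps. tcons A n (\<psi> p b) (ptens A n (map2 \<psi> ps bs)))"
      by (rule multilinear_comp[OF Suc.IH[OF as(3)] tcons_lin[OF \<psi>c[OF p]]])
    then show "multilinear P n (tpower A (Suc n)) (\<lambda>ps. ptens A (Suc n) (map2 \<psi> (p # ps) as))"
      by (rule multilinear_cong[THEN iffD1, rotated 2])
        (simp_all add: P as(1) tcons_ptens \<psi>c p map2_tuples[OF \<psi> _ as(3)])
  qed
qed

lemma (in precoalg) sweedler_lin: "lin_map P (tpower P n) (sweedler P n)"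
proof (induction n)
  case 0
  have "lin_map P (tpower P 0) (\<lambda>p. scale (tpower P 0) (counit P p) (ptens P 0 []))"
    by (intro lin_map_scale_vec counit_lin is_vspace_tpower ptens_carr) simp
  then show ?case
    by (rule lin_map_cong[THEN iffD1, rotated 2]) (simp_all del: fscale_apply add: vs)
next
  case (Suc n)
  have b: "bilinear P P (tpower P (Suc n)) (\<lambda>p1 p2. tcons P n p1 (sweedler P n p2))"
    by (rule bilinear_maps[OF tcons_bilinear[OF vs] lin_map_ident Suc])
  show ?case
    by (simp, rule lin_map_comp[OF comul_lin tlift_lin[OF is_vspace_tpower b]])
qed

text \<open>Only bilinearity of \<open>\<psi>\<close> is assumed, not the measuring law, so that
  both sides of that law can be computed before it is known.\<close>

locale pmeas = precoalg P
  for P :: "('a::field, 'b::ab_group_add, 'c) coalg_scheme" +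
  fixes A :: "('a::field, 'd::ab_group_add, 'e) vspace_scheme"
    and \<psi> :: "'b \<Rightarrow> 'd \<Rightarrow> 'd"
  assumes A: "is_vspace A" and \<psi>: "bilinear P A A \<psi>"
begin

text \<open>The tensor \<open>\<psi> p\<^sub>1 a\<^sub>1 \<otimes> \<dots> \<otimes> \<psi>
  p\<^sub>n a\<^sub>n\<close>, the value of \<open>meas_pow\<close> at the pure tensor of
  \<open>as\<close>. With \<open>p\<close> as last argument it is a linear map for fixed
  \<open>as\<close>.\<close>

definition act where
  "act as p = plift P (length as) (tpower A (length as))
     (\<lambda>ps. ptens A (length as) (map2 \<psi> ps as)) (sweedler P (length as) p)"

lemma act_lin_gen: "as \<in> tuples A n \<Longrightarrow>
    lin_map (tpower P n) (tpower A n) (plift P n (tpower A n) (\<lambda>ps. ptens A n (map2 \<psi> ps as)))"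
  by (intro plift_lin is_vspace_tpower map2_multilinear A vs \<psi>)

lemma act_lin: "as \<in> tuples A n \<Longrightarrow> lin_map P (tpower A n) (act as)"
  unfolding act_def using lin_map_comp[OF sweedler_lin act_lin_gen, of as n] by (simp add: tuples_def)

lemma act_Nil: "act [] p = fscale (counit P p) (ptens A 0 [])"
proof -
  have m: "multilinear P 0 (tpower A 0) (\<lambda>ps. ptens A 0 (map2 \<psi> ps []))"
    by (rule map2_multilinear[OF A vs \<psi>]) simp
  have "plift P 0 (tpower A 0) (\<lambda>ps. ptens A 0 (map2 \<psi> ps [])) (ptens P 0 []) = ptens A 0 []"
    using plift_ptens[OF is_vspace_tpower m, of "[]"] by simp
  then show ?thesis
    using lin_map_scale[OF plift_lin[OF is_vspace_tpower m] ptens_carr, of "[]" "counit P p"]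
    by (simp add: act_def)
qed

text \<open>The recursion runs parallel to that of \<open>rho_list\<close>, with the coproduct of
  \<open>p\<close> in the place of the product of coefficients.\<close>

lemma act_Cons:
  assumes a: "a \<in> carr A" and as: "as \<in> tuples A n" and p: "p \<in> carr P"
  shows "act (a # as) p = (\<Sum>(p1, p2)\<leftarrow>cop P p. tcons A n (\<psi> p1 a) (act as p2))"
proof -
  have len: "length as = n" using as by (simp add: tuples_def)
  have aas: "a # as \<in> tuples A (Suc n)" using a as by simp
  let ?J = "plift P (Suc n) (tpower A (Suc n)) (\<lambda>ps. ptens A (Suc n) (map2 \<psi> ps (a # as)))"
  let ?J' = "plift P n (tpower A n) (\<lambda>ps. ptens A n (map2 \<psi> ps as))"
  note m = map2_multilinear[OF A vs \<psi> aas] and m' = map2_multilinear[OF A vs \<psi> as]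
  note Jl = act_lin_gen[OF aas] and Jl' = act_lin_gen[OF as]
  note \<psi>c = lin_map_carr[OF bilinear_left[OF \<psi> a]]
  \<comment> \<open>Both sides are linear in \<open>s\<close>, so pure tensors decide.\<close>
  have J: "?J (tcons P n p1 s) = tcons A n (\<psi> p1 a) (?J' s)"
    if p1: "p1 \<in> carr P" and s: "s \<in> carr (tpower P n)" for p1 s
    by (rule tpower_lin_eq[OF lin_map_comp[OF tcons_lin[OF p1] Jl]
          lin_map_comp[OF Jl' tcons_lin[OF \<psi>c[OF p1]]] is_vspace_tpower _ s])
      (simp add: tcons_ptens p1 plift_ptens[OF is_vspace_tpower m] plift_ptens[OF is_vspace_tpower m']
        \<psi>c map2_tuples[OF \<psi> _ as])
  have b: "bilinear P P (tpower P (Suc n)) (\<lambda>p1 p2. tcons P n p1 (sweedler P n p2))"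
    by (rule bilinear_maps[OF tcons_bilinear[OF vs] lin_map_ident sweedler_lin])
  have "act (a # as) p = ?J (\<Sum>(p1, p2)\<leftarrow>cop P p. tcons P n p1 (sweedler P n p2))"
    by (simp add: act_def len cop_tlift[OF is_vspace_tpower b p])
  also have "\<dots> = (\<Sum>z\<leftarrow>cop P p. ?J (case z of (p1, p2) \<Rightarrow> tcons P n p1 (sweedler P n p2)))"
    by (rule lin_map_sum_list[OF Jl is_vspace_tpower])
      (auto intro!: lin_map_carr[OF tcons_lin] lin_map_carr[OF sweedler_lin] dest: cop_carr[OF p])
  also have "\<dots> = (\<Sum>(p1, p2)\<leftarrow>cop P p. tcons A n (\<psi> p1 a) (act as p2))"
  proof (rule sum_list_cong, clarify)
    fix p1 p2 assume "(p1, p2) \<in> set (cop P p)"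
    then have "p1 \<in> carr P" "p2 \<in> carr P" by (auto dest: cop_carr[OF p])
    then show "?J (tcons P n p1 (sweedler P n p2)) = tcons A n (\<psi> p1 a) (act as p2)"
      using J[OF _ lin_map_carr[OF sweedler_lin]] by (simp only: act_def len)
  qed
  finally show ?thesis .
qed

lemma act_multilinear: "p \<in> carr P \<Longrightarrow> multilinear A n (tpower A n) (\<lambda>as. act as p)"
proof (induction n arbitrary: p)
  case 0
  then show ?case by (simp add: multilinear_0 lin_map_carr[OF act_lin])
next
  case (Suc n)
  note c = cop_carr[OF Suc.prems]
  show ?case
    unfolding multilinear_Suc
  proof (intro conjI ballI)
    fix as assume as: "as \<in> tuples A n"
    have "lin_map A (tpower A (Suc n)) (\<lambda>a. \<Sum>z\<leftarrow>cop P p. case z of (p1, p2) \<Rightarrow> tcons A n (\<psi> p1 a) (act as p2))"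
      by (intro lin_map_sum is_vspace_tpower)
        (auto intro!: lin_map_comp[OF bilinear_right[OF \<psi>] bilinear_left[OF tcons_bilinear[OF A]]]
          lin_map_carr[OF act_lin[OF as]] dest: c)
    then show "lin_map A (tpower A (Suc n)) (\<lambda>a. act (a # as) p)"
      by (rule lin_map_cong[THEN iffD1, rotated 2]) (simp_all add: A act_Cons[OF _ as Suc.prems])
  next
    fix a assume a: "a \<in> carr A"
    note \<psi>c = lin_map_carr[OF bilinear_left[OF \<psi> a]]
    have "multilinear A n (tpower A (Suc n)) (\<lambda>as. \<Sum>z\<leftarrow>cop P p. case z of (p1, p2) \<Rightarrow> tcons A n (\<psi> p1 a) (act as p2))"
      by (intro multilinear_sum is_vspace_tpower)
        (auto intro!: multilinear_comp[OF Suc.IH tcons_lin] \<psi>c dest: c)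
    then show "multilinear A n (tpower A (Suc n)) (\<lambda>as. act (a # as) p)"
      by (rule multilinear_cong[THEN iffD1, rotated 2])
        (rule A, rule act_Cons[OF a _ Suc.prems, symmetric])
  qed
qed

lemma meas_pow_eq:
  assumes "p \<in> carr P"
  shows meas_pow_lin: "lin_map (tpower A n) (tpower A n) (meas_pow P A \<psi> n p)"
    and meas_pow_ptens: "as \<in> tuples A n \<Longrightarrow> meas_pow P A \<psi> n p (ptens A n as) = act as p"
proof -
  let ?\<beta> = "\<lambda>as. plift P n (tpower A n) (\<lambda>ps. ptens A n (map2 \<psi> ps as)) (sweedler P n p)"
  have eq: "?\<beta> as = act as p" if "as \<in> tuples A n" for as
    using that by (simp add: act_def tuples_def)
  have m: "multilinear A n (tpower A n) ?\<beta>"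
    using act_multilinear[OF assms]
    by (rule multilinear_cong[THEN iffD1, rotated 2]) (simp_all add: A eq)
  show "lin_map (tpower A n) (tpower A n) (meas_pow P A \<psi> n p)"
    unfolding meas_pow_def by (rule plift_lin[OF is_vspace_tpower m])
  show "as \<in> tuples A n \<Longrightarrow> meas_pow P A \<psi> n p (ptens A n as) = act as p"
    unfolding meas_pow_def by (simp add: plift_ptens[OF is_vspace_tpower m] eq)
qed

end

lemma coalg_homD:
  assumes "coalg_hom P R \<phi>"
  shows "\<phi> \<in> Hom P R" "lin_map P R \<phi>" "p \<in> carr P \<Longrightarrow> counit R (\<phi> p) = counit P p"
    "p \<in> carr P \<Longrightarrow> comul R (\<phi> p) = tlift P P (tensor R R) (\<lambda>x y. tens R R (\<phi> x) (\<phi> y)) (comul P p)"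
  using assms by (auto simp: coalg_hom_def dest: Hom_lin)

text \<open>Compatibility is assumed at the single element \<open>p\<close> and not through
  \<open>coalg_hom\<close>, so the lemma also covers linear maps that are not normalised off the
  carrier.\<close>

lemma coalg_hom_cop:
  assumes P: "precoalg P" and R: "precoalg R" and \<phi>: "lin_map P R \<phi>" and p: "p \<in> carr P"
    and eq: "comul R (\<phi> p) = tlift P P (tensor R R) (\<lambda>x y. tens R R (\<phi> x) (\<phi> y)) (comul P p)"
    and U: "is_vspace U" and \<beta>: "bilinear R R U \<beta>"
  shows "(\<Sum>(x, y)\<leftarrow>cop R (\<phi> p). \<beta> x y) = (\<Sum>(x, y)\<leftarrow>cop P p. \<beta> (\<phi> x) (\<phi> y))"
proof -
  interpret P: precoalg P by (rule P)
  interpret R: precoalg R by (rule R)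
  have c: "\<phi> (fst z) \<in> carr R" "\<phi> (snd z) \<in> carr R" if "z \<in> set (cop P p)" for z
    using P.cop_carr[OF p, of "fst z" "snd z"] lin_map_carr[OF \<phi>] that by auto
  have "(\<Sum>(x, y)\<leftarrow>cop R (\<phi> p). \<beta> x y) = tlift R R U \<beta> (comul R (\<phi> p))"
    using R.cop_tlift[OF U \<beta> lin_map_carr[OF \<phi> p]] by simp
  also have "comul R (\<phi> p) = (\<Sum>z\<leftarrow>cop P p. tens R R (\<phi> (fst z)) (\<phi> (snd z)))"
    unfolding eq P.cop_tlift[OF is_vspace_tensor bilinear_maps[OF bilinear_tens \<phi> \<phi>] p]
    by (simp add: case_prod_unfold)
  also have "tlift R R U \<beta> \<dots> = (\<Sum>z\<leftarrow>cop P p. tlift R R U \<beta> (tens R R (\<phi> (fst z)) (\<phi> (snd z))))"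
    by (rule lin_map_sum_list[OF tlift_lin[OF U \<beta>] is_vspace_tensor]) (intro tens_carr c)
  also have "\<dots> = (\<Sum>z\<leftarrow>cop P p. \<beta> (\<phi> (fst z)) (\<phi> (snd z)))"
    by (intro sum_list_cong tlift_tens U \<beta> c)
  finally show ?thesis by (simp add: case_prod_unfold)
qed

text \<open>The powers of a measuring are built from iterated coproducts, which
  \<open>\<phi>\<close> preserves; power 0 needs preservation of the counit.\<close>

lemma measuring_pullback:
  assumes O: "omega_algebra S A" and P: "precoalg P" and R: "precoalg R" and \<phi>: "coalg_hom P R \<phi>"
    and m: "measuring S A R \<psi>'" and \<psi>: "\<And>p a. p \<in> carr P \<Longrightarrow> a \<in> carr A \<Longrightarrow> \<psi> p a = \<psi>' (\<phi> p) a"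
  shows "measuring S A P \<psi>"
proof -
  note A = omega_algebraD(1)[OF O] and op = omega_algebraD(2)[OF O]
  note l = coalg_homD(2)[OF \<phi>]
  note lc = lin_map_carr[OF l]
  have b': "bilinear R A A \<psi>'" using m by (simp add: measuring_def)
  have vsP: "is_vspace P" using P by (rule precoalg.vs)
  have b: "bilinear P A A \<psi>"
    using bilinear_maps[OF b' l lin_map_ident]
    by (rule bilinear_congr[THEN iffD1, rotated 3]) (simp_all add: vsP A \<psi>)
  interpret P: pmeas P A \<psi> using P b A by (simp add: pmeas_def pmeas_axioms_def)
  interpret R: pmeas R A \<psi>' using R b' A by (simp add: pmeas_def pmeas_axioms_def)
  have act: "as \<in> tuples A n \<Longrightarrow> p \<in> carr P \<Longrightarrow> P.act as p = R.act as (\<phi> p)" for as n p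
  proof (induction n arbitrary: as p)
    case 0
    then show ?case by (simp add: P.act_Nil R.act_Nil coalg_homD(3)[OF \<phi>])
  next
    case (Suc n)
    from Suc.prems obtain b bs where as: "as = b # bs" "b \<in> carr A" "bs \<in> tuples A n" by (metis tuples_SucE)
    have bb: "bilinear R R (tpower A (Suc n)) (\<lambda>p1 p2. tcons A n (\<psi>' p1 b) (R.act bs p2))"
      by (rule bilinear_maps[OF tcons_bilinear[OF A] bilinear_left[OF b' as(2)] R.act_lin[OF as(3)]])
    have "R.act as (\<phi> p) = (\<Sum>(p1, p2)\<leftarrow>cop P p. tcons A n (\<psi>' (\<phi> p1) b) (R.act bs (\<phi> p2)))"
      unfolding as(1) R.act_Cons[OF as(2,3) lc[OF Suc.prems(2)]]
      by (rule coalg_hom_cop[OF P R l Suc.prems(2) coalg_homD(4)[OF \<phi> Suc.prems(2)] is_vspace_tpower bb])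
    also have "\<dots> = P.act as p"
      unfolding as(1) P.act_Cons[OF as(2,3) Suc.prems(2)]
      by (rule P.cop_cong[OF Suc.prems(2)]) (simp add: Suc.IH[OF as(3)] \<psi> as(2))
    finally show ?case ..
  qed
  have mp: "meas_pow P A \<psi> n p t = meas_pow R A \<psi>' n (\<phi> p) t" if "p \<in> carr P" "t \<in> carr (tpower A n)" for n p t
    by (rule tpower_lin_eq[OF P.meas_pow_lin R.meas_pow_lin is_vspace_tpower _ that(2)])
      (simp_all add: that lc P.meas_pow_ptens R.meas_pow_ptens act)
  show ?thesis
    using m unfolding measuring_def by (auto simp: b mp lc lin_map_carr[OF op])
qed

text \<open>
  A bialgebra-like pairing \<open>pr\<close> of \<open>P\<close> with \<open>Q\<close> turns \<open>\<rho>\<close> into \<open>\<psi>\<close>, and contracting the comeasuring law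
  for \<open>\<rho>\<close> along \<open>pr p\<close> gives the measuring law for \<open>\<psi>\<close> at \<open>p\<close>.
\<close>

locale pairing = alg_struct Q + co: precoalg P
  for Q :: "('a::field, 'b::ab_group_add, 'c) alg_scheme"
    and P :: "('a, 'p::ab_group_add, 'k) coalg_scheme" +
  fixes A :: "('a::field, 'd::ab_group_add, 'e) oalg"
    and \<rho> :: "'d \<Rightarrow> ('a, 'd, 'b) tens"
    and pr :: "'p \<Rightarrow> 'b \<Rightarrow> 'a"
    and \<psi> :: "'p \<Rightarrow> 'd \<Rightarrow> 'd"
  assumes A: "is_vspace A" and \<rho>: "lin_map A (tensor A Q) \<rho>"
    and pr_right: "p \<in> carr P \<Longrightarrow> lin_map Q fld (pr p)"
    and pr_left: "q \<in> carr Q \<Longrightarrow> lin_map P fld (\<lambda>p. pr p q)"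
    and pr_one: "p \<in> carr P \<Longrightarrow> pr p (one Q) = counit P p"
    and pr_mul: "p \<in> carr P \<Longrightarrow> x \<in> carr Q \<Longrightarrow> y \<in> carr Q \<Longrightarrow>
      pr p (mul Q x y) = (\<Sum>(p1, p2)\<leftarrow>cop P p. pr p1 x * pr p2 y)"
    and \<psi>: "p \<in> carr P \<Longrightarrow> a \<in> carr A \<Longrightarrow> \<psi> p a = tcontr A Q (pr p) (\<rho> a)"
begin

lemma tcontr_pr_left:
  assumes X: "is_vspace X" and s: "s \<in> carr (tensor X Q)"
  shows "lin_map P X (\<lambda>p. tcontr X Q (pr p) s)"
proof -
  have "lin_map P X (\<lambda>p. \<Sum>z\<leftarrow>trep X Q s. scale X (pr p (snd z)) (fst z))"
    using trep(1)[OF X s] by (intro lin_map_sum lin_map_scale_vec pr_left X) auto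
  then show ?thesis
    by (rule lin_map_cong[THEN iffD1, rotated 2])
      (auto simp: co.vs tcontr_def tlift_trep[OF X X bilinear_scale_right s] pr_right X case_prod_unfold)
qed

lemma \<psi>_bilinear: "bilinear P A A \<psi>"
proof -
  have "bilinear P A A (\<lambda>p a. tcontr A Q (pr p) (\<rho> a))"
    by (intro bilinearI lin_map_comp[OF \<rho> tcontr_lin] tcontr_pr_left A pr_right lin_map_carr[OF \<rho>])
  then show ?thesis
    by (rule bilinear_congr[THEN iffD1, rotated 3]) (simp_all add: co.vs A \<psi>)
qed

sublocale m: pmeas P A \<psi>
  by unfold_locales (rule A, rule \<psi>_bilinear)

text \<open>The inductive step is \<open>pr_mul\<close>: multiplying coefficients in
  \<open>Q\<close> is dual to splitting \<open>p\<close> by its coproduct. The empty list is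
  \<open>pr_one\<close>.\<close>

lemma act_eq: "as \<in> tuples A n \<Longrightarrow> p \<in> carr P \<Longrightarrow>
    m.act as p = tcontr (tpower A n) Q (pr p) (rho_list A Q \<rho> as)"
proof (induction n arbitrary: as p)
  case 0
  then show ?case
    by (simp add: m.act_Nil tcontr_tens pr_right ptens_carr one_carr pr_one)
next
  case (Suc n)
  interpret t: tmul_struct Q A "tpower A n" "tpower A (Suc n)" "tcons A n"
    using A by unfold_locales (auto simp: tcons_bilinear)
  from Suc.prems obtain b bs where as: "as = b # bs" "b \<in> carr A" "bs \<in> tuples A n" by (metis tuples_SucE)
  note p = Suc.prems(2)
  note c = co.cop_carr[OF p]
  have len: "length bs = n" using as by (simp add: tuples_def)
  note rc = multilinear_carr[OF rho_list_multilinear[OF A algebra \<rho>] as(3)]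
  let ?b = "\<lambda>s r. \<Sum>z\<leftarrow>cop P p. case z of (p1, p2) \<Rightarrow>
    tcons A n (tcontr A Q (pr p1) s) (tcontr (tpower A n) Q (pr p2) r)"
  have bb: "bilinear (tensor A Q) (tensor (tpower A n) Q) (tpower A (Suc n)) ?b"
    by (intro bilinear_sum is_vspace_tpower)
      (auto intro!: bilinear_maps[OF tcons_bilinear[OF A] tcontr_lin tcontr_lin] A pr_right dest: c)
  have "tcontr (tpower A (Suc n)) Q (pr p) (rho_list A Q \<rho> as) = ?b (\<rho> b) (rho_list A Q \<rho> bs)"
    unfolding as(1) rho_list_Cons len
  proof (rule t.tmul_eqI[OF tcontr_lin bb is_vspace_tpower _ lin_map_carr[OF \<rho> as(2)] rc])
    fix a0 a1 x q assume H: "a0 \<in> carr A" "a1 \<in> carr Q" "x \<in> carr (tpower A n)" "q \<in> carr Q"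
    have tc: "tcons A n a0 x \<in> carr (tpower A (Suc n))"
      by (rule lin_map_carr[OF tcons_lin[OF H(1)] H(3)])
    have "tcontr (tpower A (Suc n)) Q (pr p) (tens (tpower A (Suc n)) Q (tcons A n a0 x) (mul Q a1 q)) =
        fscale (\<Sum>z\<leftarrow>cop P p. case z of (p1, p2) \<Rightarrow> pr p1 a1 * pr p2 q) (tcons A n a0 x)"
      by (simp add: tcontr_tens pr_right p tc mul_carr H pr_mul)
    also have "\<dots> = (\<Sum>z\<leftarrow>cop P p. fscale (case z of (p1, p2) \<Rightarrow> pr p1 a1 * pr p2 q) (tcons A n a0 x))"
      using sum_list_scale[OF is_vspace_tpower[of A "Suc n"]] by simp
    also have "\<dots> = ?b (tens A Q a0 a1) (tens (tpower A n) Q x q)"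
    proof (rule sum_list_cong, clarify)
      fix p1 p2 assume "(p1, p2) \<in> set (cop P p)"
      then have pc: "p1 \<in> carr P" "p2 \<in> carr P" by (auto dest: c)
      have "tcons A n (scale A (pr p1 a1) a0) (fscale (pr p2 q) x) = fscale (pr p1 a1 * pr p2 q) (tcons A n a0 x)"
        using lin_map_scale[OF bilinear_left[OF t.c carr_scale[OF is_vspace_tpower H(3), of "pr p2 q"]] H(1)]
          lin_map_scale[OF tcons_lin[OF H(1)] H(3), of "pr p2 q"] scale_scale[OF is_vspace_tpower[of A "Suc n"]]
        by simp
      then show "fscale (pr p1 a1 * pr p2 q) (tcons A n a0 x) =
          tcons A n (tcontr A Q (pr p1) (tens A Q a0 a1)) (tcontr (tpower A n) Q (pr p2) (tens (tpower A n) Q x q))"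
        by (simp add: tcontr_tens A pr_right pc H)
    qed
    finally show "tcontr (tpower A (Suc n)) Q (pr p) (tens (tpower A (Suc n)) Q (tcons A n a0 x) (mul Q a1 q)) =
        ?b (tens A Q a0 a1) (tens (tpower A n) Q x q)" .
  qed (auto intro: pr_right p)
  also have "\<dots> = m.act as p"
    unfolding as(1) m.act_Cons[OF as(2,3) p]
    by (rule co.cop_cong[OF p]) (simp add: Suc.IH[OF as(3)] \<psi> as(2))
  finally show ?case ..
qed

lemma meas_pow_comeas_pow:
  assumes p: "p \<in> carr P" and t: "t \<in> carr (tpower A n)"
  shows "meas_pow P A \<psi> n p t = tcontr (tpower A n) Q (pr p) (comeas_pow A Q \<rho> n t)"
  by (rule tpower_lin_eq[OF m.meas_pow_lin[OF p]
        lin_map_comp[OF comeas_pow_lin[OF A algebra \<rho>] tcontr_lin] is_vspace_tpower _ t])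
    (simp_all add: m.meas_pow_ptens p comeas_pow_ptens[OF A algebra \<rho>] act_eq pr_right)

text \<open>The operation acts on the tensor power and \<open>pr p\<close> on \<open>Q\<close>, so
  the two commute; each side of the measuring law is the contraction of the same side of the
  comeasuring law.\<close>

lemma measuring_law_iff:
  assumes op: "lin_map (tpower A m) (tpower A n) f" and p: "p \<in> carr P" and x: "x \<in> carr (tpower A m)"
  shows "meas_pow P A \<psi> n p (f x) = f (meas_pow P A \<psi> m p x) \<longleftrightarrow>
    tcontr (tpower A n) Q (pr p) (comeas_pow A Q \<rho> n (f x)) =
    tcontr (tpower A n) Q (pr p) (tmapl (tpower A m) (tpower A n) Q f (comeas_pow A Q \<rho> m x))"
  by (simp add: meas_pow_comeas_pow p x lin_map_carr[OF op]
      tcontr_tmapl[OF is_vspace_tpower is_vspace_tpower op pr_right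
        lin_map_carr[OF comeas_pow_lin[OF A algebra \<rho>] x]])

lemma measuring_of_comeasuring:
  assumes O: "omega_algebra S A" and c: "comeasuring S A Q \<rho>"
  shows "measuring S A P \<psi>"
  using c \<psi>_bilinear
  by (auto simp: measuring_def comeasuring_iff measuring_law_iff[OF omega_algebraD(2)[OF O]])

text \<open>If the functionals \<open>pr p\<close> separate \<open>Q\<close>, the contracted laws
  together imply the uncontracted one. This is the direction used for a convolution algebra, where
  evaluations separate.\<close>

lemma comeasuring_of_measuring:
  assumes O: "omega_algebra S A" and c: "measuring S A P \<psi>"
    and sep: "\<And>q. q \<in> carr Q \<Longrightarrow> (\<And>p. p \<in> carr P \<Longrightarrow> pr p q = 0) \<Longrightarrow> q = 0"
  shows "comeasuring S A Q \<rho>"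
  unfolding comeasuring_iff
proof (intro conjI ballI \<rho>)
  fix \<omega> x assume \<omega>: "\<omega> \<in> opset S" and x: "x \<in> carr (tpower A (src S \<omega>))"
  note op = omega_algebraD(2)[OF O \<omega>]
  note cl = lin_map_carr[OF comeas_pow_lin[OF A algebra \<rho>]]
  show "comeas_pow A Q \<rho> (tgt S \<omega>) (oper A \<omega> x) =
      tmapl (tpower A (src S \<omega>)) (tpower A (tgt S \<omega>)) Q (oper A \<omega>) (comeas_pow A Q \<rho> (src S \<omega>) x)"
  proof (rule tensor_eqI[where \<Psi> = "pr ` carr P", OF is_vspace_tpower avs])
    show "comeas_pow A Q \<rho> (tgt S \<omega>) (oper A \<omega> x) \<in> carr (tensor (tpower A (tgt S \<omega>)) Q)"
      by (rule cl[OF lin_map_carr[OF op x]])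
    show "tmapl (tpower A (src S \<omega>)) (tpower A (tgt S \<omega>)) Q (oper A \<omega>) (comeas_pow A Q \<rho> (src S \<omega>) x)
        \<in> carr (tensor (tpower A (tgt S \<omega>)) Q)"
      by (rule lin_map_carr[OF tmapl_lin[OF op] cl[OF x]])
    show "q = 0" if "q \<in> carr Q" "\<And>f. f \<in> pr ` carr P \<Longrightarrow> f q = 0" for q
      using that by (intro sep) auto
    fix f assume "f \<in> pr ` carr P"
    then obtain p where p: "p \<in> carr P" "f = pr p" by blast
    then show "lin_map Q fld f" by (simp add: pr_right)
    show "tcontr (tpower A (tgt S \<omega>)) Q f (comeas_pow A Q \<rho> (tgt S \<omega>) (oper A \<omega> x)) =
        tcontr (tpower A (tgt S \<omega>)) Q f
          (tmapl (tpower A (src S \<omega>)) (tpower A (tgt S \<omega>)) Q (oper A \<omega>) (comeas_pow A Q \<rho> (src S \<omega>) x))"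
      using measuring_law_iff[OF op p(1) x] c \<omega> p x by (simp add: measuring_def)
  qed
qed

end

section \<open>Universality for test objects on other types\<close>

text \<open>Functions are extended by 0 along the injection. This embeds the full dual of
  \<open>Bl\<close> and the finite dual of \<open>Br\<close>, both spaces of functions on the
  underlying types.\<close>

lemma embed_functions:
  fixes e :: "'z \<Rightarrow> 'u" and V :: "('f::field, 'z \<Rightarrow> 'f, 'm) vspace_scheme"
  assumes "inj e" "scale V = fscale"
  shows "\<exists>j :: ('z \<Rightarrow> 'f) \<Rightarrow> 'u \<Rightarrow> 'f. lin_map V fun_space j \<and> inj_on j (carr V)"
proof (intro exI conjI)
  let ?j = "\<lambda>f u. if u \<in> range e then f (inv e u) else 0"
  show "lin_map V fun_space ?j"
    using assms(2) by (auto simp: lin_map_def fun_eq_iff)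
  show "inj_on ?j (carr V)"
  proof (rule inj_onI)
    fix f g :: "'z \<Rightarrow> 'f" assume eq: "?j f = ?j g"
    show "f = g"
    proof
      fix z show "f z = g z" using fun_cong[OF eq, of "e z"] assms(1) by simp
    qed
  qed
qed

text \<open>A vector is sent to its coordinates in a basis of the ambient space. Basis vectors are
  elements of \<open>'v\<close>, so the coordinates form a function on \<open>'v\<close>, which is
  moved to \<open>'u\<close> along \<open>e\<close>.\<close>

lemma embed_vspace:
  fixes e :: "'v::ab_group_add \<Rightarrow> 'u" and V :: "('f::field, 'v, 'm) vspace_scheme"
  assumes e: "inj e" and V: "is_vspace V"
  shows "\<exists>j :: 'v \<Rightarrow> 'u \<Rightarrow> 'f. lin_map V fun_space j \<and> inj_on j (carr V)"
proof -
  interpret V: vector_space "scale V" using V by (simp add: is_vspace_def)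
  let ?B = "V.extend_basis {}"
  have ind: "V.independent ?B" by (rule V.independent_extend_basis[OF V.independent_empty])
  have sp: "V.span ?B = UNIV" by (rule V.span_extend_basis[OF V.independent_empty])
  let ?r = "V.representation ?B"
  let ?j = "\<lambda>v u. if u \<in> range e then ?r v (inv e u) else 0"
  have "lin_map V fun_space ?j"
    using ind sp by (auto simp: lin_map_def fun_eq_iff V.representation_add V.representation_scale)
  moreover have "inj_on ?j (carr V)"
  proof (rule inj_onI)
    fix v w assume eq: "?j v = ?j w"
    have "?r v b = ?r w b" for b using fun_cong[OF eq, of "e b"] e by simp
    then have rr: "?r v = ?r w" by blast
    have sum: "(\<Sum>b | ?r x b \<noteq> 0. scale V (?r x b) b) = x" for x
      by (rule V.sum_nonzero_representation_eq[OF ind]) (simp add: sp)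
    show "v = w" using sum[of v] unfolding rr unfolding sum[of w] by (rule sym)
  qed
  ultimately show ?thesis by blast
qed

lemma image_space:
  fixes V :: "('f::field, 'v::ab_group_add, 'm) vspace_scheme" and j :: "'v \<Rightarrow> 'u \<Rightarrow> 'f"
  assumes V: "is_vspace V" and j: "lin_map V fun_space j" and inj: "inj_on j (carr V)"
  defines "W \<equiv> \<lparr>scale = fscale, carr = j ` carr V\<rparr>" and "i \<equiv> inv_into (carr V) j"
  shows "is_vspace W" "lin_map V W j" "lin_map W V i" "x \<in> carr V \<Longrightarrow> i (j x) = x"
proof -
  have ij: "i (j x) = x" if "x \<in> carr V" for x using inj that by (simp add: i_def)
  then show "x \<in> carr V \<Longrightarrow> i (j x) = x" .
  have jadd: "j (x + y) = j x + j y" if "x \<in> carr V" "y \<in> carr V" for x y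
    by (rule lin_map_add[OF j that])
  have jsc: "j (scale V c x) = fscale c (j x)" if "x \<in> carr V" for x c
    using lin_map_scale[OF j that, of c] by simp
  have iadd: "i (j x + j y) = x + y" if "x \<in> carr V" "y \<in> carr V" for x y
    using jadd[OF that] ij[OF carr_add[OF V that]] by simp
  have isc: "i (fscale c (j x)) = scale V c x" if "x \<in> carr V" for x c
    using jsc[OF that] ij[OF carr_scale[OF V that]] by metis
  have "j x + j y \<in> j ` carr V" if "x \<in> carr V" "y \<in> carr V" for x y
    using jadd[OF that] carr_add[OF V that] by (metis imageI)
  moreover have "fscale c (j x) \<in> j ` carr V" if "x \<in> carr V" for x c
    using jsc[OF that] carr_scale[OF V that] by (metis imageI)
  moreover have "0 \<in> j ` carr V"
    using lin_map_zero[OF j V] carr_zero[OF V] by (metis imageI)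
  ultimately show "is_vspace W"
    by (auto simp: W_def is_vspace_def vector_space_fscale module.subspace_def[OF module_fscale])
  show "lin_map V W j" by (rule lin_mapI) (auto simp: W_def jadd jsc)
  show "lin_map W V i" by (rule lin_mapI) (auto simp: W_def ij iadd isc)
qed

text \<open>Transport of structure along an injective linear map, which turns an algebra on an
  arbitrary type into a test object. The maps \<open>J\<close> and \<open>I\<close> are restricted
  to the carriers so as to be homomorphisms in the normalised sense.\<close>

lemma algebra_transport:
  fixes Q :: "('f::field, 'q::ab_group_add, 'm) alg_scheme" and j :: "'q \<Rightarrow> 'u \<Rightarrow> 'f"
  assumes Q: "algebra Q" and j: "lin_map Q fun_space j" and inj: "inj_on j (carr Q)"
  shows "\<exists>(Q' :: ('f, 'u \<Rightarrow> 'f) alg) J I. algebra Q' \<and> alg_hom Q Q' J \<and> alg_hom Q' Q I \<and>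
    (\<forall>x\<in>carr Q. I (J x) = x) \<and> (\<forall>y\<in>carr Q'. J (I y) = y)"
proof -
  interpret alg_struct Q by unfold_locales (rule Q)
  define i where "i = inv_into (carr Q) j"
  define W where "W = \<lparr>scale = fscale, carr = j ` carr Q\<rparr>"
  note im = image_space[OF avs j inj, folded i_def W_def]
  define Q' where "Q' = \<lparr>scale = fscale, carr = j ` carr Q,
    mul = (\<lambda>x y. j (mul Q (i x) (i y))), one = j (one Q)\<rparr>"
  have sel [simp]: "scale Q' = fscale" "carr Q' = j ` carr Q" "one Q' = j (one Q)"
    "mul Q' = (\<lambda>x y. j (mul Q (i x) (i y)))" by (simp_all add: Q'_def)
  have "scale Q' = scale W" "carr Q' = carr W" by (simp_all add: W_def)
  note spc = space_cong[OF this]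
  have vs': "is_vspace Q'" using im(1) by (simp only: spc)
  have "bilinear W W W (mul Q')"
    unfolding sel by (rule bilinear_comp[OF bilinear_maps[OF mul_bilinear im(3,3)] im(2)])
  then have "bilinear Q' Q' Q' (mul Q')" by (simp only: bilinear_def spc)
  then have "algebra Q'"
    using vs' one_carr by (auto simp: algebra_def im(4) mul_carr mul_assoc mul_one_left mul_one_right)
  moreover have "alg_hom Q Q' (zrestr Q j)"
    unfolding alg_hom_def
  proof (intro conjI ballI zrestr_Hom avs)
    show "lin_map Q Q' j" using im(2) by (simp only: spc)
  qed (auto simp: mul_carr im(4) one_carr)
  moreover have "alg_hom Q' Q (zrestr Q' i)"
    unfolding alg_hom_def
  proof (intro conjI ballI zrestr_Hom vs')
    show "lin_map Q' Q i" using im(3) by (simp only: spc)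
  qed (auto simp: mul_carr im(4) one_carr)
  moreover have "\<forall>x\<in>carr Q. zrestr Q' i (zrestr Q j x) = x" "\<forall>y\<in>carr Q'. zrestr Q j (zrestr Q' i y) = y"
    by (auto simp: im(4))
  ultimately show ?thesis by blast
qed

lemma coalg_hom_comp:
  assumes P: "precoalg P" and R: "precoalg R" and f: "coalg_hom P R f" and g: "coalg_hom R T g"
    and T: "precoalg T"
  shows "coalg_hom P T (zrestr P (\<lambda>x. g (f x)))"
proof -
  interpret P: precoalg P by (rule P)
  interpret R: precoalg R by (rule R)
  interpret T: precoalg T by (rule T)
  note fl = coalg_homD(2)[OF f] and gl = coalg_homD(2)[OF g]
  show ?thesis
    unfolding coalg_hom_def
  proof (intro conjI ballI zrestr_Hom P.vs lin_map_comp[OF fl gl])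
    fix p assume p: "p \<in> carr P"
    note fp = lin_map_carr[OF fl p]
    show "counit T (zrestr P (\<lambda>x. g (f x)) p) = counit P p"
      using p fp by (simp add: coalg_homD(3)[OF f] coalg_homD(3)[OF g])
    note bg = bilinear_maps[OF bilinear_tens gl gl]
    note bz = bilinear_maps[OF bilinear_tens Hom_lin[OF zrestr_Hom[OF P.vs lin_map_comp[OF fl gl]]]
        Hom_lin[OF zrestr_Hom[OF P.vs lin_map_comp[OF fl gl]]]]
    have "comul T (g (f p)) = (\<Sum>(x, y)\<leftarrow>cop R (f p). tens T T (g x) (g y))"
      using coalg_homD(4)[OF g fp] R.cop_tlift[OF is_vspace_tensor bg fp] by simp
    also have "\<dots> = (\<Sum>(x, y)\<leftarrow>cop P p. tens T T (g (f x)) (g (f y)))"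
      by (rule coalg_hom_cop[OF P R fl p coalg_homD(4)[OF f p] is_vspace_tensor bg])
    also have "\<dots> = (\<Sum>(x, y)\<leftarrow>cop P p. tens T T (zrestr P (\<lambda>x. g (f x)) x) (zrestr P (\<lambda>x. g (f x)) y))"
      by (rule P.cop_cong[OF p]) simp
    finally show "comul T (zrestr P (\<lambda>x. g (f x)) p) =
        tlift P P (tensor T T) (\<lambda>x y. tens T T (zrestr P (\<lambda>x. g (f x)) x) (zrestr P (\<lambda>x. g (f x)) y)) (comul P p)"
      using p by (simp add: P.cop_tlift[OF is_vspace_tensor bz p])
  qed
qed

lemma coalg_hom_ident:
  assumes "precoalg P"
  shows "coalg_hom P P (zrestr P (\<lambda>x. x))"
proof -
  interpret P: precoalg P by (rule assms)
  note z = Hom_lin[OF zrestr_Hom[OF P.vs lin_map_ident]]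
  show ?thesis
    unfolding coalg_hom_def
  proof (intro conjI ballI zrestr_Hom P.vs lin_map_ident)
    fix p assume p: "p \<in> carr P"
    note c = lin_map_carr[OF P.comul_lin p]
    have "tlift P P (tensor P P) (\<lambda>x y. tens P P (zrestr P (\<lambda>x. x) x) (zrestr P (\<lambda>x. x) y)) (comul P p) =
        (\<Sum>(x, y)\<leftarrow>cop P p. tens P P x y)"
      unfolding P.cop_tlift[OF is_vspace_tensor bilinear_maps[OF bilinear_tens z z] p]
      by (rule P.cop_cong[OF p]) simp
    also have "\<dots> = comul P p"
      using trep(2)[OF P.vs c] by (simp add: cop_def tsum_def)
    finally show "comul P (zrestr P (\<lambda>x. x) p) =
        tlift P P (tensor P P) (\<lambda>x y. tens P P (zrestr P (\<lambda>x. x) x) (zrestr P (\<lambda>x. x) y)) (comul P p)"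
      using p by simp
  qed simp
qed

text \<open>Sums over the coproduct of \<open>j p\<close> become sums over the coproduct of
  \<open>p\<close>, so each law, tested by forms, pulls back along \<open>j\<close> to the law in
  \<open>P\<close>.\<close>

lemma coalgebra_transport:
  fixes P :: "('f::field, 'p::ab_group_add, 'm) coalg_scheme" and j :: "'p \<Rightarrow> 'u \<Rightarrow> 'f"
  assumes P: "coalgebra P" and j: "lin_map P fun_space j" and inj: "inj_on j (carr P)"
  shows "\<exists>(P' :: ('f, 'u \<Rightarrow> 'f) coalg) J I. coalgebra P' \<and> coalg_hom P P' J \<and> coalg_hom P' P I \<and>
    (\<forall>x\<in>carr P. I (J x) = x) \<and> (\<forall>y\<in>carr P'. J (I y) = y)"
proof -
  interpret coalg P by unfold_locales (rule P)
  define i where "i = inv_into (carr P) j"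
  define W where "W = \<lparr>scale = fscale, carr = j ` carr P\<rparr>"
  note im = image_space[OF vs j inj, folded i_def W_def]
  note jW = im(2) and iW = im(3) and ij = im(4)
  have bj: "bilinear P P (tensor W W) (\<lambda>x y. tens W W (j x) (j y))"
    by (rule bilinear_maps[OF bilinear_tens jW jW])
  \<comment> \<open>The comultiplication takes values in the tensor square of the bare space
    \<open>W\<close>, since that of \<open>P'\<close> cannot be named inside its own definition; the
    two squares coincide by \<open>space_cong\<close>.\<close>
  define P' where "P' = \<lparr>scale = fscale, carr = j ` carr P,
    comul = (\<lambda>y. tlift P P (tensor W W) (\<lambda>x y. tens W W (j x) (j y)) (comul P (i y))),
    counit = (\<lambda>y. counit P (i y))\<rparr>"
  have sel [simp]: "scale P' = fscale" "carr P' = j ` carr P"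
    "counit P' = (\<lambda>y. counit P (i y))"
    "comul P' = (\<lambda>y. tlift P P (tensor W W) (\<lambda>x y. tens W W (j x) (j y)) (comul P (i y)))"
    by (simp_all add: P'_def)
  have "scale P' = scale W" "carr P' = carr W" by (simp_all add: W_def)
  note spc = space_cong[OF this]
  interpret P': precoalg P'
  proof
    show "is_vspace P'" using im(1) by (simp only: spc)
    show "lin_map P' (tensor P' P') (comul P')"
      unfolding spc sel(4)
      by (rule lin_map_comp[OF lin_map_comp[OF iW comul_lin] tlift_lin[OF is_vspace_tensor bj]])
    show "lin_map P' fld (counit P')"
      unfolding spc sel(3) by (rule lin_map_comp[OF iW counit_lin])
  qed
  have jP: "lin_map P P' j" using jW by (simp only: spc)
  have iP: "lin_map P' P i" using iW by (simp only: spc)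
  have jc: "comul P' (j p) = tlift P P (tensor P' P') (\<lambda>x y. tens P' P' (j x) (j y)) (comul P p)"
    if "p \<in> carr P" for p
    using that by (simp add: ij spc)
  have copf: "(\<Sum>(x, y)\<leftarrow>cop P' (j p). \<beta> x y) = (\<Sum>(x, y)\<leftarrow>cop P p. \<beta> (j x) (j y))"
    if "bilinear P' P' fld \<beta>" "p \<in> carr P" for \<beta> p
    by (rule coalg_hom_cop[OF precoalg_axioms P'.precoalg_axioms jP that(2) jc[OF that(2)] is_vspace_fld that(1)])
  have copt: "(\<Sum>(x, y)\<leftarrow>cop P' (j p). \<beta> x y) = (\<Sum>(x, y)\<leftarrow>cop P p. \<beta> (j x) (j y))"
    if "bilinear P' P' P' \<beta>" "p \<in> carr P" for \<beta> p
    by (rule coalg_hom_cop[OF precoalg_axioms P'.precoalg_axioms jP that(2) jc[OF that(2)] P'.vs that(1)])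
  have "coalgebra P'"
  proof (rule P'.coalgebraI_sep[where \<Phi> = "Hom P' fld"])
    fix f g h q assume H: "f \<in> Hom P' fld" "g \<in> Hom P' fld" "h \<in> Hom P' fld" and "q \<in> carr P'"
    then obtain p where p: "p \<in> carr P" "q = j p" by auto
    note t = trilinear_mult[OF H[THEN Hom_lin]]
    note t' = trilinear_mult[OF H[THEN Hom_lin, THEN lin_map_comp[OF jP]]]
    have bl: "bilinear P' P' fld (\<lambda>x1 x2. f x1 * g x2 * h y)" if "y \<in> carr P'" for y
      using t that by (intro bilinearI) (auto simp: trilinear_def)
    have br: "bilinear P' P' fld (\<lambda>y1 y2. f x * g y1 * h y2)" if "x \<in> carr P'" for x
      using t that by (intro bilinearI) (auto simp: trilinear_def)
    have "(\<Sum>(x, y)\<leftarrow>cop P' q. \<Sum>(x1, x2)\<leftarrow>cop P' x. f x1 * g x2 * h y) =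
        (\<Sum>(x, y)\<leftarrow>cop P p. \<Sum>(x1, x2)\<leftarrow>cop P x. f (j x1) * g (j x2) * h (j y))"
      unfolding p(2) copf[OF P'.trilinear_bilinear_left[OF is_vspace_fld t] p(1)]
      by (rule cop_cong[OF p(1)], rule copf[OF bl]) auto
    also have "\<dots> = (\<Sum>(x, y)\<leftarrow>cop P p. \<Sum>(y1, y2)\<leftarrow>cop P y. f (j x) * g (j y1) * h (j y2))"
      by (rule coassoc[OF is_vspace_fld t' p(1)])
    also have "\<dots> = (\<Sum>(x, y)\<leftarrow>cop P' q. \<Sum>(y1, y2)\<leftarrow>cop P' y. f x * g y1 * h y2)"
      unfolding p(2) copf[OF P'.trilinear_bilinear_right[OF is_vspace_fld t] p(1)]
      by (rule cop_cong[OF p(1)], rule copf[OF br, symmetric]) auto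
    finally show "(\<Sum>(x, y)\<leftarrow>cop P' q. \<Sum>(x1, x2)\<leftarrow>cop P' x. f x1 * g x2 * h y) =
        (\<Sum>(x, y)\<leftarrow>cop P' q. \<Sum>(y1, y2)\<leftarrow>cop P' y. f x * g y1 * h y2)" .
  next
    fix q assume "q \<in> carr P'"
    then obtain p where p: "p \<in> carr P" "q = j p" by auto
    have "(\<Sum>(x, y)\<leftarrow>cop P' q. scale P' (counit P' x) y) =
        (\<Sum>(x, y)\<leftarrow>cop P p. scale P' (counit P' (j x)) (j y))"
      unfolding p(2) by (rule copt[OF bilinear_scale_left[OF P'.vs P'.counit_lin] p(1)])
    also have "\<dots> = (\<Sum>(x, y)\<leftarrow>cop P p. scale P' (counit P x) (j y))"
      by (rule cop_cong[OF p(1)]) (simp add: ij)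
    also have "\<dots> = q" unfolding p(2) by (rule counit_left[OF P'.vs jP p(1)])
    finally show "(\<Sum>(x, y)\<leftarrow>cop P' q. scale P' (counit P' x) y) = q" .
    have "(\<Sum>(x, y)\<leftarrow>cop P' q. scale P' (counit P' y) x) =
        (\<Sum>(x, y)\<leftarrow>cop P p. scale P' (counit P' (j y)) (j x))"
      unfolding p(2) by (rule copt[OF bilinear_scale_right[OF P'.vs P'.counit_lin] p(1)])
    also have "\<dots> = (\<Sum>(x, y)\<leftarrow>cop P p. scale P' (counit P y) (j x))"
      by (rule cop_cong[OF p(1)]) (simp add: ij)
    also have "\<dots> = q" unfolding p(2) by (rule counit_right[OF P'.vs jP p(1)])
    finally show "(\<Sum>(x, y)\<leftarrow>cop P' q. scale P' (counit P' y) x) = q" .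
  qed (use forms_separate[OF P'.vs] Hom_lin in blast)+
  moreover have "coalg_hom P P' (zrestr P j)"
    unfolding coalg_hom_def
  proof (intro conjI ballI zrestr_Hom vs jP)
    note z = Hom_lin[OF zrestr_Hom[OF vs jP]]
    fix p assume p: "p \<in> carr P"
    have "tlift P P (tensor P' P') (\<lambda>x y. tens P' P' (zrestr P j x) (zrestr P j y)) (comul P p) =
        tlift P P (tensor P' P') (\<lambda>x y. tens P' P' (j x) (j y)) (comul P p)"
      unfolding cop_tlift[OF is_vspace_tensor bilinear_maps[OF bilinear_tens z z] p]
        cop_tlift[OF is_vspace_tensor bilinear_maps[OF bilinear_tens jP jP] p]
      by (rule cop_cong[OF p]) simp
    then show "comul P' (zrestr P j p) =
        tlift P P (tensor P' P') (\<lambda>x y. tens P' P' (zrestr P j x) (zrestr P j y)) (comul P p)"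
      using jc[OF p] p by simp
    show "counit P' (zrestr P j p) = counit P p" using p by (simp add: ij)
  qed
  moreover have "coalg_hom P' P (zrestr P' i)"
    unfolding coalg_hom_def
  proof (intro conjI ballI zrestr_Hom P'.vs iP)
    note z = Hom_lin[OF zrestr_Hom[OF P'.vs iP]]
    fix q assume q': "q \<in> carr P'"
    then obtain p where p: "p \<in> carr P" "q = j p" by auto
    note b = bilinear_maps[OF bilinear_tens z z]
    have "tlift P' P' (tensor P P) (\<lambda>x y. tens P P (zrestr P' i x) (zrestr P' i y)) (comul P' q) =
        (\<Sum>(x, y)\<leftarrow>cop P p. tens P P (zrestr P' i (j x)) (zrestr P' i (j y)))"
      unfolding P'.cop_tlift[OF is_vspace_tensor b q'] unfolding p(2)
      by (rule coalg_hom_cop[OF precoalg_axioms P'.precoalg_axioms jP p(1) jc[OF p(1)] is_vspace_tensor b])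
    also have "\<dots> = (\<Sum>(x, y)\<leftarrow>cop P p. tens P P x y)"
      by (rule cop_cong[OF p(1)]) (simp add: ij)
    also have "\<dots> = comul P p"
      using trep(2)[OF vs lin_map_carr[OF comul_lin p(1)]] by (simp add: cop_def tsum_def)
    finally show "comul P (zrestr P' i q) =
        tlift P' P' (tensor P P) (\<lambda>x y. tens P P (zrestr P' i x) (zrestr P' i y)) (comul P' q)"
      using p by (simp add: ij)
    show "counit P (zrestr P' i q) = counit P' q" using p by simp
  qed
  moreover have "\<forall>x\<in>carr P. zrestr P' i (zrestr P j x) = x" "\<forall>y\<in>carr P'. zrestr P j (zrestr P' i y) = y"
    by (auto simp: ij)
  ultimately show ?thesis by blast
qed

lemma alg_hom_comp:
  assumes "algebra Q" "alg_hom Q R f" "alg_hom R T g"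
  shows "alg_hom Q T (zrestr Q (\<lambda>x. g (f x)))"
proof -
  interpret alg_struct Q by unfold_locales (rule assms)
  have "zrestr Q (\<lambda>x. g (f x)) \<in> Hom Q T"
    by (rule zrestr_Hom[OF avs lin_map_comp[OF alg_homD(2)[OF assms(2)] alg_homD(2)[OF assms(3)]]])
  then show ?thesis
    unfolding alg_hom_def
    using alg_homD(3,4)[OF assms(2)] alg_homD(3,4)[OF assms(3)] lin_map_carr[OF alg_homD(2)[OF assms(2)]]
    by (simp add: mul_carr one_carr)
qed

lemma alg_hom_ident:
  assumes "algebra Q"
  shows "alg_hom Q Q (zrestr Q (\<lambda>x. x))"
proof -
  interpret alg_struct Q by unfold_locales (rule assms)
  show ?thesis
    unfolding alg_hom_def using zrestr_Hom[OF avs lin_map_ident] by (simp add: mul_carr one_carr)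
qed

lemma tmap_cong:
  assumes "is_vspace V" "is_vspace W" "lin_map W U h" "\<And>w. w \<in> carr W \<Longrightarrow> h w = k w" "t \<in> carr (tensor V W)"
  shows "tmap V W U h t = tmap V W U k t"
proof -
  have k: "lin_map W U k" using assms(3) by (rule lin_map_cong[THEN iffD1, rotated 2]) (simp_all add: assms)
  show ?thesis
    by (rule tensor_lin_eq[OF tmap_lin[OF assms(3)] tmap_lin[OF k] assms(1) _ assms(5)])
      (simp add: tmap_tens assms k)
qed

lemma tcontr_cong:
  assumes "is_vspace V" "is_vspace W" "lin_map W fld h" "\<And>w. w \<in> carr W \<Longrightarrow> h w = k w" "t \<in> carr (tensor V W)"
  shows "tcontr V W h t = tcontr V W k t"
proof -
  have k: "lin_map W fld k" using assms(3) by (rule lin_map_cong[THEN iffD1, rotated 2]) (simp_all add: assms)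
  show ?thesis
    by (rule tensor_lin_eq[OF tcontr_lin[OF assms(1,3)] tcontr_lin[OF assms(1) k] assms(1) _ assms(5)])
      (simp add: tcontr_tens assms k)
qed

lemma coact_dual_tcontr: "coact_dual A Q \<rho> f a = tcontr A Q f (\<rho> a)"
  by (simp add: coact_dual_def tcontr_def)

text \<open>Forms pull back along \<open>\<phi>\<close>, so pushing a comeasuring forward cannot
  enlarge its cosupport.\<close>

lemma comeas_cosupp_tmap:
  assumes A: "is_vspace A" and Q: "is_vspace Q" and \<phi>: "lin_map Q R \<phi>"
    and \<rho>: "lin_map A (tensor A Q) \<rho>" and \<rho>': "\<And>a. a \<in> carr A \<Longrightarrow> \<rho>' a = tmap A Q R \<phi> (\<rho> a)"
  shows "comeas_cosupp A R \<rho>' \<subseteq> comeas_cosupp A Q \<rho>"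
proof
  fix h assume "h \<in> comeas_cosupp A R \<rho>'"
  then obtain f where f: "f \<in> Hom R fld" "h = zrestr A (coact_dual A R \<rho>' f)"
    by (auto simp: comeas_cosupp_def)
  let ?f = "zrestr Q (\<lambda>q. f (\<phi> q))"
  note fl = lin_map_comp[OF \<phi> Hom_lin[OF f(1)]]
  have "h = zrestr A (coact_dual A Q \<rho> ?f)"
    unfolding f(2)
  proof (rule zrestr_eqI)
    fix a assume a: "a \<in> carr A"
    note t = lin_map_carr[OF \<rho> a]
    show "coact_dual A R \<rho>' f a = coact_dual A Q \<rho> ?f a"
      using tcontr_cong[OF A Q fl, of ?f, OF _ t]
      by (simp add: coact_dual_tcontr \<rho>' a tcontr_tmap[OF A \<phi> Hom_lin[OF f(1)] t])
  qed
  then show "h \<in> comeas_cosupp A Q \<rho>"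
    using zrestr_Hom[OF Q fl] by (auto simp: comeas_cosupp_def)
qed

section \<open>Universality for all objects that embed into the test space\<close>

lemma universal_acting_any:
  fixes P :: "('f::field, 'z::ab_group_add, 'm) coalg_scheme" and j :: "'z \<Rightarrow> 'u \<Rightarrow> 'f"
  assumes UA: "universal_acting TYPE('u \<Rightarrow> 'f) S A V Bl \<psi>" and O: "omega_algebra S A"
    and P: "coalgebra P" and j: "lin_map P fun_space j" "inj_on j (carr P)"
    and m: "measuring S A P \<psi>'" and V: "meas_cosupp A P \<psi>' \<subseteq> V"
  shows "\<exists>!\<phi>. coalg_hom P (coalg_of Bl) \<phi> \<and> (\<forall>p\<in>carr P. \<forall>a\<in>carr A. \<psi> (\<phi> p) a = \<psi>' p a)"
proof -
  obtain P' :: "('f, 'u \<Rightarrow> 'f) coalg" and J I where P': "coalgebra P'"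
    and J: "coalg_hom P P' J" and I: "coalg_hom P' P I"
    and IJ: "\<And>x. x \<in> carr P \<Longrightarrow> I (J x) = x" and JI: "\<And>y. y \<in> carr P' \<Longrightarrow> J (I y) = y"
    using coalgebra_transport[OF P j] by blast
  interpret P: coalg P by unfold_locales (rule P)
  interpret P': coalg P' by unfold_locales (rule P')
  have "bialgebra Bl" using UA by (simp add: universal_acting_def)
  then interpret Bl: bialg_struct Bl by unfold_locales
  have Jc: "\<And>x. x \<in> carr P \<Longrightarrow> J x \<in> carr P'" and Ic: "\<And>x. x \<in> carr P' \<Longrightarrow> I x \<in> carr P"
    using lin_map_carr[OF coalg_homD(2)[OF J]] lin_map_carr[OF coalg_homD(2)[OF I]] by auto
  note pc = P.precoalg_axioms P'.precoalg_axioms Bl.co.precoalg_axioms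
  let ?c = "\<lambda>(P :: ('f, 'u \<Rightarrow> 'f) coalg) \<psi>' \<phi>. coalg_hom P (coalg_of Bl) \<phi> \<and> (\<forall>p\<in>carr P. \<forall>a\<in>carr A. \<psi> (\<phi> p) a = \<psi>' p a)"
  have "measuring S A P' (\<lambda>q. \<psi>' (I q))"
    by (rule measuring_pullback[OF O pc(2,1) I m]) simp
  moreover have "meas_cosupp A P' (\<lambda>q. \<psi>' (I q)) \<subseteq> V"
    using V Ic by (auto simp: meas_cosupp_def)
  ultimately have ex1: "\<exists>!\<phi>. ?c P' (\<lambda>q. \<psi>' (I q)) \<phi>"
    using UA P' unfolding universal_acting_def by blast
  then obtain \<phi> where \<phi>: "?c P' (\<lambda>q. \<psi>' (I q)) \<phi>" by blast
  show ?thesis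
  proof (rule ex1I[of _ "zrestr P (\<lambda>x. \<phi> (J x))"])
    show "coalg_hom P (coalg_of Bl) (zrestr P (\<lambda>x. \<phi> (J x))) \<and>
        (\<forall>p\<in>carr P. \<forall>a\<in>carr A. \<psi> (zrestr P (\<lambda>x. \<phi> (J x)) p) a = \<psi>' p a)"
      using coalg_hom_comp[OF pc(1,2) J _ pc(3)] \<phi> Jc IJ by simp
    \<comment> \<open>Composed with \<open>I\<close>, a competitor on \<open>P\<close> becomes one
      on the transported coalgebra, where uniqueness is known; \<open>I (J x) = x\<close> brings the
      equality back.\<close>
    fix \<chi> assume \<chi>: "coalg_hom P (coalg_of Bl) \<chi> \<and> (\<forall>p\<in>carr P. \<forall>a\<in>carr A. \<psi> (\<chi> p) a = \<psi>' p a)"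
    then have "?c P' (\<lambda>q. \<psi>' (I q)) (zrestr P' (\<lambda>x. \<chi> (I x)))"
      using coalg_hom_comp[OF pc(2,1) I _ pc(3)] Ic by simp
    then have eq: "zrestr P' (\<lambda>x. \<chi> (I x)) = \<phi>" using ex1 \<phi> by blast
    show "\<chi> = zrestr P (\<lambda>x. \<phi> (J x))"
    proof (rule Hom_eqI)
      show "\<chi> \<in> Hom P (coalg_of Bl)" using \<chi> by (simp only: coalg_homD(1))
      show "zrestr P (\<lambda>x. \<phi> (J x)) \<in> Hom P (coalg_of Bl)"
        using coalg_homD(1)[OF coalg_hom_comp[OF pc(1,2) J _ pc(3)]] \<phi> by blast
      show "\<chi> x = zrestr P (\<lambda>x. \<phi> (J x)) x" if "x \<in> carr P" for x
        using that Jc IJ by (simp add: eq[symmetric])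
    qed
  qed
qed

text \<open>The comeasuring is pushed forward to the transported algebra, which keeps the cosupport
  in \<open>V\<close>; existence and uniqueness then return along the inverse isomorphisms.\<close>

lemma universal_coacting_any:
  fixes Q :: "('f::field, 'z::ab_group_add, 'm) alg_scheme" and j :: "'z \<Rightarrow> 'u \<Rightarrow> 'f"
  assumes UC: "universal_coacting TYPE('u \<Rightarrow> 'f) S A V Br \<rho>" and O: "omega_algebra S A"
    and Q: "algebra Q" and j: "lin_map Q fun_space j" "inj_on j (carr Q)"
    and m: "comeasuring S A Q \<rho>'" and V: "comeas_cosupp A Q \<rho>' \<subseteq> V"
  shows "\<exists>!\<phi>. alg_hom Br Q \<phi> \<and> (\<forall>a\<in>carr A. tmap A Br Q \<phi> (\<rho> a) = \<rho>' a)"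
proof -
  obtain Q' :: "('f, 'u \<Rightarrow> 'f) alg" and J I where Q': "algebra Q'"
    and J: "alg_hom Q Q' J" and I: "alg_hom Q' Q I"
    and IJ: "\<And>x. x \<in> carr Q \<Longrightarrow> I (J x) = x" and JI: "\<And>y. y \<in> carr Q' \<Longrightarrow> J (I y) = y"
    using algebra_transport[OF Q j] by blast
  have vsQ: "is_vspace Q" "is_vspace Q'" using Q Q' by (auto simp: algebra_def)
  note A = omega_algebraD(1)[OF O]
  have Br: "algebra Br" "is_vspace Br" and \<rho>: "lin_map A (tensor A Br) \<rho>"
    using UC by (auto simp: universal_coacting_def bialgebra_def algebra_def coaction_def comeasuring_def)
  have \<rho>': "lin_map A (tensor A Q) \<rho>'" using m by (simp add: comeasuring_def)
  note Jl = alg_homD(2)[OF J] and Il = alg_homD(2)[OF I]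
  define \<rho>'' where "\<rho>'' a = tmap A Q Q' J (\<rho>' a)" for a
  have "comeasuring S A Q' \<rho>''"
    by (rule comeasuring_tmap[OF O Q Q' J m]) (simp add: \<rho>''_def)
  moreover have "comeas_cosupp A Q' \<rho>'' \<subseteq> V"
    using comeas_cosupp_tmap[OF A vsQ(1) Jl \<rho>', of \<rho>''] V by (auto simp: \<rho>''_def)
  ultimately have ex1: "\<exists>!\<phi>. alg_hom Br Q' \<phi> \<and> (\<forall>a\<in>carr A. tmap A Br Q' \<phi> (\<rho> a) = \<rho>'' a)"
    using UC Q' unfolding universal_coacting_def tmap_def by blast
  then obtain \<phi> where \<phi>: "alg_hom Br Q' \<phi>" "\<And>a. a \<in> carr A \<Longrightarrow> tmap A Br Q' \<phi> (\<rho> a) = \<rho>'' a" by blast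
  note \<phi>l = alg_homD(2)[OF \<phi>(1)]
  show ?thesis
  proof (rule ex1I[of _ "zrestr Br (\<lambda>x. I (\<phi> x))"], intro conjI ballI)
    show "alg_hom Br Q (zrestr Br (\<lambda>x. I (\<phi> x)))" by (rule alg_hom_comp[OF Br(1) \<phi>(1) I])
    fix a assume a: "a \<in> carr A"
    note t = lin_map_carr[OF \<rho> a] and t' = lin_map_carr[OF \<rho>' a]
    have "tmap A Br Q (zrestr Br (\<lambda>x. I (\<phi> x))) (\<rho> a) = tmap A Br Q (\<lambda>x. I (\<phi> x)) (\<rho> a)"
      by (rule tmap_cong[OF A Br(2) lin_map_comp[OF \<phi>l Il] _ t, symmetric]) simp
    also have "\<dots> = tmap A Q' Q I (tmap A Br Q' \<phi> (\<rho> a))"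
      by (rule tmap_tmap[OF A \<phi>l Il t, symmetric])
    also have "\<dots> = tmap A Q Q (\<lambda>x. I (J x)) (\<rho>' a)"
      unfolding \<phi>(2)[OF a] \<rho>''_def by (rule tmap_tmap[OF A Jl Il t'])
    also have "\<dots> = \<rho>' a" by (rule tmap_ident[OF A t' IJ vsQ(1)])
    finally show "tmap A Br Q (zrestr Br (\<lambda>x. I (\<phi> x))) (\<rho> a) = \<rho>' a" .
  next
    fix \<chi> assume \<chi>: "alg_hom Br Q \<chi> \<and> (\<forall>a\<in>carr A. tmap A Br Q \<chi> (\<rho> a) = \<rho>' a)"
    then have \<chi>l: "lin_map Br Q \<chi>" by (simp only: alg_homD(2))
    note z = alg_hom_comp[OF Br(1) _ J, of \<chi>]
    have "tmap A Br Q' (zrestr Br (\<lambda>x. J (\<chi> x))) (\<rho> a) = \<rho>'' a" if a: "a \<in> carr A" for a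
    proof -
      note t = lin_map_carr[OF \<rho> a]
      have "tmap A Br Q' (zrestr Br (\<lambda>x. J (\<chi> x))) (\<rho> a) = tmap A Br Q' (\<lambda>x. J (\<chi> x)) (\<rho> a)"
        by (rule tmap_cong[OF A Br(2) lin_map_comp[OF \<chi>l Jl] _ t, symmetric]) simp
      then show ?thesis using \<chi> a by (simp add: tmap_tmap[OF A \<chi>l Jl t, symmetric] \<rho>''_def)
    qed
    then have eq: "zrestr Br (\<lambda>x. J (\<chi> x)) = \<phi>" using ex1 \<phi> z \<chi> by blast
    show "\<chi> = zrestr Br (\<lambda>x. I (\<phi> x))"
    proof (rule Hom_eqI[of _ Br Q])
      show "\<chi> \<in> Hom Br Q" using \<chi> by (simp only: alg_homD(1))
      show "zrestr Br (\<lambda>x. I (\<phi> x)) \<in> Hom Br Q" by (rule zrestr_Hom[OF Br(2) lin_map_comp[OF \<phi>l Il]])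
      show "\<chi> x = zrestr Br (\<lambda>x. I (\<phi> x)) x" if "x \<in> carr Br" for x
        using that IJ lin_map_carr[OF \<chi>l that] by (simp add: eq[symmetric])
    qed
  qed
qed

section \<open>The comeasuring dual to a measuring\<close>

text \<open>Two generating sets meet in the one given by the union of their conditions, so the
  generating sets already form a base.\<close>

lemma finite_topology_open:
  assumes "openin (finite_topology A) U" "h \<in> U"
  shows "\<exists>R. finite R \<and> R \<subseteq> carr A \<times> carr A \<and> (\<forall>(a, b)\<in>R. h a = b) \<and>
    (\<forall>g\<in>Hom A A. (\<forall>(a, b)\<in>R. g a = b) \<longrightarrow> g \<in> U)"
proof -
  have "generate_topology_on
      {{f \<in> Hom A A. \<forall>(a, b)\<in>R. f a = b} | R. finite R \<and> R \<subseteq> carr A \<times> carr A} U"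
    using assms(1) by (simp add: finite_topology_def openin_topology_generated_by_iff)
  then show ?thesis
    using assms(2)
  proof (induction arbitrary: h rule: generate_topology_on.induct)
    case Empty
    then show ?case by simp
  next
    case (Int a b)
    from Int.IH(1)[of h] Int.prems obtain R1 where R1: "finite R1" "R1 \<subseteq> carr A \<times> carr A"
      "\<forall>(a, b)\<in>R1. h a = b" "\<And>g. g \<in> Hom A A \<Longrightarrow> \<forall>(a, b)\<in>R1. g a = b \<Longrightarrow> g \<in> a" by auto
    from Int.IH(2)[of h] Int.prems obtain R2 where R2: "finite R2" "R2 \<subseteq> carr A \<times> carr A"
      "\<forall>(a, b)\<in>R2. h a = b" "\<And>g. g \<in> Hom A A \<Longrightarrow> \<forall>(a, b)\<in>R2. g a = b \<Longrightarrow> g \<in> b" by auto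
    show ?case
    proof (intro exI[of _ "R1 \<union> R2"] conjI ballI impI)
      fix g assume "g \<in> Hom A A" "\<forall>(a, b)\<in>R1 \<union> R2. g a = b"
      then show "g \<in> a \<inter> b" using R1(4)[of g] R2(4)[of g] by (simp add: ball_Un)
    qed (use R1 R2 in auto)
  next
    case (UN K)
    then obtain k where k: "k \<in> K" "h \<in> k" by blast
    from UN.IH[OF k] obtain R where "finite R" "R \<subseteq> carr A \<times> carr A" "\<forall>(a, b)\<in>R. h a = b"
      "\<forall>g\<in>Hom A A. (\<forall>(a, b)\<in>R. g a = b) \<longrightarrow> g \<in> k" by blast
    then show ?case using k(1) by (intro exI[of _ R]) blast
  next
    case (Basis s)
    then show ?case by blast
  qed
qed

lemma topspace_finite_topology: "topspace (finite_topology A) = Hom A A"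
proof -
  \<comment> \<open>The empty set of conditions gives the whole space as a generating set.\<close>
  have "{f \<in> Hom A A. \<forall>(a, b)\<in>{}. f a = b} \<in>
      {{f \<in> Hom A A. \<forall>(a, b)\<in>R. f a = b} | R. finite R \<and> R \<subseteq> carr A \<times> carr A}"
    by blast
  then have "Hom A A \<in> {{f \<in> Hom A A. \<forall>(a, b)\<in>R. f a = b} | R. finite R \<and> R \<subseteq> carr A \<times> carr A}"
    by simp
  then have "\<Union>{{f \<in> Hom A A. \<forall>(a, b)\<in>R. f a = b} | R. finite R \<and> R \<subseteq> carr A \<times> carr A} = Hom A A"
    by blast
  then show ?thesis by (simp add: finite_topology_def)
qed

text \<open>Otherwise some basic neighbourhood of \<open>h\<close> misses \<open>V\<close>; but it
  constrains only finitely many points, and a member of \<open>V\<close> agreeing with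
  \<open>h\<close> there lies in it.\<close>

lemma finite_topology_closure:
  assumes V: "closedin (finite_topology A) V" and h: "h \<in> Hom A A"
    and approx: "\<And>R. finite R \<Longrightarrow> R \<subseteq> carr A \<Longrightarrow> \<exists>v\<in>V. \<forall>a\<in>R. v a = h a"
  shows "h \<in> V"
proof (rule ccontr)
  assume "h \<notin> V"
  have sub: "V \<subseteq> Hom A A" using closedin_subset[OF V] by (simp add: topspace_finite_topology)
  have "openin (finite_topology A) (Hom A A - V)"
    using V by (simp add: closedin_def topspace_finite_topology)
  from finite_topology_open[OF this, of h] \<open>h \<notin> V\<close> h obtain R where
    R: "finite R" "R \<subseteq> carr A \<times> carr A" "\<forall>(a, b)\<in>R. h a = b"
    "\<And>g. g \<in> Hom A A \<Longrightarrow> \<forall>(a, b)\<in>R. g a = b \<Longrightarrow> g \<notin> V" by blast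
  have "finite (fst ` R)" "fst ` R \<subseteq> carr A" using R(1,2) by auto
  from approx[OF this] obtain v where v: "v \<in> V" "\<forall>a\<in>fst ` R. v a = h a" by blast
  have "\<forall>(a, b)\<in>R. v a = b" using v(2) R(3) by fastforce
  then show False using R(4)[of v] v(1) sub by blast
qed

text \<open>Finite dimensional reflexivity. The values of the functionals in \<open>C\<close> form a
  linear map \<open>N\<close> of finite rank, and on their span the form \<open>q\<close> is
  evaluation at a combination of finitely many preimages.\<close>

lemma double_dual_finite:
  fixes P :: "('f::field, 'p::ab_group_add, 'm) vspace_scheme"
  assumes P: "is_vspace P" and C: "finite C" "C \<subseteq> Hom P fld" and q: "lin_map (forms P) fld q"
  shows "\<exists>p\<in>carr P. \<forall>c\<in>C. q c = c p"
proof -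
  define N where "N p = (\<lambda>c. if c \<in> C then c p else 0)" for p
  have cl: "lin_map P fld c" if "c \<in> C" for c using C(2) that by (auto intro: Hom_lin)
  have Nl: "lin_map P fun_space N"
    by (rule lin_mapI) (auto simp: N_def fun_eq_iff lin_map_add[OF cl] lin_map_scale[OF cl])
  have "N ` carr P \<subseteq> module.span (scale fun_space) ((\<lambda>s t. if t = s then 1 else 0) ` C)"
  proof clarify
    fix p
    have "N p \<in> module.span fscale ((\<lambda>s t. if t = s then 1 else 0) ` C)"
      by (rule finite_support_span[OF C(1)]) (simp add: N_def)
    then show "N p \<in> module.span (scale fun_space) ((\<lambda>s t. if t = s then 1 else 0) ` C)" by simp
  qed
  from fin_dim_image[OF P is_vspace_fun_space Nl _ this] C(1) obtain M where
    M0: "\<forall>(\<alpha>, y)\<in>set M. Vector_Spaces.linear fscale (*) \<alpha> \<and> y \<in> carr P"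
      "\<forall>x\<in>carr P. N x = (\<Sum>(\<alpha>, y)\<leftarrow>M. fscale (\<alpha> (N x)) (N y))"
    by auto
  define \<gamma> where "\<gamma> \<alpha> = zrestr P (\<lambda>p. \<alpha> (N p))" for \<alpha> :: "(('p \<Rightarrow> 'f) \<Rightarrow> 'f) \<Rightarrow> 'f"
  have M: "snd z \<in> carr P" "\<gamma> (fst z) \<in> Hom P fld" if "z \<in> set M" for z
  proof -
    have z: "Vector_Spaces.linear fscale (*) (fst z)" "snd z \<in> carr P" using M0(1) that by auto
    have "lin_map fun_space fld (fst z)" by (rule linear_lin_map) (simp add: z)
    then show "snd z \<in> carr P" "\<gamma> (fst z) \<in> Hom P fld"
      unfolding \<gamma>_def using z lin_map_comp[OF Nl] by (auto intro!: zrestr_Hom P)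
  qed
  \<comment> \<open>The entry at \<open>c\<close> of the expansion of \<open>N p\<close>: each
    functional in \<open>C\<close> is a combination of the finitely many \<open>\<gamma>\<close>,
    with its own values at the preimages as coefficients.\<close>
  have c_eq: "c = (\<Sum>z\<leftarrow>M. fscale (c (snd z)) (\<gamma> (fst z)))" if c: "c \<in> C" for c
  proof
    fix p
    show "c p = (\<Sum>z\<leftarrow>M. fscale (c (snd z)) (\<gamma> (fst z))) p"
    proof (cases "p \<in> carr P")
      case True
      have "c p = N p c" using c by (simp add: N_def)
      also have "\<dots> = (\<Sum>(\<alpha>, y)\<leftarrow>M. fscale (\<alpha> (N p)) (N y)) c" using M0(2) True by simp
      also have "\<dots> = (\<Sum>z\<leftarrow>M. fst z (N p) * c (snd z))"
        using c by (simp add: sum_list_fun case_prod_unfold N_def)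
      finally show ?thesis using True by (simp add: sum_list_fun \<gamma>_def mult.commute)
    next
      case False
      then show ?thesis using c C(2) by (auto simp: sum_list_fun \<gamma>_def zrestr_def Hom_def)
    qed
  qed
  \<comment> \<open>Applying \<open>q\<close> to \<open>c_eq\<close> and moving \<open>c\<close> out
    of the sum dictates this element.\<close>
  let ?p = "\<Sum>z\<leftarrow>M. scale P (q (\<gamma> (fst z))) (snd z)"
  note H = is_vspace_forms[OF P]
  have p: "?p \<in> carr P" by (intro carr_sum_list P carr_scale M)
  have "q c = c ?p" if c: "c \<in> C" for c
  proof -
    have "q c = q (\<Sum>z\<leftarrow>M. fscale (c (snd z)) (\<gamma> (fst z)))" using c_eq[OF c] by simp
    also have "\<dots> = (\<Sum>z\<leftarrow>M. q (fscale (c (snd z)) (\<gamma> (fst z))))"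
      using carr_scale[OF H] M by (intro lin_map_sum_list[OF q H]) simp
    also have "\<dots> = (\<Sum>z\<leftarrow>M. c (scale P (q (\<gamma> (fst z))) (snd z)))"
      using lin_map_scale[OF q] M lin_map_scale[OF cl[OF c]]
      by (intro sum_list_cong) (simp add: mult.commute)
    also have "\<dots> = c ?p"
      by (rule lin_map_sum_list[OF cl[OF c] P, symmetric]) (intro carr_scale P M)
    finally show ?thesis .
  qed
  then show ?thesis using p by blast
qed

locale vmeasuring = coalg P
  for P :: "('f::field, 'p::ab_group_add, 'm) coalg_scheme" +
  fixes S :: "'o sig" and A :: "('f, 'a::ab_group_add, 'o) oalg" and V :: "('a \<Rightarrow> 'a) set"
    and \<psi> :: "'p \<Rightarrow> 'a \<Rightarrow> 'a"
  assumes O: "omega_algebra S A" and pfd: "pointwise_fin_dim A V"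
    and closed: "closedin (finite_topology A) V"
    and meas: "measuring S A P \<psi>" and cosupp: "meas_cosupp A P \<psi> \<subseteq> V"
begin

lemma A: "is_vspace A" by (rule omega_algebraD(1)[OF O])

lemma \<psi>_bilinear: "bilinear P A A \<psi>" using meas by (simp add: measuring_def)

lemma in_V: "p \<in> carr P \<Longrightarrow> zrestr A (\<psi> p) \<in> V"
  using cosupp by (auto simp: meas_cosupp_def)

lemma ev_lin: "lin_map (dual_alg P) fld (\<lambda>c. c p)"
  by (rule lin_mapI) auto

lemma dual_alg_is_vspace: "is_vspace (dual_alg P)"
  using algebra_dual by (simp add: algebra_def)

text \<open>The orbit of \<open>a\<close> lies in the finite dimensional span of the
  \<open>v a\<close>. In a basis \<open>\<psi> y a\<close> of it the coordinates of
  \<open>\<psi> p a\<close> are forms in \<open>p\<close>, that is, elements of the dual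
  algebra.\<close>

lemma ex_dual:
  assumes a: "a \<in> carr A"
  shows "\<exists>t. t \<in> carr (tensor A (dual_alg P)) \<and> (\<forall>p\<in>carr P. tcontr A (dual_alg P) (\<lambda>c. c p) t = \<psi> p a)"
proof -
  note l = bilinear_left[OF \<psi>_bilinear a]
  obtain E where E: "finite E" "{v a | v. v \<in> V} \<subseteq> module.span (scale A) E"
    using pfd a by (auto simp: pointwise_fin_dim_def fin_dim_def)
  have "\<psi> p a \<in> {v a | v. v \<in> V}" if "p \<in> carr P" for p
    using in_V[OF that] a by (metis (mono_tags, lifting) mem_Collect_eq zrestr_in)
  then have "(\<lambda>p. \<psi> p a) ` carr P \<subseteq> module.span (scale A) E" using E(2) by blast
  from fin_dim_image[OF vs A l E(1) this] obtain L where
    L: "\<And>\<alpha> y. (\<alpha>, y) \<in> set L \<Longrightarrow> Vector_Spaces.linear (scale A) (*) \<alpha> \<and> y \<in> carr P"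
    "\<And>p. p \<in> carr P \<Longrightarrow> \<psi> p a = (\<Sum>(\<alpha>, y)\<leftarrow>L. scale A (\<alpha> (\<psi> p a)) (\<psi> y a))" by blast
  let ?xs = "map (\<lambda>(\<alpha>, y). (\<psi> y a, zrestr P (\<lambda>p. \<alpha> (\<psi> p a)))) L"
  have "zrestr P (\<lambda>p. \<alpha> (\<psi> p a)) \<in> Hom P fld" if "(\<alpha>, y) \<in> set L" for \<alpha> y
    by (rule zrestr_Hom[OF vs lin_map_comp[OF l linear_lin_map]]) (use L(1)[OF that] in simp)
  then have xs: "set ?xs \<subseteq> carr A \<times> carr (dual_alg P)"
    using L(1) lin_map_carr[OF l] by fastforce
  have "tcontr A (dual_alg P) (\<lambda>c. c p) (tsum A (dual_alg P) ?xs) = \<psi> p a" if p: "p \<in> carr P" for p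
    unfolding tcontr_def tlift_tsum[OF A bilinear_scale_right[OF A ev_lin] xs]
    using L(2)[OF p, symmetric] p by (simp add: comp_def case_prod_unfold)
  then show ?thesis using tsum_carr[OF xs] by blast
qed

lemma dual_eqI:
  assumes "s \<in> carr (tensor X (dual_alg P))" "t \<in> carr (tensor X (dual_alg P))" "is_vspace X"
    and "\<And>p. p \<in> carr P \<Longrightarrow> tcontr X (dual_alg P) (\<lambda>c. c p) s = tcontr X (dual_alg P) (\<lambda>c. c p) t"
  shows "s = t"
proof (rule tensor_eqI[where \<Psi> = "(\<lambda>p c. c p) ` carr P", OF assms(3) dual_alg_is_vspace assms(1,2)])
  show "c = 0" if "c \<in> carr (dual_alg P)" "\<And>f. f \<in> (\<lambda>p c. c p) ` carr P \<Longrightarrow> f c = 0" for c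
    using that(1) that(2)[OF imageI] by (auto simp: Hom_def fun_eq_iff)
qed (use ev_lin assms(4) in auto)

text \<open>Chosen separately for each \<open>a\<close>; by \<open>dual_eqI\<close> the tensor is
  unique, and this is why the result is linear in \<open>a\<close>.\<close>

definition \<rho> where
  "\<rho> a = (SOME t. t \<in> carr (tensor A (dual_alg P)) \<and>
    (\<forall>p\<in>carr P. tcontr A (dual_alg P) (\<lambda>c. c p) t = \<psi> p a))"

lemma \<rho>:
  assumes "a \<in> carr A"
  shows \<rho>_carr: "\<rho> a \<in> carr (tensor A (dual_alg P))"
    and \<rho>_ev: "p \<in> carr P \<Longrightarrow> tcontr A (dual_alg P) (\<lambda>c. c p) (\<rho> a) = \<psi> p a"
  using someI_ex[OF ex_dual[OF assms]] unfolding \<rho>_def by auto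

lemma \<rho>_lin: "lin_map A (tensor A (dual_alg P)) \<rho>"
proof (rule lin_mapI)
  let ?E = "dual_alg P"
  fix a b c assume a: "a \<in> carr A"
  show "\<rho> a \<in> carr (tensor A ?E)" by (rule \<rho>_carr[OF a])
  show "\<rho> (scale A c a) = scale (tensor A ?E) c (\<rho> a)"
  proof (rule dual_eqI[OF \<rho>_carr carr_scale A])
    fix p assume p: "p \<in> carr P"
    show "tcontr A ?E (\<lambda>c. c p) (\<rho> (scale A c a)) = tcontr A ?E (\<lambda>c. c p) (scale (tensor A ?E) c (\<rho> a))"
      using lin_map_scale[OF bilinear_right[OF \<psi>_bilinear p] a]
        lin_map_scale[OF tcontr_lin[OF A ev_lin] \<rho>_carr[OF a]]
      by (simp add: \<rho>_ev a p carr_scale[OF A])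
  qed (simp_all add: a carr_scale[OF A] \<rho>_carr)
  assume b: "b \<in> carr A"
  show "\<rho> (a + b) = \<rho> a + \<rho> b"
  proof (rule dual_eqI[OF \<rho>_carr carr_add A])
    fix p assume p: "p \<in> carr P"
    show "tcontr A ?E (\<lambda>c. c p) (\<rho> (a + b)) = tcontr A ?E (\<lambda>c. c p) (\<rho> a + \<rho> b)"
      using lin_map_add[OF bilinear_right[OF \<psi>_bilinear p] a b]
        lin_map_add[OF tcontr_lin[OF A ev_lin] \<rho>_carr[OF a] \<rho>_carr[OF b]]
      by (simp add: \<rho>_ev a b p carr_add[OF A])
  qed (simp_all add: a b carr_add[OF A] \<rho>_carr)
qed

sublocale pr: pairing "dual_alg P" P A \<rho> "\<lambda>p c. c p" \<psi>
proof unfold_locales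
  show "algebra (dual_alg P)" by (rule algebra_dual)
  show "is_vspace A" by (rule A)
  show "lin_map A (tensor A (dual_alg P)) \<rho>" by (rule \<rho>_lin)
  show "lin_map (dual_alg P) fld (\<lambda>c. c p)" for p by (rule ev_lin)
  show "lin_map P fld (\<lambda>p. c p)" if "c \<in> carr (dual_alg P)" for c
    using that by (simp add: Hom_lin)
  show "one (dual_alg P) p = counit P p" if "p \<in> carr P" for p using that by simp
  show "mul (dual_alg P) c d p = (\<Sum>(p1, p2)\<leftarrow>cop P p. c p1 * d p2)"
    if "p \<in> carr P" "c \<in> carr (dual_alg P)" "d \<in> carr (dual_alg P)" for p c d
    using that by (simp add: dual_mul Hom_lin)
  show "\<psi> p a = tcontr A (dual_alg P) (\<lambda>c. c p) (\<rho> a)" if "p \<in> carr P" "a \<in> carr A" for p a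
    using that by (simp add: \<rho>_ev)
qed

lemma comeasuring_\<rho>: "comeasuring S A (dual_alg P) \<rho>"
proof (rule pr.comeasuring_of_measuring[OF O meas])
  show "c = 0" if "c \<in> carr (dual_alg P)" "\<And>p. p \<in> carr P \<Longrightarrow> c p = 0" for c
  proof
    show "c p = 0 p" for p using that by (cases "p \<in> carr P") (simp_all add: Hom_def)
  qed
qed

text \<open>A member of the cosupport comes from an arbitrary form \<open>q\<close> on the dual. On
  finitely many vectors it agrees with the map given by some \<open>p\<close>, which lies in
  \<open>V\<close>; closedness does the rest.\<close>

lemma comeas_cosupp_\<rho>: "comeas_cosupp A (dual_alg P) \<rho> \<subseteq> V"
proof
  let ?E = "dual_alg P"
  fix h assume "h \<in> comeas_cosupp A ?E \<rho>"
  then obtain q where q: "q \<in> Hom ?E fld" "h = zrestr A (coact_dual A ?E \<rho> q)"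
    by (auto simp: comeas_cosupp_def)
  have ql: "lin_map ?E fld q" using q(1) by (rule Hom_lin)
  have ql': "lin_map (forms P) fld q" using ql by (simp add: lin_map_def)
  have hH: "h \<in> Hom A A"
    unfolding q(2) coact_dual_tcontr by (rule zrestr_Hom[OF A lin_map_comp[OF \<rho>_lin tcontr_lin[OF A ql]]])
  show "h \<in> V"
  proof (rule finite_topology_closure[OF closed hH])
    fix R assume R: "finite R" "R \<subseteq> carr A"
    \<comment> \<open>Over a finite set of vectors only finitely many functionals occur as
      coefficients, so \<open>q\<close> may be replaced by an evaluation.\<close>
    let ?C = "\<Union>a\<in>R. snd ` set (trep A ?E (\<rho> a))"
    have r: "set (trep A ?E (\<rho> a)) \<subseteq> carr A \<times> Hom P fld" if "a \<in> R" for a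
      using trep(1)[OF A \<rho>_carr] that R(2) by auto
    have "finite ?C" using R(1) by simp
    moreover have "?C \<subseteq> Hom P fld" using r by fastforce
    ultimately have "\<exists>p\<in>carr P. \<forall>c\<in>?C. q c = c p" by (rule double_dual_finite[OF vs _ _ ql'])
    then obtain p where p: "p \<in> carr P" and pC: "\<forall>c\<in>?C. q c = c p" by (rule bexE)
    have "\<psi> p a = h a" if a: "a \<in> R" for a
    proof -
      have ac: "a \<in> carr A" using a R(2) by blast
      have "h a = (\<Sum>(x, c)\<leftarrow>trep A ?E (\<rho> a). scale A (q c) x)"
        using ac by (simp add: q(2) coact_dual_tcontr tcontr_def
            tlift_trep[OF A A bilinear_scale_right[OF A ql] \<rho>_carr[OF ac]])
      also have "\<dots> = (\<Sum>(x, c)\<leftarrow>trep A ?E (\<rho> a). scale A (c p) x)"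
        by (rule sum_list_cong) (use a pC in fastforce)
      also have "\<dots> = tcontr A ?E (\<lambda>c. c p) (\<rho> a)"
        by (simp add: tcontr_def tlift_trep[OF A A bilinear_scale_right[OF A ev_lin] \<rho>_carr[OF ac]])
      finally show ?thesis using \<rho>_ev[OF ac p] by simp
    qed
    then show "\<exists>v\<in>V. \<forall>a\<in>R. v a = h a"
      using in_V[OF p] R(2) by (intro bexI[of _ "zrestr A (\<psi> p)"]) auto
  qed
qed

end

section \<open>The comparison map\<close>

locale coacting = bialg_struct Br
  for Br :: "('f::field, 'q::ab_group_add) bialg" +
  fixes S :: "'o sig" and A :: "('f, 'a::ab_group_add, 'o) oalg" and \<rho> :: "'a \<Rightarrow> ('f, 'a, 'q) tens"
  assumes O: "omega_algebra S A" and coaction: "coaction S A Br \<rho>"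
begin

lemma A: "is_vspace A" by (rule omega_algebraD(1)[OF O])

lemma comeasuring: "comeasuring S A Br \<rho>" using coaction by (simp add: coaction_def)

lemma \<rho>_lin: "lin_map A (tensor A Br) \<rho>" using comeasuring by (simp add: comeasuring_def)

lemmas \<rho>_carr = lin_map_carr[OF \<rho>_lin]

lemma coact_lin: "lin_map Br fld f \<Longrightarrow> lin_map A A (coact_dual A Br \<rho> f)"
  unfolding coact_dual_tcontr by (rule lin_map_comp[OF \<rho>_lin tcontr_lin[OF A]])

lemma coact_cong:
  assumes "lin_map Br fld f" "\<And>x. x \<in> carr Br \<Longrightarrow> f x = g x" "a \<in> carr A"
  shows "coact_dual A Br \<rho> f a = coact_dual A Br \<rho> g a"
  unfolding coact_dual_tcontr by (rule tcontr_cong[OF A avs assms(1,2) \<rho>_carr[OF assms(3)]])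

lemma coact_counit:
  assumes "a \<in> carr A"
  shows "coact_dual A Br \<rho> (zrestr Br (bcounit Br)) a = a"
proof -
  have c: "lin_map Br fld (bcounit Br)" using co.counit_lin by simp
  have "coact_dual A Br \<rho> (zrestr Br (bcounit Br)) a = coact_dual A Br \<rho> (bcounit Br) a"
    by (rule coact_cong[OF c _ assms, symmetric]) simp
  also have "\<dots> = a" using coaction assms by (simp add: coaction_def coact_dual_def)
  finally show ?thesis .
qed

lemma coact_mul:
  assumes f: "f \<in> Hom Br fld" and g: "g \<in> Hom Br fld" and a: "a \<in> carr A"
  shows "coact_dual A Br \<rho> (mul (fdual Br) f g) a = coact_dual A Br \<rho> f (coact_dual A Br \<rho> g a)"
proof -
  let ?BB = "tensor Br Br"
  let ?T = "tensor A ?BB"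
  let ?F = "tlift Br Br fld (\<lambda>x y. f x * g y)"
  \<comment> \<open>The summand of \<open>(\<rho> \<otimes> id) \<rho>\<close>. The form
    \<open>f\<close> meets the coefficient of the inner coaction and \<open>g\<close> that of the
    outer one, hence a left action.\<close>
  let ?\<beta> = "\<lambda>a0 a1. tmap A Br ?BB (\<lambda>y. tens Br Br y a1) (\<rho> a0)"
  note fl = Hom_lin[OF f] and gl = Hom_lin[OF g]
  have b: "bilinear Br Br fld (\<lambda>x y. f x * g y)" by (rule bilinear_mult[OF fl gl])
  have F: "lin_map ?BB fld ?F" by (rule tlift_lin[OF is_vspace_fld b])
  have C: "lin_map Br ?BB (bcomul Br)" using co.comul_lin by simp
  have FC: "?F (bcomul Br x) = mul (fdual Br) f g x" if "x \<in> carr Br" for x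
    using co.cop_tlift[OF is_vspace_fld, of "\<lambda>x y. f x * g y" x] b that by (simp add: conv_apply f g)
  note H = tcontr_lin[OF A F]
  have \<beta>1: "lin_map A ?T (\<lambda>a0. ?\<beta> a0 a1)" if "a1 \<in> carr Br" for a1
    by (rule lin_map_comp[OF \<rho>_lin tmap_lin[OF bilinear_left[OF bilinear_tens that]]])
  have tm: "tmap A Br ?BB (\<lambda>y. tens Br Br y a1) s =
      (\<Sum>z\<leftarrow>trep A Br s. tens A ?BB (fst z) (tens Br Br (snd z) a1))"
    if "a1 \<in> carr Br" "s \<in> carr (tensor A Br)" for a1 s
    unfolding tmap_def
    by (subst tlift_trep[OF A is_vspace_tensor bilinear_tmap[OF bilinear_left[OF bilinear_tens that(1)]] that(2)])
      (simp add: case_prod_unfold)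
  have \<beta>2: "lin_map Br ?T (?\<beta> a0)" if a0: "a0 \<in> carr A" for a0
  proof -
    have z: "fst z \<in> carr A" "snd z \<in> carr Br" if "z \<in> set (trep A Br (\<rho> a0))" for z
      using trep(1)[OF A \<rho>_carr[OF a0]] that by auto
    have "lin_map Br ?T (\<lambda>a1. \<Sum>z\<leftarrow>trep A Br (\<rho> a0). tens A ?BB (fst z) (tens Br Br (snd z) a1))"
      by (intro lin_map_sum is_vspace_tensor
          lin_map_comp[OF bilinear_right[OF bilinear_tens] bilinear_right[OF bilinear_tens]] z)
    then show ?thesis
      by (rule lin_map_cong[THEN iffD1, rotated 2]) (simp_all add: avs tm \<rho>_carr[OF a0])
  qed
  have \<beta>: "bilinear A Br ?T ?\<beta>" by (rule bilinearI[OF \<beta>2 \<beta>1])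
  have sc: "tcontr A Br (\<lambda>y. f y * c) s = scale A c (tcontr A Br f s)" if "s \<in> carr (tensor A Br)" for c s
  proof -
    have fc: "lin_map Br fld (\<lambda>y. f y * c)"
      using lin_map_scaled[OF is_vspace_fld fl, of c] by (simp add: mult.commute)
    show ?thesis
      by (rule tensor_lin_eq[OF tcontr_lin[OF A fc] lin_map_scaled[OF A tcontr_lin[OF A fl]] A _ that])
        (simp add: tcontr_tens A fc fl scale_scale, simp add: mult.commute)
  qed
  have "coact_dual A Br \<rho> (mul (fdual Br) f g) a = tcontr A Br (\<lambda>x. ?F (bcomul Br x)) (\<rho> a)"
    unfolding coact_dual_tcontr
    by (rule tcontr_cong[OF A avs lin_map_comp[OF C F] _ \<rho>_carr[OF a], symmetric]) (rule FC)
  also have "\<dots> = tcontr A ?BB ?F (tmap A Br ?BB (bcomul Br) (\<rho> a))"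
    by (rule tcontr_tmap[OF A C F \<rho>_carr[OF a], symmetric])
  also have "tmap A Br ?BB (bcomul Br) (\<rho> a) = tlift A Br ?T ?\<beta> (\<rho> a)"
    using coaction a by (simp add: coaction_def tmap_def)
  also have "tcontr A ?BB ?F (tlift A Br ?T ?\<beta> (\<rho> a)) = coact_dual A Br \<rho> f (tcontr A Br g (\<rho> a))"
  proof (rule tensor_lin_eq[OF lin_map_comp[OF tlift_lin[OF is_vspace_tensor \<beta>] H]
        lin_map_comp[OF tcontr_lin[OF A gl] coact_lin[OF fl]] A _ \<rho>_carr[OF a]])
    fix a0 a1 assume a01: "a0 \<in> carr A" "a1 \<in> carr Br"
    note r = \<rho>_carr[OF a01(1)]
    note tl = bilinear_left[OF bilinear_tens a01(2)]
    have "tcontr A ?BB ?F (tlift A Br ?T ?\<beta> (tens A Br a0 a1)) = tcontr A ?BB ?F (?\<beta> a0 a1)"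
      by (simp add: tlift_tens[OF is_vspace_tensor \<beta> a01])
    also have "\<dots> = tcontr A Br (\<lambda>y. ?F (tens Br Br y a1)) (\<rho> a0)"
      by (rule tcontr_tmap[OF A tl F r])
    also have "\<dots> = tcontr A Br (\<lambda>y. f y * g a1) (\<rho> a0)"
      by (rule tcontr_cong[OF A avs lin_map_comp[OF tl F] _ r]) (simp add: tlift_tens b a01)
    also have "\<dots> = scale A (g a1) (coact_dual A Br \<rho> f a0)"
      by (simp add: sc[OF r] coact_dual_tcontr)
    also have "\<dots> = coact_dual A Br \<rho> f (tcontr A Br g (tens A Br a0 a1))"
      by (simp add: tcontr_tens A gl a01 lin_map_scale[OF coact_lin[OF fl]])
    finally show "tcontr A ?BB ?F (tlift A Br ?T ?\<beta> (tens A Br a0 a1)) =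
        coact_dual A Br \<rho> f (tcontr A Br g (tens A Br a0 a1))" .
  qed
  finally show ?thesis by (simp add: coact_dual_tcontr)
qed

sublocale pairing Br "coalg_of (fdual Br)" A \<rho> "\<lambda>f. f" "coact_dual A Br \<rho>"
proof unfold_locales
  show "is_vspace A" by (rule A)
  show "lin_map A (tensor A Br) \<rho>" by (rule \<rho>_lin)
  show "lin_map Br fld f" if "f \<in> carr (coalg_of (fdual Br))" for f
    using that fdual_Hom[of f Br] by (simp add: Hom_lin)
  show "lin_map (coalg_of (fdual Br)) fld (\<lambda>f. f x)" for x using eval_lin by simp
  show "f (one Br) = counit (coalg_of (fdual Br)) f" for f by simp
  show "f (mul Br x y) = (\<Sum>(f1, f2)\<leftarrow>cop (coalg_of (fdual Br)) f. f1 x * f2 y)"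
    if "f \<in> carr (coalg_of (fdual Br))" "x \<in> carr Br" "y \<in> carr Br" for f x y
    using that cop_fdual by simp
  show "coact_dual A Br \<rho> f a = tcontr A Br f (\<rho> a)" for f a by (rule coact_dual_tcontr)
qed

lemma action_fdual: "action S A (fdual Br) (coact_dual A Br \<rho>)"
  unfolding action_def
  using measuring_of_comeasuring[OF O comeasuring] coact_counit coact_mul fdual_Hom[of _ Br] by simp

lemma fdual_cosupp: "meas_cosupp A (fdual Br) (coact_dual A Br \<rho>) \<subseteq> comeas_cosupp A Br \<rho>"
  using fdual_Hom[of _ Br] by (auto simp: meas_cosupp_def comeas_cosupp_def)

text \<open>Values of a form at the coefficients are determined by its action, so identities of
  actions become identities of forms on a generating set.\<close>

lemma coact_tcoeff:
  assumes "lin_map Br fld f" "lin_map A fld \<alpha>" "a \<in> carr A"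
  shows "f (tcoeff A Br \<alpha> (\<rho> a)) = \<alpha> (coact_dual A Br \<rho> f a)"
  unfolding coact_dual_tcontr by (rule tcoeff_tcontr[OF A avs assms(2,1) \<rho>_carr[OF assms(3)]])

end

section \<open>A universal acting and a universal coacting bialgebra for the same data\<close>

locale universal_pair = coacting Br S A \<rho>
  for Br :: "('f::field, 'q::ab_group_add) bialg" and S :: "'o sig"
    and A :: "('f, 'a::ab_group_add, 'o) oalg" and \<rho> :: "'a \<Rightarrow> ('f, 'a, 'q) tens" +
  fixes V :: "('a \<Rightarrow> 'a) set" and Bl :: "('f, 'p::ab_group_add) bialg" and \<psi> :: "'p \<Rightarrow> 'a \<Rightarrow> 'a"
    and ep :: "'p \<Rightarrow> 'u" and eq :: "'q \<Rightarrow> 'u"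
  assumes pfd: "pointwise_fin_dim A V" and closed: "closedin (finite_topology A) V"
    and UA: "universal_acting TYPE('u \<Rightarrow> 'f) S A V Bl \<psi>"
    and UC: "universal_coacting TYPE('u \<Rightarrow> 'f) S A V Br \<rho>"
    and ep: "inj ep" and eq: "inj eq"

sublocale universal_pair \<subseteq> L: bialg_struct Bl
  using UA by unfold_locales (simp add: universal_acting_def)

context universal_pair
begin

lemma action: "action S A Bl \<psi>" using UA by (simp add: universal_acting_def)

lemma cosupp_Br: "comeas_cosupp A Br \<rho> \<subseteq> V" using UC by (simp add: universal_coacting_def)

sublocale vm: vmeasuring "coalg_of Bl" S A V \<psi>
  using O pfd closed UA
  by unfold_locales (auto simp: universal_acting_def action_def meas_cosupp_def)

text \<open>
  The comeasuring corestricts to \<open>X\<close>, so universality gives an algebra map \<open>Br \<rightarrow> X\<close>, and by uniqueness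
  its composite with the inclusion is the identity.
\<close>

lemma coefficients_generate:
  assumes X: "X \<subseteq> carr Br" "module.subspace (scale Br) X" "one Br \<in> X"
    and Xm: "\<And>x y. x \<in> X \<Longrightarrow> y \<in> X \<Longrightarrow> mul Br x y \<in> X"
    and coeff: "\<And>a \<alpha>. a \<in> carr A \<Longrightarrow> lin_map A fld \<alpha> \<Longrightarrow> tcoeff A Br \<alpha> (\<rho> a) \<in> X"
  shows "X = carr Br"
proof -
  define K where "K = \<lparr>scale = scale Br, carr = X, mul = mul Br, one = one Br\<rparr>"
  have K [simp]: "scale K = scale Br" "carr K = X" "mul K = mul Br" "one K = one Br"
    by (simp_all add: K_def)
  have vsK: "is_vspace K" using avs X(2) by (simp add: is_vspace_def)
  have incl: "lin_map K Br (\<lambda>x. x)" using X(1) by (intro lin_mapI) auto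
  have algK: "algebra K"
    unfolding algebra_def
  proof (intro conjI ballI vsK bilinearI lin_mapI)
    fix x y z c assume x: "x \<in> carr K" and y: "y \<in> carr K"
    then have xB: "x \<in> carr Br" and yB: "y \<in> carr Br" using X(1) by auto
    show "mul K x y \<in> carr K" using Xm x y by simp
    show "mul K x y \<in> carr K" using Xm x y by simp
    show "mul K x (scale K c y) = scale K c (mul K x y)"
      using lin_map_scale[OF mul_lin_right[OF xB] yB] by simp
    show "mul K (scale K c y) x = scale K c (mul K y x)"
      using lin_map_scale[OF mul_lin_left[OF xB] yB] by simp
    assume z: "z \<in> carr K"
    then have zB: "z \<in> carr Br" using X(1) by auto
    show "mul K x (y + z) = mul K x y + mul K x z"
      using lin_map_add[OF mul_lin_right[OF xB] yB zB] by simp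
    show "mul K (y + z) x = mul K y x + mul K z x"
      using lin_map_add[OF mul_lin_left[OF xB] yB zB] by simp
    show "mul K (mul K x y) z = mul K x (mul K y z)" by (simp add: mul_assoc xB yB zB)
  next
    fix x assume "x \<in> carr K"
    then have "x \<in> carr Br" using X(1) by auto
    then show "mul K (one K) x = x" "mul K x (one K) = x" by (simp_all add: mul_one_left mul_one_right)
  qed (use X in simp)
  let ?\<iota> = "zrestr K (\<lambda>x. x)"
  have \<iota>: "alg_hom K Br ?\<iota>"
    unfolding alg_hom_def using zrestr_Hom[OF vsK incl] Xm X(3) by simp
  note \<iota>l = alg_homD(2)[OF \<iota>]
  have inj: "q = 0" if "q \<in> carr K" "?\<iota> q = 0" for q using that by simp
  \<comment> \<open>After \<open>tensor_expand\<close> the right factors of \<open>\<rho> a\<close>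
    are coefficients, which lie in \<open>X\<close>.\<close>
  have ex: "\<exists>t. t \<in> carr (tensor A K) \<and> tmap A K Br ?\<iota> t = \<rho> a" if a: "a \<in> carr A" for a
  proof -
    obtain L where L: "\<And>\<alpha> b. (\<alpha>, b) \<in> set L \<Longrightarrow> b \<in> carr A \<and> lin_map A fld \<alpha>"
      "\<rho> a = (\<Sum>(\<alpha>, b)\<leftarrow>L. tens A Br b (tcoeff A Br \<alpha> (\<rho> a)))"
      using tensor_expand[OF A avs \<rho>_carr[OF a]] by fastforce
    let ?t = "\<Sum>z\<leftarrow>L. tens A K (snd z) (tcoeff A Br (fst z) (\<rho> a))"
    have Lz: "snd z \<in> carr A" "tcoeff A Br (fst z) (\<rho> a) \<in> X" if "z \<in> set L" for z
      using L(1)[of "fst z" "snd z"] that coeff[OF a] by auto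
    have t: "?t \<in> carr (tensor A K)"
      using Lz by (intro carr_sum_list is_vspace_tensor tens_carr) auto
    have "tmap A K Br ?\<iota> ?t = (\<Sum>z\<leftarrow>L. tmap A K Br ?\<iota> (tens A K (snd z) (tcoeff A Br (fst z) (\<rho> a))))"
      using Lz by (intro lin_map_sum_list[OF tmap_lin[OF \<iota>l]] is_vspace_tensor tens_carr) auto
    also have "\<dots> = (\<Sum>z\<leftarrow>L. tens A Br (snd z) (tcoeff A Br (fst z) (\<rho> a)))"
      by (rule sum_list_cong) (use Lz in \<open>simp add: tmap_tens \<iota>l\<close>)
    also have "\<dots> = \<rho> a" using L(2) by (simp add: case_prod_unfold)
    finally show ?thesis using t by blast
  qed
  \<comment> \<open>The inclusion stays injective after tensoring with \<open>A\<close>, so the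
    choice is forced and linear in \<open>a\<close>.\<close>
  define \<rho>K where "\<rho>K a = (SOME t. t \<in> carr (tensor A K) \<and> tmap A K Br ?\<iota> t = \<rho> a)" for a
  have \<rho>K: "\<rho>K a \<in> carr (tensor A K)" "tmap A K Br ?\<iota> (\<rho>K a) = \<rho> a" if "a \<in> carr A" for a
    using someI_ex[OF ex[OF that]] unfolding \<rho>K_def by auto
  note tl = tmap_lin[OF \<iota>l, of A]
  note tinj = tmap_inj[OF A vsK avs \<iota>l inj]
  have \<rho>Kl: "lin_map A (tensor A K) \<rho>K"
  proof (rule lin_mapI)
    fix a b c assume a: "a \<in> carr A"
    show "\<rho>K a \<in> carr (tensor A K)" by (rule \<rho>K(1)[OF a])
    show "\<rho>K (scale A c a) = scale (tensor A K) c (\<rho>K a)"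
      by (rule tinj) (simp_all only: \<rho>K a carr_scale[OF A] carr_scale[OF is_vspace_tensor]
          lin_map_scale[OF tl] lin_map_scale[OF \<rho>_lin])
    assume b: "b \<in> carr A"
    show "\<rho>K (a + b) = \<rho>K a + \<rho>K b"
      by (rule tinj) (simp_all only: \<rho>K a b carr_add[OF A] carr_add[OF is_vspace_tensor]
          lin_map_add[OF tl] lin_map_add[OF \<rho>_lin])
  qed
  have comK: "comeasuring S A K \<rho>K"
    by (rule comeasuring_of_tmap[OF O algK algebra \<iota> inj \<rho>Kl comeasuring]) (simp_all add: \<rho>K)
  have "comeas_cosupp A K \<rho>K \<subseteq> comeas_cosupp A Br \<rho>"
  proof
    fix h assume "h \<in> comeas_cosupp A K \<rho>K"
    then obtain f where f: "f \<in> Hom K fld" "h = zrestr A (coact_dual A K \<rho>K f)"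
      by (auto simp: comeas_cosupp_def)
    have fl: "lin_map K fld f" using f(1) by (rule Hom_lin)
    \<comment> \<open>A form on the subalgebra extends to \<open>Br\<close> and gives the same map
      on \<open>A\<close>, so corestriction adds nothing to the cosupport.\<close>
    obtain g where g: "Vector_Spaces.linear (scale Br) (*) g" "\<And>x. x \<in> X \<Longrightarrow> g x = f x"
      using form_extend[OF avs X(2), of f] lin_map_add[OF fl] lin_map_scale[OF fl] by auto
    note gl = linear_lin_map[OF g(1)]
    let ?g = "zrestr Br g"
    have gH: "?g \<in> Hom Br fld" by (rule zrestr_Hom[OF avs gl])
    have "h = zrestr A (coact_dual A Br \<rho> ?g)"
      unfolding f(2)
    proof (rule zrestr_eqI)
      fix a assume a: "a \<in> carr A"
      have "coact_dual A Br \<rho> ?g a = tcontr A Br ?g (tmap A K Br ?\<iota> (\<rho>K a))"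
        by (simp add: coact_dual_tcontr \<rho>K a)
      also have "\<dots> = tcontr A K (\<lambda>x. ?g (?\<iota> x)) (\<rho>K a)"
        by (rule tcontr_tmap[OF A \<iota>l Hom_lin[OF gH] \<rho>K(1)[OF a]])
      also have "\<dots> = tcontr A K f (\<rho>K a)"
        by (rule tcontr_cong[OF A vsK lin_map_comp[OF \<iota>l Hom_lin[OF gH]] _ \<rho>K(1)[OF a]])
          (use X(1) g(2) in auto)
      finally show "coact_dual A K \<rho>K f a = coact_dual A Br \<rho> ?g a" by (simp add: coact_dual_tcontr)
    qed
    then show "h \<in> comeas_cosupp A Br \<rho>" using gH by (auto simp: comeas_cosupp_def)
  qed
  then have cosK: "comeas_cosupp A K \<rho>K \<subseteq> V" using cosupp_Br by blast
  obtain jK :: "'q \<Rightarrow> 'u \<Rightarrow> 'f" where jK: "lin_map K fun_space jK" "inj_on jK (carr K)"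
    using embed_vspace[OF eq vsK] by blast
  obtain \<phi> where \<phi>: "alg_hom Br K \<phi>" "\<And>a. a \<in> carr A \<Longrightarrow> tmap A Br K \<phi> (\<rho> a) = \<rho>K a"
    using universal_coacting_any[OF UC O algK jK comK cosK] by blast
  obtain jB :: "'q \<Rightarrow> 'u \<Rightarrow> 'f" where jB: "lin_map Br fun_space jB" "inj_on jB (carr Br)"
    using embed_vspace[OF eq avs] by blast
  note uniq = universal_coacting_any[OF UC O algebra jB comeasuring cosupp_Br]
  note \<phi>l = alg_homD(2)[OF \<phi>(1)]
  let ?c = "zrestr Br (\<lambda>x. ?\<iota> (\<phi> x))"
  have "tmap A Br Br ?c (\<rho> a) = \<rho> a" if a: "a \<in> carr A" for a
  proof -
    have "tmap A Br Br ?c (\<rho> a) = tmap A Br Br (\<lambda>x. ?\<iota> (\<phi> x)) (\<rho> a)"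
      by (rule tmap_cong[OF A avs lin_map_comp[OF \<phi>l \<iota>l] _ \<rho>_carr[OF a], symmetric]) simp
    also have "\<dots> = tmap A K Br ?\<iota> (tmap A Br K \<phi> (\<rho> a))"
      by (rule tmap_tmap[OF A \<phi>l \<iota>l \<rho>_carr[OF a], symmetric])
    finally show ?thesis by (simp add: \<phi>(2) \<rho>K a)
  qed
  moreover have "tmap A Br Br (zrestr Br (\<lambda>x. x)) (\<rho> a) = \<rho> a" if "a \<in> carr A" for a
    by (rule tmap_ident[OF A \<rho>_carr[OF that] _ avs]) simp
  ultimately have c: "?c = zrestr Br (\<lambda>x. x)"
    using uniq alg_hom_comp[OF algebra \<phi>(1) \<iota>] alg_hom_ident[OF algebra] by blast
  have "\<phi> b = b" if "b \<in> carr Br" for b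
    using fun_cong[OF c, of b] that lin_map_carr[OF \<phi>l that] by simp
  then show ?thesis using X(1) lin_map_carr[OF \<phi>l] by auto
qed

end

lemma equalizer_subspace:
  assumes V: "is_vspace V" and f: "\<And>i. i \<in> I \<Longrightarrow> lin_map V fld (f i)" and g: "\<And>i. i \<in> I \<Longrightarrow> lin_map V fld (g i)"
  shows "module.subspace (scale V) {x \<in> carr V. \<forall>i\<in>I. f i x = g i x}"
proof -
  have "module (scale V)" using V by (simp add: is_vspace_def vector_space_def module_def)
  then show ?thesis
    unfolding module.subspace_def[OF \<open>module (scale V)\<close>]
    by (simp add: vs_carr[OF V] lin_map_zero[OF f V] lin_map_zero[OF g V] lin_map_add[OF f] lin_map_add[OF g]
        lin_map_scale[OF f] lin_map_scale[OF g])
qed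

section \<open>The mutually inverse maps \<theta> and \<beta>\<close>

context universal_pair
begin

text \<open>Universality is applied to the underlying measuring of the action, so the unique map is
  so far only a coalgebra map.\<close>

lemma ex_\<theta>: "\<exists>!\<theta>. coalg_hom (coalg_of (fdual Br)) (coalg_of Bl) \<theta> \<and>
    (\<forall>f\<in>carr (fdual Br). \<forall>a\<in>carr A. \<psi> (\<theta> f) a = coact_dual A Br \<rho> f a)"
proof -
  obtain j :: "('q \<Rightarrow> 'f) \<Rightarrow> 'u \<Rightarrow> 'f"
    where j: "lin_map (coalg_of (fdual Br)) fun_space j" "inj_on j (carr (coalg_of (fdual Br)))"
    using embed_functions[OF eq, of "coalg_of (fdual Br)"] by auto
  have "measuring S A (coalg_of (fdual Br)) (coact_dual A Br \<rho>)"
    using action_fdual by (simp add: action_def)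
  moreover have "meas_cosupp A (coalg_of (fdual Br)) (coact_dual A Br \<rho>) \<subseteq> V"
    using fdual_cosupp cosupp_Br by (auto simp: meas_cosupp_def)
  ultimately show ?thesis
    using universal_acting_any[OF UA O coalgebra_fdual j] by simp
qed

definition \<theta> where
  "\<theta> = (THE \<theta>. coalg_hom (coalg_of (fdual Br)) (coalg_of Bl) \<theta> \<and>
    (\<forall>f\<in>carr (fdual Br). \<forall>a\<in>carr A. \<psi> (\<theta> f) a = coact_dual A Br \<rho> f a))"

lemma \<theta>_hom: "coalg_hom (coalg_of (fdual Br)) (coalg_of Bl) \<theta>"
  and \<theta>_act: "f \<in> carr (fdual_space Br) \<Longrightarrow> a \<in> carr A \<Longrightarrow> \<psi> (\<theta> f) a = coact_dual A Br \<rho> f a"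
  using theI'[OF ex_\<theta>] unfolding \<theta>_def[symmetric] by auto

lemma \<theta>_carr: "f \<in> carr (fdual_space Br) \<Longrightarrow> \<theta> f \<in> carr Bl"
  using lin_map_carr[OF coalg_homD(2)[OF \<theta>_hom]] by simp

lemma ex_\<phi>: "\<exists>!\<phi>. alg_hom Br (dual_alg (coalg_of Bl)) \<phi> \<and>
    (\<forall>a\<in>carr A. tmap A Br (dual_alg (coalg_of Bl)) \<phi> (\<rho> a) = vm.\<rho> a)"
proof -
  obtain j :: "('p \<Rightarrow> 'f) \<Rightarrow> 'u \<Rightarrow> 'f"
    where "lin_map (dual_alg (coalg_of Bl)) fun_space j" "inj_on j (carr (dual_alg (coalg_of Bl)))"
    using embed_functions[OF ep, of "dual_alg (coalg_of Bl)"] by auto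
  from universal_coacting_any[OF UC O L.co.algebra_dual this vm.comeasuring_\<rho> vm.comeas_cosupp_\<rho>]
  show ?thesis .
qed

definition \<phi> where
  "\<phi> = (THE \<phi>. alg_hom Br (dual_alg (coalg_of Bl)) \<phi> \<and>
    (\<forall>a\<in>carr A. tmap A Br (dual_alg (coalg_of Bl)) \<phi> (\<rho> a) = vm.\<rho> a))"

lemma \<phi>_hom: "alg_hom Br (dual_alg (coalg_of Bl)) \<phi>"
  and \<phi>_\<rho>: "a \<in> carr A \<Longrightarrow> tmap A Br (dual_alg (coalg_of Bl)) \<phi> (\<rho> a) = vm.\<rho> a"
  using theI'[OF ex_\<phi>] unfolding \<phi>_def[symmetric] by auto

lemma \<phi>_Hom: "b \<in> carr Br \<Longrightarrow> \<phi> b \<in> Hom Bl fld"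
  using lin_map_carr[OF alg_homD(2)[OF \<phi>_hom]] by simp

lemma \<phi>_lin: "lin_map Br fld (\<lambda>b. \<phi> b p)"
  using alg_homD(2)[OF \<phi>_hom] by (simp add: lin_map_def)

lemma \<phi>_mul:
  assumes "x \<in> carr Br" "y \<in> carr Br" "p \<in> carr Bl"
  shows "\<phi> (mul Br x y) p = (\<Sum>(p1, p2)\<leftarrow>cop (coalg_of Bl) p. \<phi> x p1 * \<phi> y p2)"
  using alg_homD(4)[OF \<phi>_hom assms(1,2)] L.co.dual_mul[of "\<phi> x" "\<phi> y" p]
    assms by (simp add: Hom_lin[OF \<phi>_Hom])

lemma \<phi>_one: "p \<in> carr Bl \<Longrightarrow> \<phi> (one Br) p = bcounit Bl p"
  using alg_homD(3)[OF \<phi>_hom] by simp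

definition \<beta> where
  "\<beta> = zrestr Bl (\<lambda>p. zrestr Br (\<lambda>b. \<phi> b p))"

lemma \<beta>_apply: "p \<in> carr Bl \<Longrightarrow> b \<in> carr Br \<Longrightarrow> \<beta> p b = \<phi> b p"
  by (simp add: \<beta>_def)

lemma Lcop: "p \<in> carr Bl \<Longrightarrow> z \<in> set (cop (coalg_of Bl) p) \<Longrightarrow> fst z \<in> carr Bl \<and> snd z \<in> carr Bl"
  using L.co.cop_carr[of p "fst z" "snd z"] by simp

lemma \<beta>_mul:
  assumes "p \<in> carr Bl" "x \<in> carr Br" "y \<in> carr Br"
  shows "\<beta> p (mul Br x y) = (\<Sum>(p1, p2)\<leftarrow>cop (coalg_of Bl) p. \<beta> p1 x * \<beta> p2 y)"
  unfolding case_prod_unfold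
  by (simp add: \<beta>_apply mul_carr assms \<phi>_mul case_prod_unfold)
    (rule sum_list_cong, simp add: \<beta>_apply assms Lcop[OF assms(1)])

text \<open>The coproduct of \<open>p\<close> splits the values of \<open>\<beta> p\<close> at
  products, so \<open>\<beta> p\<close> has finite rank.\<close>

lemma \<beta>_carr:
  assumes p: "p \<in> carr Bl"
  shows "\<beta> p \<in> carr (fdual_space Br)"
proof (rule fdualI)
  show "\<beta> p \<in> Hom Br fld" using p by (simp add: \<beta>_def zrestr_Hom[OF avs \<phi>_lin])
  show "mul_rep Br (\<beta> p) (map (\<lambda>z. (\<lambda>x. \<phi> x (fst z), \<lambda>y. \<phi> y (snd z))) (cop (coalg_of Bl) p))"
    by (auto simp: mul_rep_def \<phi>_lin \<beta>_apply p mul_carr \<phi>_mul comp_def case_prod_unfold)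
qed

lemma \<beta>_lin: "lin_map Bl (fdual_space Br) \<beta>"
proof (rule lin_mapI)
  fix p q c assume p: "p \<in> carr Bl"
  show "\<beta> p \<in> carr (fdual_space Br)" by (rule \<beta>_carr[OF p])
  have out: "\<beta> r b = 0" if "b \<notin> carr Br" for r b using that by (simp add: \<beta>_def zrestr_def)
  show "\<beta> (scale Bl c p) = scale (fdual_space Br) c (\<beta> p)"
  proof
    fix b show "\<beta> (scale Bl c p) b = scale (fdual_space Br) c (\<beta> p) b"
      using lin_map_scale[OF Hom_lin[OF \<phi>_Hom] p] by (cases "b \<in> carr Br") (simp_all add: \<beta>_apply p carr_scale[OF L.avs] out)
  qed
  assume q: "q \<in> carr Bl"
  show "\<beta> (p + q) = \<beta> p + \<beta> q"
  proof
    fix b show "\<beta> (p + q) b = (\<beta> p + \<beta> q) b"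
      using lin_map_add[OF Hom_lin[OF \<phi>_Hom] p q] by (cases "b \<in> carr Br") (simp_all add: \<beta>_apply p q carr_add[OF L.avs] out)
  qed
qed

lemma \<beta>_Hom: "\<beta> \<in> Hom Bl (fdual Br)"
proof -
  have "lin_map Bl (fdual Br) \<beta>" using \<beta>_lin by simp
  then show ?thesis by (simp add: Hom_def) (simp add: \<beta>_def zrestr_def)
qed

text \<open>The coproduct of \<open>\<beta> p\<close> is characterised by the values of
  \<open>\<beta> p\<close> at products, which \<open>\<beta>_mul\<close> computes from the coproduct
  of \<open>p\<close>.\<close>

lemma \<beta>_hom: "coalg_hom (coalg_of Bl) (coalg_of (fdual Br)) \<beta>"
proof -
  let ?D = "fdual_space Br"
  have b: "bilinear (coalg_of Bl) (coalg_of Bl) (tensor ?D ?D) (\<lambda>x y. tens ?D ?D (\<beta> x) (\<beta> y))"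
    using bilinear_maps[OF bilinear_tens \<beta>_lin \<beta>_lin] by simp
  have "dcomul Br (\<beta> p) = (\<Sum>(x, y)\<leftarrow>cop (coalg_of Bl) p. tens ?D ?D (\<beta> x) (\<beta> y))" if p: "p \<in> carr Bl" for p
  proof (rule dcomul_eqI)
    have c: "tens ?D ?D (\<beta> (fst z)) (\<beta> (snd z)) \<in> carr (tensor ?D ?D)" if "z \<in> set (cop (coalg_of Bl) p)" for z
      using Lcop[OF p that] by (intro tens_carr \<beta>_carr) auto
    show "(\<Sum>(x, y)\<leftarrow>cop (coalg_of Bl) p. tens ?D ?D (\<beta> x) (\<beta> y)) \<in> carr (tensor ?D ?D)"
      unfolding case_prod_unfold by (intro carr_sum_list is_vspace_tensor c)
    fix x y assume xy: "x \<in> carr Br" "y \<in> carr Br"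
    have "tlift ?D ?D fld (\<lambda>f1 f2. f1 x * f2 y) (\<Sum>z\<leftarrow>cop (coalg_of Bl) p. tens ?D ?D (\<beta> (fst z)) (\<beta> (snd z))) =
        (\<Sum>z\<leftarrow>cop (coalg_of Bl) p. tlift ?D ?D fld (\<lambda>f1 f2. f1 x * f2 y) (tens ?D ?D (\<beta> (fst z)) (\<beta> (snd z))))"
      by (rule lin_map_sum_list[OF tlift_lin[OF is_vspace_fld eval_bilinear] is_vspace_tensor c])
    also have "\<dots> = (\<Sum>z\<leftarrow>cop (coalg_of Bl) p. \<beta> (fst z) x * \<beta> (snd z) y)"
      by (rule sum_list_cong, rule tlift_tens[OF is_vspace_fld eval_bilinear]) (use Lcop[OF p] \<beta>_carr in auto)
    also have "\<dots> = \<beta> p (mul Br x y)" by (simp add: \<beta>_mul p xy case_prod_unfold)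
    finally show "tlift ?D ?D fld (\<lambda>f1 f2. f1 x * f2 y)
        (\<Sum>(x, y)\<leftarrow>cop (coalg_of Bl) p. tens ?D ?D (\<beta> x) (\<beta> y)) = \<beta> p (mul Br x y)"
      by (simp add: case_prod_unfold)
  qed
  then have "\<forall>p\<in>carr Bl. dcomul Br (\<beta> p) = tlift Bl Bl (tensor ?D ?D) (\<lambda>x y. tens ?D ?D (\<beta> x) (\<beta> y)) (bcomul Bl p)"
    using L.co.cop_tlift[OF is_vspace_tensor b] by simp
  moreover have "\<beta> p (one Br) = bcounit Bl p" if "p \<in> carr Bl" for p
    using that by (simp add: \<beta>_apply one_carr \<phi>_one)
  moreover have "\<beta> \<in> Hom (coalg_of Bl) (coalg_of (fdual Br))"
    using \<beta>_Hom by (simp add: Hom_def)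
  ultimately show ?thesis by (simp add: coalg_hom_def)
qed

text \<open>Contracting \<open>\<rho> a\<close> by \<open>\<beta> p\<close> amounts to applying
  \<open>\<phi>\<close> to the coefficients and then evaluating at \<open>p\<close>; the first
  operation gives the dual comeasuring, the second recovers \<open>\<psi>\<close>.\<close>

lemma \<beta>_act:
  assumes p: "p \<in> carr Bl" and a: "a \<in> carr A"
  shows "coact_dual A Br \<rho> (\<beta> p) a = \<psi> p a"
proof -
  let ?E = "dual_alg (coalg_of Bl)"
  note l = alg_homD(2)[OF \<phi>_hom]
  have "coact_dual A Br \<rho> (\<beta> p) a = coact_dual A Br \<rho> (\<lambda>b. \<phi> b p) a"
    by (rule coact_cong[OF \<phi>_lin _ a, symmetric]) (simp add: \<beta>_apply p)
  also have "\<dots> = tcontr A ?E (\<lambda>c. c p) (tmap A Br ?E \<phi> (\<rho> a))"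
    unfolding coact_dual_tcontr by (rule tcontr_tmap[OF A l vm.ev_lin \<rho>_carr[OF a], symmetric])
  also have "\<dots> = \<psi> p a"
    using vm.\<rho>_ev[OF a, of p] p by (simp add: \<phi>_\<rho> a)
  finally show ?thesis .
qed

lemmas fdual_co = fd.precoalg_axioms and Bl_co = L.co.precoalg_axioms

text \<open>The composite and the identity are coalgebra endomorphisms of \<open>Bl\<close>
  compatible with \<open>\<psi>\<close>, so terminality identifies them.\<close>

lemma \<theta>\<beta>:
  assumes p: "p \<in> carr Bl"
  shows "\<theta> (\<beta> p) = p"
proof -
  obtain j :: "'p \<Rightarrow> 'u \<Rightarrow> 'f"
    where j: "lin_map (coalg_of Bl) fun_space j" "inj_on j (carr (coalg_of Bl))"
    using embed_vspace[OF ep L.co.vs] by blast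
  note uniq = universal_acting_any[OF UA O L.co.coalgebra j vm.meas vm.cosupp]
  let ?c = "zrestr (coalg_of Bl) (\<lambda>x. \<theta> (\<beta> x))" and ?i = "zrestr (coalg_of Bl) (\<lambda>x. x)"
  have "coalg_hom (coalg_of Bl) (coalg_of Bl) ?c"
    by (rule coalg_hom_comp[OF Bl_co fdual_co \<beta>_hom \<theta>_hom Bl_co])
  moreover have "\<psi> (?c p) a = \<psi> p a" if "p \<in> carr (coalg_of Bl)" "a \<in> carr A" for p a
    using that by (simp add: \<theta>_act \<beta>_act \<beta>_carr)
  moreover have "coalg_hom (coalg_of Bl) (coalg_of Bl) ?i" by (rule coalg_hom_ident[OF Bl_co])
  moreover have "\<psi> (?i p) a = \<psi> p a" if "p \<in> carr (coalg_of Bl)" for p a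
    using that by simp
  ultimately have eq: "?c = ?i" using uniq by blast
  show ?thesis using fun_cong[OF eq, of p] p by simp
qed

lemma \<beta>\<theta>:
  assumes f: "f \<in> carr (fdual_space Br)"
  shows "\<beta> (\<theta> f) = f"
proof -
  let ?D = "fdual_space Br"
  let ?g = "zrestr (coalg_of (fdual Br)) (\<lambda>f. \<beta> (\<theta> f))"
  have g: "coalg_hom (coalg_of (fdual Br)) (coalg_of (fdual Br)) ?g"
    by (rule coalg_hom_comp[OF fdual_co Bl_co \<theta>_hom \<beta>_hom fdual_co])
  note gl = coalg_homD(2)[OF g]
  have gc: "\<beta> (\<theta> f) \<in> carr ?D" if "f \<in> carr ?D" for f by (rule \<beta>_carr[OF \<theta>_carr[OF that]])
  note lin = Hom_lin[OF fdual_Hom]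
  \<comment> \<open>All \<open>f\<close> are treated at once: closure under products needs the
    equality for the two components of the coproduct of \<open>f\<close>.\<close>
  let ?X = "{b \<in> carr Br. \<forall>f\<in>carr ?D. \<beta> (\<theta> f) b = f b}"
  have "?X = carr Br"
  proof (rule coefficients_generate)
    show "module.subspace (scale Br) ?X"
      by (rule equalizer_subspace[OF avs lin[OF gc] lin])
    have "\<beta> (\<theta> f) (one Br) = f (one Br)" if "f \<in> carr ?D" for f
      using coalg_homD(3)[OF g, of f] that by simp
    then show "one Br \<in> ?X" by (simp add: one_carr)
    fix x y assume x: "x \<in> ?X" and y: "y \<in> ?X"
    then have xy: "x \<in> carr Br" "y \<in> carr Br" by auto
    have "\<beta> (\<theta> f) (mul Br x y) = f (mul Br x y)" if f: "f \<in> carr ?D" for f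
    proof -
      have fC: "f \<in> carr (coalg_of (fdual Br))" using f by simp
      have b: "bilinear (coalg_of (fdual Br)) (coalg_of (fdual Br)) fld (\<lambda>u v. u x * v y)"
        using eval_bilinear by simp
      have "\<beta> (\<theta> f) (mul Br x y) = (\<Sum>(u, v)\<leftarrow>cop (coalg_of (fdual Br)) (?g f). u x * v y)"
        using cop_fdual[OF gc[OF f] xy] f by simp
      also have "\<dots> = (\<Sum>(u, v)\<leftarrow>cop (coalg_of (fdual Br)) f. ?g u x * ?g v y)"
        by (rule coalg_hom_cop[OF fdual_co fdual_co gl fC coalg_homD(4)[OF g fC] is_vspace_fld b])
      also have "\<dots> = (\<Sum>(u, v)\<leftarrow>cop (coalg_of (fdual Br)) f. u x * v y)"
        by (rule fd.cop_cong[OF fC]) (use x y in simp)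
      also have "\<dots> = f (mul Br x y)" by (rule cop_fdual[OF f xy, symmetric])
      finally show ?thesis .
    qed
    then show "mul Br x y \<in> ?X" using mul_carr[OF xy] by blast
  next
    fix a \<alpha> assume a: "a \<in> carr A" and \<alpha>: "lin_map A fld \<alpha>"
    have "\<beta> (\<theta> f) (tcoeff A Br \<alpha> (\<rho> a)) = f (tcoeff A Br \<alpha> (\<rho> a))" if f: "f \<in> carr ?D" for f
      using coact_tcoeff[OF lin[OF f] \<alpha> a] coact_tcoeff[OF lin[OF gc[OF f]] \<alpha> a]
      by (simp add: \<beta>_act \<theta>_carr f a \<theta>_act)
    then show "tcoeff A Br \<alpha> (\<rho> a) \<in> ?X"
      using lin_map_carr[OF tcoeff_lin[OF avs \<alpha>] \<rho>_carr[OF a]] by blast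
  qed auto
  then have "\<beta> (\<theta> f) b = f b" if "b \<in> carr Br" for b using that f by blast
  then show ?thesis
    by (rule Hom_eqI[OF fdual_Hom[OF gc[OF f]] fdual_Hom[OF f]])
qed

lemma \<beta>_one: "\<beta> (one Bl) = zrestr Br (bcounit Br)"
proof -
  let ?X = "{b \<in> carr Br. \<beta> (one Bl) b = bcounit Br b}"
  note l1 = Hom_lin[OF fdual_Hom[OF \<beta>_carr[OF L.one_carr]]]
  have l2: "lin_map Br fld (bcounit Br)" using co.counit_lin by simp
  have "?X = carr Br"
  proof (rule coefficients_generate)
    show "module.subspace (scale Br) ?X"
      using equalizer_subspace[OF avs, of "{()}" "\<lambda>_. \<beta> (one Bl)" "\<lambda>_. bcounit Br"] l1 l2 by simp
    show "one Br \<in> ?X" by (simp add: one_carr \<beta>_apply L.one_carr \<phi>_one L.counit_one counit_one)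
    fix x y assume x: "x \<in> ?X" and y: "y \<in> ?X"
    then have xy: "x \<in> carr Br" "y \<in> carr Br" by auto
    have b: "bilinear Bl Bl fld (\<lambda>u v. \<beta> u x * \<beta> v y)"
      by (rule bilinear_mult) (rule lin_map_comp[OF \<beta>_lin eval_lin])+
    show "mul Br x y \<in> ?X"
      using L.cop_one[OF is_vspace_fld b] x y
      by (simp add: \<beta>_mul L.one_carr mul_carr counit_mul)
  next
    fix a \<alpha> assume a: "a \<in> carr A" and \<alpha>: "lin_map A fld \<alpha>"
    have "coact_dual A Br \<rho> (bcounit Br) a = a"
      using coact_cong[OF l2 _ a, of "zrestr Br (bcounit Br)"] coact_counit[OF a] by simp
    moreover have "\<psi> (one Bl) a = a" using action a by (simp add: action_def)
    ultimately show "tcoeff A Br \<alpha> (\<rho> a) \<in> ?X"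
      using coact_tcoeff[OF l1 \<alpha> a] coact_tcoeff[OF l2 \<alpha> a] \<beta>_act[OF L.one_carr a]
        lin_map_carr[OF tcoeff_lin[OF avs \<alpha>] \<rho>_carr[OF a]] by simp
  qed auto
  then show ?thesis
    by (intro Hom_eqI[OF fdual_Hom[OF \<beta>_carr[OF L.one_carr]] fdual_Hom[OF counit_fdual]]) auto
qed

lemma \<beta>_prod:
  assumes p: "p \<in> carr Bl" and q: "q \<in> carr Bl"
  shows "\<beta> (mul Bl p q) = mul (fdual Br) (\<beta> p) (\<beta> q)"
proof -
  \<comment> \<open>Again for all \<open>p\<close> and \<open>q\<close> together, since at a product
    the components of both coproducts enter.\<close>
  let ?X = "{b \<in> carr Br. \<forall>p\<in>carr Bl. \<forall>q\<in>carr Bl. \<beta> (mul Bl p q) b = mul (fdual Br) (\<beta> p) (\<beta> q) b}"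
  have c1: "\<beta> (mul Bl p q) \<in> carr (fdual_space Br)" if "p \<in> carr Bl" "q \<in> carr Bl" for p q
    by (rule \<beta>_carr[OF L.mul_carr[OF that]])
  have c2: "mul (fdual Br) (\<beta> p) (\<beta> q) \<in> carr (fdual_space Br)" if "p \<in> carr Bl" "q \<in> carr Bl" for p q
    by (rule conv_carr[OF \<beta>_carr[OF that(1)] \<beta>_carr[OF that(2)]])
  note l1 = Hom_lin[OF fdual_Hom[OF c1]] and l2 = Hom_lin[OF fdual_Hom[OF c2]]
  have "?X = carr Br"
  proof (rule coefficients_generate)
    have "module.subspace (scale Br) {b \<in> carr Br. \<forall>z\<in>carr Bl \<times> carr Bl.
        \<beta> (mul Bl (fst z) (snd z)) b = mul (fdual Br) (\<beta> (fst z)) (\<beta> (snd z)) b}"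
      by (rule equalizer_subspace[OF avs]) (auto intro: l1 l2)
    also have "{b \<in> carr Br. \<forall>z\<in>carr Bl \<times> carr Bl.
        \<beta> (mul Bl (fst z) (snd z)) b = mul (fdual Br) (\<beta> (fst z)) (\<beta> (snd z)) b} = ?X" by auto
    finally show "module.subspace (scale Br) ?X" .
    have "\<beta> (mul Bl p q) (one Br) = mul (fdual Br) (\<beta> p) (\<beta> q) (one Br)"
      if p: "p \<in> carr Bl" and q: "q \<in> carr Bl" for p q
    proof -
      note H = fdual_Hom[OF \<beta>_carr[OF p]] fdual_Hom[OF \<beta>_carr[OF q]]
      have "mul (fdual Br) (\<beta> p) (\<beta> q) (one Br) = \<beta> p (one Br) * \<beta> q (one Br)"
        using cop_one[OF is_vspace_fld bilinear_mult[OF H[THEN Hom_lin]]]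
        by (simp add: conv_apply H one_carr)
      then show ?thesis
        using p q by (simp add: \<beta>_apply one_carr \<phi>_one L.mul_carr L.counit_mul)
    qed
    then show "one Br \<in> ?X" by (simp add: one_carr)
    fix x y assume x: "x \<in> ?X" and y: "y \<in> ?X"
    then have xy: "x \<in> carr Br" "y \<in> carr Br" by auto
    have "\<beta> (mul Bl p q) (mul Br x y) = mul (fdual Br) (\<beta> p) (\<beta> q) (mul Br x y)"
      if p: "p \<in> carr Bl" and q: "q \<in> carr Bl" for p q
    proof -
      let ?C = "cop (coalg_of Bl)"
      have b: "bilinear Bl Bl fld (\<lambda>u v. \<beta> u x * \<beta> v y)"
        by (rule bilinear_mult) (rule lin_map_comp[OF \<beta>_lin eval_lin])+
      let ?M = "\<lambda>r. map (\<lambda>z. (\<beta> (fst z), \<beta> (snd z))) (?C r)"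
      have M: "set (?M r) \<subseteq> Hom Br fld \<times> Hom Br fld" if "r \<in> carr Bl" for r
        using Lcop[OF that] fdual_Hom[OF \<beta>_carr] by auto
      have M': "\<beta> r (mul Br u v) = (\<Sum>(g, h)\<leftarrow>?M r. g u * h v)"
        if "r \<in> carr Bl" "u \<in> carr Br" "v \<in> carr Br" for r u v
        by (simp add: \<beta>_mul that comp_def case_prod_unfold)
      have "\<beta> (mul Bl p q) (mul Br x y) =
          (\<Sum>z\<leftarrow>?C p. \<Sum>w\<leftarrow>?C q. \<beta> (mul Bl (fst z) (fst w)) x * \<beta> (mul Bl (snd z) (snd w)) y)"
        using L.cop_mul[OF is_vspace_fld b p q] by (simp add: \<beta>_mul L.mul_carr p q xy case_prod_unfold)
      also have "\<dots> = (\<Sum>z\<leftarrow>?C p. \<Sum>w\<leftarrow>?C q.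
          mul (fdual Br) (\<beta> (fst z)) (\<beta> (fst w)) x * mul (fdual Br) (\<beta> (snd z)) (\<beta> (snd w)) y)"
        using x y by (intro sum_list_cong) (simp add: Lcop[OF p] Lcop[OF q])
      also have "\<dots> = (\<Sum>(f1, f2)\<leftarrow>?M p. \<Sum>(g1, g2)\<leftarrow>?M q. mul (fdual Br) f1 g1 x * mul (fdual Br) f2 g2 y)"
        by (simp add: comp_def case_prod_unfold)
      also have "\<dots> = mul (fdual Br) (\<beta> p) (\<beta> q) (mul Br x y)"
        by (rule conv_mul[OF fdual_Hom[OF \<beta>_carr[OF p]] fdual_Hom[OF \<beta>_carr[OF q]]
              M[OF p] M[OF q] M'[OF p] M'[OF q] xy, symmetric])
      finally show ?thesis .
    qed
    then show "mul Br x y \<in> ?X" using mul_carr[OF xy] by blast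
  next
    fix a \<alpha> assume a: "a \<in> carr A" and \<alpha>: "lin_map A fld \<alpha>"
    have "\<beta> (mul Bl p q) (tcoeff A Br \<alpha> (\<rho> a)) = mul (fdual Br) (\<beta> p) (\<beta> q) (tcoeff A Br \<alpha> (\<rho> a))"
      if p: "p \<in> carr Bl" and q: "q \<in> carr Bl" for p q
    proof -
      have "\<psi> (mul Bl p q) a = \<psi> p (\<psi> q a)" using action a p q by (simp add: action_def)
      moreover have "\<psi> q a \<in> carr A"
        using lin_map_carr[OF bilinear_left[OF vm.\<psi>_bilinear a], of q] q by simp
      ultimately show ?thesis
        using coact_tcoeff[OF l1[OF p q] \<alpha> a] coact_tcoeff[OF l2[OF p q] \<alpha> a]
          coact_mul[OF fdual_Hom[OF \<beta>_carr[OF p]] fdual_Hom[OF \<beta>_carr[OF q]] a]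
        by (simp add: \<beta>_act p q a L.mul_carr)
    qed
    then show "tcoeff A Br \<alpha> (\<rho> a) \<in> ?X"
      using lin_map_carr[OF tcoeff_lin[OF avs \<alpha>] \<rho>_carr[OF a]] by blast
  qed auto
  then show ?thesis
    using p q by (intro Hom_eqI[OF fdual_Hom[OF c1[OF p q]] fdual_Hom[OF c2[OF p q]]]) blast
qed

lemma \<beta>_iso: "bialg_iso Bl (fdual Br) \<beta>"
proof -
  have "bij_betw \<beta> (carr Bl) (carr (fdual_space Br))"
    by (rule bij_betwI[where g = \<theta>]) (auto simp: \<beta>_carr \<theta>_carr \<theta>\<beta> \<beta>\<theta>)
  then show ?thesis
    using \<beta>_hom \<beta>_Hom \<beta>_prod \<beta>_one by (simp add: bialg_iso_def bialg_hom_def alg_hom_def)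
qed

text \<open>As the inverse of the multiplicative and unital \<open>\<beta>\<close>, the coalgebra
  map \<theta> is multiplicative and unital too.\<close>

lemma \<theta>_iso: "bialg_iso (fdual Br) Bl \<theta>"
proof -
  have "bij_betw \<theta> (carr (fdual_space Br)) (carr Bl)"
    by (rule bij_betwI[where g = \<beta>]) (auto simp: \<beta>_carr \<theta>_carr \<theta>\<beta> \<beta>\<theta>)
  moreover have "\<theta> (mul (fdual Br) f g) = mul Bl (\<theta> f) (\<theta> g)"
    if f: "f \<in> carr (fdual_space Br)" and g: "g \<in> carr (fdual_space Br)" for f g
    using \<beta>_prod[OF \<theta>_carr[OF f] \<theta>_carr[OF g]] \<theta>\<beta>[OF L.mul_carr[OF \<theta>_carr[OF f] \<theta>_carr[OF g]]]
    by (simp add: \<beta>\<theta> f g)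
  moreover have "\<theta> (zrestr Br (bcounit Br)) = one Bl"
    using \<theta>\<beta>[OF L.one_carr] by (simp add: \<beta>_one)
  moreover have "\<theta> \<in> Hom (fdual Br) Bl"
    using coalg_homD(1)[OF \<theta>_hom] by (simp add: Hom_def)
  ultimately show ?thesis
    using \<theta>_hom by (simp add: bialg_iso_def bialg_hom_def alg_hom_def)
qed

end

section \<open>Finite dimensional algebras and coalgebras as special cases\<close>

lemma tpower_space_cong:
  assumes "scale V = scale V'" "carr V = carr V'"
  shows "tpower V n = tpower V' n"
proof -
  have t: "tuples V n = tuples V' n" using assms by (simp add: tuples_def)
  have "multilinear V n fld = (multilinear V' n fld :: ('b list \<Rightarrow> 'a) \<Rightarrow> bool)"
    by (intro ext) (simp add: multilinear_def t lin_map_cong_dom[OF assms])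
  then have "ptens V n = ptens V' n" by (simp add: ptens_def fun_eq_iff)
  then show ?thesis by (simp add: tpower_def t)
qed

text \<open>The full endomorphism space is the whole topological space, hence closed, and every
  orbit lies in the finite dimensional carrier.\<close>

lemma Hom_fin_dim:
  assumes "scale A' = scale A" "carr A' = carr A" and fd: "fin_dim (scale A) (carr A)"
  shows "pointwise_fin_dim A' (Hom A A)" "closedin (finite_topology A') (Hom A A)"
proof -
  have "Hom A A = Hom A' A'" using assms by (simp add: Hom_def lin_map_def)
  then show "closedin (finite_topology A') (Hom A A)"
    using closedin_topspace[of "finite_topology A'"] by (simp add: topspace_finite_topology)
  show "pointwise_fin_dim A' (Hom A A)"
    unfolding pointwise_fin_dim_def assms(1,2)
  proof
    fix a assume a: "a \<in> carr A"
    have "{v a | v. v \<in> Hom A A} \<subseteq> carr A" using lin_map_carr[OF Hom_lin a] by blast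
    then show "fin_dim (scale A) {v a | v. v \<in> Hom A A}" using fd unfolding fin_dim_def by blast
  qed
qed

lemma alg_oalg_sel [simp]: "scale (alg_oalg A) = scale A" "carr (alg_oalg A) = carr A"
  by (simp_all add: alg_oalg_def)

lemma coalg_oalg_sel [simp]: "scale (coalg_oalg C) = scale C" "carr (coalg_oalg C) = carr C"
  by (simp_all add: coalg_oalg_def)

lemma omega_algebra_alg_oalg:
  assumes "algebra A"
  shows "omega_algebra alg_sig (alg_oalg A)"
proof -
  interpret alg_struct A by unfold_locales (rule assms)
  have tp: "tpower (alg_oalg A) n = tpower A n" for n by (rule tpower_space_cong) simp_all
  have p1: "lin_map A (tpower A (Suc 0)) (\<lambda>x. ptens A (Suc 0) [x])"
    using multilinear_ptens[of A "Suc 0"] by (simp add: multilinear_Suc)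
  have "multilinear A (Suc (Suc 0)) (tpower A (Suc 0)) (\<lambda>xs. ptens A (Suc 0) [mul A (xs ! 0) (xs ! Suc 0)])"
    unfolding multilinear_Suc
    by (auto simp: multilinear_0 elim!: tuples_SucE
        intro!: lin_map_comp[OF mul_lin_left p1] lin_map_comp[OF mul_lin_right p1] ptens_carr mul_carr)
  then have m: "multilinear A 2 (tpower A 1) (\<lambda>xs. ptens A 1 [mul A (xs ! 0) (xs ! 1)])"
    by (simp add: numeral_2_eq_2)
  have u: "multilinear A 0 (tpower A 1) (\<lambda>_. ptens A 1 [one A])"
    by (simp add: multilinear_0 ptens_carr one_carr)
  have "is_vspace (alg_oalg A)" using avs by (simp add: is_vspace_def)
  then show ?thesis
    using plift_lin[OF is_vspace_tpower m] plift_lin[OF is_vspace_tpower u]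
    by (auto simp: omega_algebra_def alg_sig_def tp) (simp_all add: alg_oalg_def)
qed

lemma omega_algebra_coalg_oalg:
  assumes "coalgebra C"
  shows "omega_algebra coalg_sig (coalg_oalg C)"
proof -
  interpret coalg C by unfold_locales (rule assms)
  have tp: "tpower (coalg_oalg C) n = tpower C n" for n by (rule tpower_space_cong) simp_all
  have b: "bilinear C C (tpower C 2) (\<lambda>x y. ptens C 2 [x, y])"
    using multilinear_ptens[of C "Suc (Suc 0)"]
    by (auto simp: multilinear_Suc numeral_2_eq_2 intro!: bilinearI)
  have "lin_map C (tpower C 2) (\<lambda>x. tlift C C (tpower C 2) (\<lambda>x y. ptens C 2 [x, y]) (comul C x))"
    by (rule lin_map_comp[OF comul_lin tlift_lin[OF is_vspace_tpower b]])
  then have d: "multilinear C 1 (tpower C 2)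
      (\<lambda>xs. tlift C C (tpower C 2) (\<lambda>x y. ptens C 2 [x, y]) (comul C (xs ! 0)))"
    by (auto simp: multilinear_Suc multilinear_0 intro: lin_map_carr)
  have "lin_map C (tpower C 0) (\<lambda>x. scale (tpower C 0) (counit C x) (ptens C 0 []))"
    by (intro lin_map_scale_vec is_vspace_tpower counit_lin ptens_carr) simp
  then have l: "lin_map C (tpower C 0) (\<lambda>x. fscale (counit C x) (ptens C 0 []))"
    by (simp del: fscale_apply)
  then have e: "multilinear C 1 (tpower C 0) (\<lambda>xs. fscale (counit C (xs ! 0)) (ptens C 0 []))"
    using lin_map_carr[OF l] by (simp add: multilinear_Suc multilinear_0 del: fscale_apply)
  have "is_vspace (coalg_oalg C)" using vs by (simp add: is_vspace_def)
  then show ?thesis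
    using plift_lin[OF is_vspace_tpower d] plift_lin[OF is_vspace_tpower e]
    by (auto simp: omega_algebra_def coalg_sig_def tp) (simp_all add: coalg_oalg_def)
qed

lemma universal_pairI:
  assumes "omega_algebra S A" "pointwise_fin_dim A V" "closedin (finite_topology A) V"
    and "universal_acting TYPE('u \<Rightarrow> 'f::field) S A V (Bl :: ('f, 'p::ab_group_add) bialg) \<psi>"
    and "universal_coacting TYPE('u \<Rightarrow> 'f) S A V (Br :: ('f, 'q::ab_group_add) bialg) \<rho>"
    and "inj (ep :: 'p \<Rightarrow> 'u)" "inj (eq :: 'q \<Rightarrow> 'u)"
  shows "universal_pair Br S A \<rho> V Bl \<psi> ep eq"
  using assms by unfold_locales (auto simp: universal_coacting_def)

theorem theorem4p14:
  assumes "infinite (UNIV :: 'u set)"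
    and "\<exists>e :: 'p::ab_group_add \<Rightarrow> 'u. inj e"
    and "\<exists>e :: 'q::ab_group_add \<Rightarrow> 'u. inj e"
  shows
    "(\<forall>(S :: 'o sig) (A :: ('f::field, 'a::ab_group_add, 'o) oalg) V
        (Bl :: ('f, 'p) bialg) \<psi> (Br :: ('f, 'q) bialg) \<rho>.
        omega_algebra S A \<and> unital_subalgebra A V \<and> pointwise_fin_dim A V \<and>
        closedin (finite_topology A) V \<and>
        universal_acting TYPE('u \<Rightarrow> 'f) S A V Bl \<psi> \<and>
        universal_coacting TYPE('u \<Rightarrow> 'f) S A V Br \<rho> \<longrightarrow>
        bialgebra (fdual Br) \<and> action S A (fdual Br) (coact_dual A Br \<rho>) \<and>
        (\<exists>!\<theta>. bialg_hom (fdual Br) Bl \<theta> \<and>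
           (\<forall>f\<in>carr (fdual Br). \<forall>a\<in>carr A. \<psi> (\<theta> f) a = coact_dual A Br \<rho> f a)) \<and>
        (\<forall>\<theta>. bialg_hom (fdual Br) Bl \<theta> \<and>
           (\<forall>f\<in>carr (fdual Br). \<forall>a\<in>carr A. \<psi> (\<theta> f) a = coact_dual A Br \<rho> f a) \<longrightarrow>
           bialg_iso (fdual Br) Bl \<theta>)) \<and>
     (\<forall>(A :: ('f, 'a) alg) (Bl :: ('f, 'p) bialg) \<psi> (Br :: ('f, 'q) bialg) \<rho>.
        algebra A \<and> fin_dim (scale A) (carr A) \<and>
        universal_acting TYPE('u \<Rightarrow> 'f) alg_sig (alg_oalg A) (Hom A A) Bl \<psi> \<and>
        universal_coacting TYPE('u \<Rightarrow> 'f) alg_sig (alg_oalg A) (Hom A A) Br \<rho> \<longrightarrow>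
        (\<exists>\<theta>. bialg_iso Bl (fdual Br) \<theta>)) \<and>
     (\<forall>(C :: ('f, 'a) coalg) (Bl :: ('f, 'p) bialg) \<psi> (Br :: ('f, 'q) bialg) \<rho>.
        coalgebra C \<and> fin_dim (scale C) (carr C) \<and>
        universal_acting TYPE('u \<Rightarrow> 'f) coalg_sig (coalg_oalg C) (Hom C C) Bl \<psi> \<and>
        universal_coacting TYPE('u \<Rightarrow> 'f) coalg_sig (coalg_oalg C) (Hom C C) Br \<rho> \<longrightarrow>
        (\<exists>\<theta>. bialg_iso Bl (fdual Br) \<theta>))"
proof -
  obtain ep :: "'p \<Rightarrow> 'u" where ep: "inj ep" using assms(2) by blast
  obtain eq :: "'q \<Rightarrow> 'u" where eq: "inj eq" using assms(3) by blast
  show ?thesis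
  proof (intro conjI allI impI; elim conjE)
    fix S :: "'o sig" and A :: "('f, 'a, 'o) oalg" and V and Bl :: "('f, 'p) bialg" and \<psi>
      and Br :: "('f, 'q) bialg" and \<rho>
    assume H: "omega_algebra S A" "pointwise_fin_dim A V" "closedin (finite_topology A) V"
      "universal_acting TYPE('u \<Rightarrow> 'f) S A V Bl \<psi>" "universal_coacting TYPE('u \<Rightarrow> 'f) S A V Br \<rho>"
    interpret universal_pair Br S A \<rho> V Bl \<psi> ep eq by (rule universal_pairI[OF H ep eq])
    \<comment> \<open>A bialgebra map is in particular a coalgebra map, and among those compatible
      with the actions \<theta> is the only one.\<close>
    have unique: "\<chi> = \<theta>" if "bialg_hom (fdual Br) Bl \<chi>"
      "\<forall>f\<in>carr (fdual Br). \<forall>a\<in>carr A. \<psi> (\<chi> f) a = coact_dual A Br \<rho> f a" for \<chi>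
      using ex_\<theta> \<theta>_hom \<theta>_act that by (auto simp: bialg_hom_def)
    show "bialgebra (fdual Br)" by (rule bialgebra_fdual)
    show "action S A (fdual Br) (coact_dual A Br \<rho>)" by (rule action_fdual)
    show "\<exists>!\<theta>. bialg_hom (fdual Br) Bl \<theta> \<and>
        (\<forall>f\<in>carr (fdual Br). \<forall>a\<in>carr A. \<psi> (\<theta> f) a = coact_dual A Br \<rho> f a)"
    proof (rule ex1I[of _ \<theta>])
      show "bialg_hom (fdual Br) Bl \<theta> \<and>
          (\<forall>f\<in>carr (fdual Br). \<forall>a\<in>carr A. \<psi> (\<theta> f) a = coact_dual A Br \<rho> f a)"
        using \<theta>_iso \<theta>_act by (simp add: bialg_iso_def)
    qed (use unique in blast)
    show "bialg_iso (fdual Br) Bl \<chi>" if "bialg_hom (fdual Br) Bl \<chi>"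
      "\<forall>f\<in>carr (fdual Br). \<forall>a\<in>carr A. \<psi> (\<chi> f) a = coact_dual A Br \<rho> f a" for \<chi>
      using unique[OF that] \<theta>_iso by simp
  next
    fix A :: "('f, 'a) alg" and Bl :: "('f, 'p) bialg" and \<psi> and Br :: "('f, 'q) bialg" and \<rho>
    assume H: "algebra A" "fin_dim (scale A) (carr A)"
      "universal_acting TYPE('u \<Rightarrow> 'f) alg_sig (alg_oalg A) (Hom A A) Bl \<psi>"
      "universal_coacting TYPE('u \<Rightarrow> 'f) alg_sig (alg_oalg A) (Hom A A) Br \<rho>"
    interpret universal_pair Br alg_sig "alg_oalg A" \<rho> "Hom A A" Bl \<psi> ep eq
      by (rule universal_pairI[OF omega_algebra_alg_oalg[OF H(1)] Hom_fin_dim[OF _ _ H(2)] H(3,4) ep eq]) simp_all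
    \<comment> \<open>The isomorphism is asked for out of the acting bialgebra, so \<beta> is the
      witness here.\<close>
    show "\<exists>\<theta>. bialg_iso Bl (fdual Br) \<theta>" using \<beta>_iso by blast
  next
    fix C :: "('f, 'a) coalg" and Bl :: "('f, 'p) bialg" and \<psi> and Br :: "('f, 'q) bialg" and \<rho>
    assume H: "coalgebra C" "fin_dim (scale C) (carr C)"
      "universal_acting TYPE('u \<Rightarrow> 'f) coalg_sig (coalg_oalg C) (Hom C C) Bl \<psi>"
      "universal_coacting TYPE('u \<Rightarrow> 'f) coalg_sig (coalg_oalg C) (Hom C C) Br \<rho>"
    interpret universal_pair Br coalg_sig "coalg_oalg C" \<rho> "Hom C C" Bl \<psi> ep eq
      by (rule universal_pairI[OF omega_algebra_coalg_oalg[OF H(1)] Hom_fin_dim[OF _ _ H(2)] H(3,4) ep eq]) simp_all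
    show "\<exists>\<theta>. bialg_iso Bl (fdual Br) \<theta>" using \<beta>_iso by blast
  qed
qed

end
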